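(* Let $K$ be a field and let $(\mathcal{C},\mathbb{E},\mathfrak{s})$ be a small $K$-linear extriangulated category such that $\mathcal{C}$ is $\mathrm{Hom}$-finite over $K$ (all $\mathcal{C}(X,Y)$ are finite-dimensional), with enough projective objects and enough injective objects. Then the following are equivalent. (1) For every injective object $I\in\mathcal{C}$ and every inflation $x\colon A\to B$ the map $\mathcal{C}(I,x)\colon\mathcal{C}(I,A)\to\mathcal{C}(I,B)$ is injective, and for every projective object $P\in\mathcal{C}$ and every deflation $y\colon B\to C$ the map $\mathcal{C}(y,P)\colon\mathcal{C}(C,P)\to\mathcal{C}(B,P)$ is injective. (2) $\dim_K\mathbb{E}_{\mathrm{I}}^{-1}(X,Y)=\dim_K\mathbb{E}_{\mathrm{II}}^{-1}(X,Y)$ for all $X,Y\in\mathcal{C}$. (3) $\dim_K\mathbb{E}_{\mathrm{I}}^{-n}(X,Y)=\dim_K\mathbb{E}_{\mathrm{II}}^{-n}(X,Y)$ for all $X,Y\in\mathcal{C}$ and all $n>0$.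
   Context: Put $R=K$; $\mathcal{C}$ is an additive $R$-linear category. Extriangulated categories: let $\mathbb{E}\colon\mathcal{C}^{\mathrm{op}}\times\mathcal{C}\to\mathrm{Mod}\,R$ be an $R$-bilinear functor. An element $\delta\in\mathbb{E}(C,A)$ is called an extension; for $a\colon A\to A'$ and $c\colon C'\to C$ put $a_*\delta=\mathbb{E}(C,a)(\delta)$ and $c^*\delta=\mathbb{E}(c,A)(\delta)$. A morphism of extensions from $\delta\in\mathbb{E}(C,A)$ to $\delta'\in\mathbb{E}(C',A')$ is a pair $(a\colon A\to A',\,c\colon C\to C')$ with $a_*\delta=c^*\delta'$. The extension $\delta\oplus\delta'\in\mathbb{E}(C\oplus C',A\oplus A')$ is the one with diagonal components $\delta,\delta'$ and zero off-diagonal components. Sequences $A\xrightarrow{x}B\xrightarrow{y}C$ and $A\xrightarrow{x'}B'\xrightarrow{y'}C$ are equivalent if there is an isomorphism $b\colon B\to B'$ with $bx=x'$, $y'b=y$; the class is written $[A\xrightarrow{x}B\xrightarrow{y}C]$. An additive realization $\mathfrak{s}$ assigns to each $\delta\in\mathbb{E}(C,A)$ such a class $\mathfrak{s}(\delta)=[A\xrightarrow{x}B\xrightarrow{y}C]$ so that: for each morphism $(a,c)\colon\delta\to\delta'$ with $\mathfrak{s}(\delta')=[A'\xrightarrow{x'}B'\xrightarrow{y'}C']$ there is $b\colon B\to B'$ with $bx=x'a$, $y'b=cy$; $\mathfrak{s}(0)=[A\to A\oplus C\to C]$ (canonical maps); and $\mathfrak{s}(\delta\oplus\delta')=\mathfrak{s}(\delta)\oplus\mathfrak{s}(\delta')$.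 The triple $(\mathcal{C},\mathbb{E},\mathfrak{s})$ is an ($R$-linear) extriangulated category if moreover: (ET3) if $\mathfrak{s}(\delta)=[A\xrightarrow{x}B\xrightarrow{y}C]$, $\mathfrak{s}(\delta')=[A'\xrightarrow{x'}B'\xrightarrow{y'}C']$ and $bx=x'a$, then there is $c$ with $cy=y'b$ and $a_*\delta=c^*\delta'$; (ET3)$^{\mathrm{op}}$ the dual; (ET4) if $\delta\in\mathbb{E}(D,A)$ and $\delta'\in\mathbb{E}(F,B)$ are realized by $A\xrightarrow{f}B\xrightarrow{f'}D$ and $B\xrightarrow{g}C\xrightarrow{g'}F$, then there are an object $E$, morphisms $d\colon D\to E$, $e\colon E\to F$, $h=gf$, $h'\colon C\to E$ with $h'g=df'$, $eh'=g'$, and $\delta''\in\mathbb{E}(E,A)$ realized by $A\xrightarrow{h}C\xrightarrow{h'}E$, such that $D\xrightarrow{d}E\xrightarrow{e}F$ realizes $f'_*\delta'$, $d^*\delta''=\delta$ and $f_*\delta''=e^*\delta'$; (ET4)$^{\mathrm{op}}$ the dual. If $\mathfrak{s}(\delta)=[A\xrightarrow{x}B\xrightarrow{y}C]$ one writes $A\xrightarrow{x}B\xrightarrow{y}C\overset{\delta}{\dashrightarrow}$ and calls it an $\mathfrak{s}$-triangle; $x$ is an inflation, $y$ a deflation, $A\to B\to C$ a conflation. An object $P$ is projective if $\mathbb{E}(P,-)=0$, and $I$ is injective if $\mathbb{E}(-,I)=0$. There are enough projective (resp. injective) objects if every object $C$ admits a deflation $P\to C$ with $P$ projective (resp. every object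 $A$ admits an inflation $A\to I$ with $I$ injective). $\mathrm{Mod}\,\mathcal{C}$ (resp. $\mathcal{C}\,\mathrm{Mod}$) is the category of $R$-linear functors $\mathcal{C}^{\mathrm{op}}\to\mathrm{Mod}\,R$ (resp. $\mathcal{C}\to\mathrm{Mod}\,R$). Positive extensions: $\mathbb{E}^0=\mathcal{C}(-,-)$, $\mathbb{E}^1=\mathbb{E}$, and inductively $\mathbb{E}^n(X,Y)=\int^{M\in\mathcal{C}}\mathbb{E}^{n-1}(M,Y)\otimes_R\mathbb{E}(X,M)$ (coend). Negative extensions, for $n>0$: $\mathbb{E}_{\mathrm{I}}^{-n}(X,Y)=(\mathcal{C}\,\mathrm{Mod})(\mathbb{E}^n(Y,-),\mathcal{C}(X,-))$ and $\mathbb{E}_{\mathrm{II}}^{-n}(X,Y)=(\mathrm{Mod}\,\mathcal{C})(\mathbb{E}^n(-,X),\mathcal{C}(-,Y))$. *)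

theory Defs
  imports "Jordan_Normal_Form.Missing_VectorSpace" "HOL-Algebra.AbelCoset"
begin

section \<open>Small linear categories\<close>

text \<open>
  The objects of a small category are the elements of the type \<open>'o\<close>. Composition is not indexed
  by objects. As arrows can be tagged with their source and target (hom-sets are conventionally
  disjoint), this is no restriction; disjointness of the hom-sets is not required below.
\<close>

record ('k, 'o, 'm) lincat =
  Hom :: "'o \<Rightarrow> 'o \<Rightarrow> ('k, 'm) module"
  Comp :: "'m \<Rightarrow> 'm \<Rightarrow> 'm"  (infixl \<open>\<cdot>\<index>\<close> 75)
  Ident :: "'o \<Rightarrow> 'm"

abbreviation Arr :: "('k, 'o, 'm, 'z) lincat_scheme \<Rightarrow> 'o \<Rightarrow> 'o \<Rightarrow> 'm set" where
  "Arr \<C> A B \<equiv> carrier (Hom \<C> A B)"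

locale linear_category =
  fixes K :: "'k ring" and \<C> :: "('k, 'o, 'm, 'z) lincat_scheme" (structure)
  assumes field_K: "field K"
    and vectorspace_Hom: "vectorspace K (Hom \<C> A B)"
    and Ident_Arr: "Ident \<C> A \<in> Arr \<C> A A"
    and Comp_Arr: "\<lbrakk>f \<in> Arr \<C> A B; g \<in> Arr \<C> B D\<rbrakk> \<Longrightarrow> g \<cdot> f \<in> Arr \<C> A D"
    and Comp_assoc: "\<lbrakk>f \<in> Arr \<C> A B; g \<in> Arr \<C> B D; h \<in> Arr \<C> D F\<rbrakk> \<Longrightarrow> h \<cdot> g \<cdot> f = h \<cdot> (g \<cdot> f)"
    and Comp_Ident_right: "f \<in> Arr \<C> A B \<Longrightarrow> f \<cdot> Ident \<C> A = f"
    and Comp_Ident_left: "f \<in> Arr \<C> A B \<Longrightarrow> Ident \<C> B \<cdot> f = f"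
    and Comp_linear_right: "g \<in> Arr \<C> B D \<Longrightarrow> (\<lambda>f. g \<cdot> f) \<in> module_hom K (Hom \<C> A B) (Hom \<C> A D)"
    and Comp_linear_left: "f \<in> Arr \<C> A B \<Longrightarrow> (\<lambda>g. g \<cdot> f) \<in> module_hom K (Hom \<C> B D) (Hom \<C> A D)"

definition iso_arrow :: "('k, 'o, 'm, 'z) lincat_scheme \<Rightarrow> 'o \<Rightarrow> 'o \<Rightarrow> 'm \<Rightarrow> bool" where
  "iso_arrow \<C> A B f \<longleftrightarrow> f \<in> Arr \<C> A B \<and>
    (\<exists>g \<in> Arr \<C> B A. g \<cdot>\<^bsub>\<C>\<^esub> f = Ident \<C> A \<and> f \<cdot>\<^bsub>\<C>\<^esub> g = Ident \<C> B)"

definition is_biproduct ::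
    "('k, 'o, 'm, 'z) lincat_scheme \<Rightarrow> 'o \<Rightarrow> 'o \<Rightarrow> 'o \<Rightarrow> 'm \<Rightarrow> 'm \<Rightarrow> 'm \<Rightarrow> 'm \<Rightarrow> bool" where
  "is_biproduct \<C> A B S i j p q \<longleftrightarrow>
     i \<in> Arr \<C> A S \<and> j \<in> Arr \<C> B S \<and> p \<in> Arr \<C> S A \<and> q \<in> Arr \<C> S B \<and>
     p \<cdot>\<^bsub>\<C>\<^esub> i = Ident \<C> A \<and> q \<cdot>\<^bsub>\<C>\<^esub> j = Ident \<C> B \<and>
     q \<cdot>\<^bsub>\<C>\<^esub> i = \<zero>\<^bsub>Hom \<C> A B\<^esub> \<and> p \<cdot>\<^bsub>\<C>\<^esub> j = \<zero>\<^bsub>Hom \<C> B A\<^esub> \<and>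
     (i \<cdot>\<^bsub>\<C>\<^esub> p) \<oplus>\<^bsub>Hom \<C> S S\<^esub> (j \<cdot>\<^bsub>\<C>\<^esub> q) = Ident \<C> S"

locale additive_linear_category = linear_category +
  assumes zero_object: "\<exists>Z. \<forall>A. Arr \<C> Z A = {\<zero>\<^bsub>Hom \<C> Z A\<^esub>} \<and> Arr \<C> A Z = {\<zero>\<^bsub>Hom \<C> A Z\<^esub>}"
    and biproducts: "\<exists>S i j p q. is_biproduct \<C> A B S i j p q"

definition hom_finite :: "'k ring \<Rightarrow> ('k, 'o, 'm, 'z) lincat_scheme \<Rightarrow> bool" where
  "hom_finite K \<C> \<longleftrightarrow> (\<forall>X Y. vectorspace.fin_dim K (Hom \<C> X Y))"

section \<open>Bifunctors with values in vector spaces\<close>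

text \<open>
  \<open>Val F X Y\<close> is \<open>F(X, Y)\<close>, contravariant in \<open>X\<close> and covariant in \<open>Y\<close>. For \<open>c : X \<rightarrow> X'\<close> the map
  \<open>Pull F X X' Y c : F(X', Y) \<rightarrow> F(X, Y)\<close> is \<open>c\<^sup>*\<close>, and for \<open>a : Y \<rightarrow> Y'\<close> the map
  \<open>Push F X Y Y' a : F(X, Y) \<rightarrow> F(X, Y')\<close> is \<open>a\<^sub>*\<close>.
\<close>

record ('k, 'o, 'm, 'x) bifunctor =
  Val :: "'o \<Rightarrow> 'o \<Rightarrow> ('k, 'x) module"
  Pull :: "'o \<Rightarrow> 'o \<Rightarrow> 'o \<Rightarrow> 'm \<Rightarrow> 'x \<Rightarrow> 'x"
  Push :: "'o \<Rightarrow> 'o \<Rightarrow> 'o \<Rightarrow> 'm \<Rightarrow> 'x \<Rightarrow> 'x"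

locale bilinear_bifunctor = linear_category K \<C>
  for K :: "'k ring" and \<C> :: "('k, 'o, 'm, 'z) lincat_scheme" (structure) +
  fixes F :: "('k, 'o, 'm, 'x) bifunctor"
  assumes vectorspace_Val: "vectorspace K (Val F X Y)"
    and Pull_hom: "c \<in> Arr \<C> X X' \<Longrightarrow> Pull F X X' Y c \<in> module_hom K (Val F X' Y) (Val F X Y)"
    and Push_hom: "a \<in> Arr \<C> Y Y' \<Longrightarrow> Push F X Y Y' a \<in> module_hom K (Val F X Y) (Val F X Y')"
    and Pull_Ident: "\<delta> \<in> carrier (Val F X Y) \<Longrightarrow> Pull F X X Y (Ident \<C> X) \<delta> = \<delta>"
    and Push_Ident: "\<delta> \<in> carrier (Val F X Y) \<Longrightarrow> Push F X Y Y (Ident \<C> Y) \<delta> = \<delta>"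
    and Pull_Comp: "\<lbrakk>c \<in> Arr \<C> X X'; c' \<in> Arr \<C> X' X''; \<delta> \<in> carrier (Val F X'' Y)\<rbrakk>
          \<Longrightarrow> Pull F X X'' Y (c' \<cdot> c) \<delta> = Pull F X X' Y c (Pull F X' X'' Y c' \<delta>)"
    and Push_Comp: "\<lbrakk>a \<in> Arr \<C> Y Y'; a' \<in> Arr \<C> Y' Y''; \<delta> \<in> carrier (Val F X Y)\<rbrakk>
          \<Longrightarrow> Push F X Y Y'' (a' \<cdot> a) \<delta> = Push F X Y' Y'' a' (Push F X Y Y' a \<delta>)"
    and Push_Pull: "\<lbrakk>c \<in> Arr \<C> X X'; a \<in> Arr \<C> Y Y'; \<delta> \<in> carrier (Val F X' Y)\<rbrakk>
          \<Longrightarrow> Push F X Y Y' a (Pull F X X' Y c \<delta>) = Pull F X X' Y' c (Push F X' Y Y' a \<delta>)"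
    and Pull_linear: "\<delta> \<in> carrier (Val F X' Y)
          \<Longrightarrow> (\<lambda>c. Pull F X X' Y c \<delta>) \<in> module_hom K (Hom \<C> X X') (Val F X Y)"
    and Push_linear: "\<delta> \<in> carrier (Val F X Y)
          \<Longrightarrow> (\<lambda>a. Push F X Y Y' a \<delta>) \<in> module_hom K (Hom \<C> Y Y') (Val F X Y')"

definition hom_bifunctor :: "('k, 'o, 'm, 'z) lincat_scheme \<Rightarrow> ('k, 'o, 'm, 'm) bifunctor" where
  "hom_bifunctor \<C> = \<lparr>Val = Hom \<C>,
     Pull = (\<lambda>X X' Y c f. f \<cdot>\<^bsub>\<C>\<^esub> c), Push = (\<lambda>X Y Y' a f. a \<cdot>\<^bsub>\<C>\<^esub> f)\<rparr>"

section \<open>Extriangulated categories\<close>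

text \<open>
  \<open>Rlz \<C> Z A \<delta>\<close>, for \<open>\<delta> \<in> \<E>(Z, A)\<close>, is the class of sequences \<open>A \<rightarrow> B \<rightarrow> Z\<close> assigned to \<open>\<delta>\<close>; such a
  sequence is represented by the triple \<open>(x, B, y)\<close>.
\<close>

record ('k, 'o, 'm, 'e) extricat = "('k, 'o, 'm) lincat" +
  Ext :: "('k, 'o, 'm, 'e) bifunctor"
  Rlz :: "'o \<Rightarrow> 'o \<Rightarrow> 'e \<Rightarrow> ('m \<times> 'o \<times> 'm) set"

abbreviation Extn :: "('k, 'o, 'm, 'e, 'z) extricat_scheme \<Rightarrow> 'o \<Rightarrow> 'o \<Rightarrow> 'e set" where
  "Extn \<C> Z A \<equiv> carrier (Val (Ext \<C>) Z A)"

definition seq_class ::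
    "('k, 'o, 'm, 'z) lincat_scheme \<Rightarrow> 'o \<Rightarrow> 'm \<Rightarrow> 'o \<Rightarrow> 'm \<Rightarrow> 'o \<Rightarrow> ('m \<times> 'o \<times> 'm) set" where
  "seq_class \<C> A x B y Z = {(x', B', y'). x' \<in> Arr \<C> A B' \<and> y' \<in> Arr \<C> B' Z \<and>
     (\<exists>b. iso_arrow \<C> B B' b \<and> b \<cdot>\<^bsub>\<C>\<^esub> x = x' \<and> y' \<cdot>\<^bsub>\<C>\<^esub> b = y)}"

definition s_triangle ::
    "('k, 'o, 'm, 'e, 'z) extricat_scheme \<Rightarrow> 'o \<Rightarrow> 'm \<Rightarrow> 'o \<Rightarrow> 'm \<Rightarrow> 'o \<Rightarrow> 'e \<Rightarrow> bool" where
  "s_triangle \<C> A x B y Z \<delta> \<longleftrightarrow> \<delta> \<in> Extn \<C> Z A \<and> (x, B, y) \<in> Rlz \<C> Z A \<delta>"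

text \<open>
  A direct sum \<open>A \<oplus> A'\<close> is any biproduct of \<open>A\<close> and \<open>A'\<close>; accordingly the two additivity axioms
  are stated for all choices of biproducts.
\<close>

locale extriangulated_category =
  additive_linear_category K \<C> + bilinear_bifunctor K \<C> "Ext \<C>"
  for K :: "'k ring" and \<C> :: "('k, 'o, 'm, 'e, 'z) extricat_scheme" (structure) +
  assumes Rlz_class: "\<delta> \<in> Extn \<C> Z A
        \<Longrightarrow> \<exists>x B y. x \<in> Arr \<C> A B \<and> y \<in> Arr \<C> B Z \<and> Rlz \<C> Z A \<delta> = seq_class \<C> A x B y Z"
    and realization: "\<lbrakk>s_triangle \<C> A x B y Z \<delta>; s_triangle \<C> A' x' B' y' Z' \<delta>';
          a \<in> Arr \<C> A A'; c \<in> Arr \<C> Z Z';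
          Push (Ext \<C>) Z A A' a \<delta> = Pull (Ext \<C>) Z Z' A' c \<delta>'\<rbrakk>
        \<Longrightarrow> \<exists>b \<in> Arr \<C> B B'. b \<cdot> x = x' \<cdot> a \<and> y' \<cdot> b = c \<cdot> y"
    and realization_zero: "is_biproduct \<C> A Z S i j p q
        \<Longrightarrow> Rlz \<C> Z A \<zero>\<^bsub>Val (Ext \<C>) Z A\<^esub> = seq_class \<C> A i S q Z"
    and realization_sum: "\<lbrakk>s_triangle \<C> A x B y Z \<delta>; s_triangle \<C> A' x' B' y' Z' \<delta>';
          is_biproduct \<C> A A' SA iA jA pA qA;
          is_biproduct \<C> B B' SB iB jB pB qB;
          is_biproduct \<C> Z Z' SZ iZ jZ pZ qZ;
          \<sigma> \<in> Extn \<C> SZ SA;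
          Push (Ext \<C>) Z SA A pA (Pull (Ext \<C>) Z SZ SA iZ \<sigma>) = \<delta>;
          Push (Ext \<C>) Z' SA A' qA (Pull (Ext \<C>) Z' SZ SA jZ \<sigma>) = \<delta>';
          Push (Ext \<C>) Z SA A' qA (Pull (Ext \<C>) Z SZ SA iZ \<sigma>) = \<zero>\<^bsub>Val (Ext \<C>) Z A'\<^esub>;
          Push (Ext \<C>) Z' SA A pA (Pull (Ext \<C>) Z' SZ SA jZ \<sigma>) = \<zero>\<^bsub>Val (Ext \<C>) Z' A\<^esub>\<rbrakk>
        \<Longrightarrow> Rlz \<C> SZ SA \<sigma> = seq_class \<C> SA
              ((iB \<cdot> x \<cdot> pA) \<oplus>\<^bsub>Hom \<C> SA SB\<^esub> (jB \<cdot> x' \<cdot> qA)) SB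
              ((iZ \<cdot> y \<cdot> pB) \<oplus>\<^bsub>Hom \<C> SB SZ\<^esub> (jZ \<cdot> y' \<cdot> qB)) SZ"
    and ET3: "\<lbrakk>s_triangle \<C> A x B y Z \<delta>; s_triangle \<C> A' x' B' y' Z' \<delta>';
          a \<in> Arr \<C> A A'; b \<in> Arr \<C> B B'; b \<cdot> x = x' \<cdot> a\<rbrakk>
        \<Longrightarrow> \<exists>c \<in> Arr \<C> Z Z'. c \<cdot> y = y' \<cdot> b \<and>
              Push (Ext \<C>) Z A A' a \<delta> = Pull (Ext \<C>) Z Z' A' c \<delta>'"
    and ET3_op: "\<lbrakk>s_triangle \<C> A x B y Z \<delta>; s_triangle \<C> A' x' B' y' Z' \<delta>';
          b \<in> Arr \<C> B B'; c \<in> Arr \<C> Z Z'; c \<cdot> y = y' \<cdot> b\<rbrakk>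
        \<Longrightarrow> \<exists>a \<in> Arr \<C> A A'. b \<cdot> x = x' \<cdot> a \<and>
              Push (Ext \<C>) Z A A' a \<delta> = Pull (Ext \<C>) Z Z' A' c \<delta>'"
    and ET4: "\<lbrakk>s_triangle \<C> A f B f' D \<delta>; s_triangle \<C> B g Z g' F \<delta>'\<rbrakk>
        \<Longrightarrow> \<exists>G d e h' \<delta>''. d \<in> Arr \<C> D G \<and> e \<in> Arr \<C> G F \<and>
              s_triangle \<C> A (g \<cdot> f) Z h' G \<delta>'' \<and>
              h' \<cdot> g = d \<cdot> f' \<and> e \<cdot> h' = g' \<and>
              s_triangle \<C> D d G e F (Push (Ext \<C>) F B D f' \<delta>') \<and>
              Pull (Ext \<C>) D G A d \<delta>'' = \<delta> \<and>
              Push (Ext \<C>) G A B f \<delta>'' = Pull (Ext \<C>) G F B e \<delta>'"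
    and ET4_op: "\<lbrakk>s_triangle \<C> D f' B f A \<delta>; s_triangle \<C> F g' Z g B \<delta>'\<rbrakk>
        \<Longrightarrow> \<exists>G d e h' \<delta>''. d \<in> Arr \<C> G D \<and> e \<in> Arr \<C> F G \<and>
              s_triangle \<C> G h' Z (f \<cdot> g) A \<delta>'' \<and>
              g \<cdot> h' = f' \<cdot> d \<and> h' \<cdot> e = g' \<and>
              s_triangle \<C> F e G d D (Pull (Ext \<C>) D B F f' \<delta>') \<and>
              Push (Ext \<C>) A G D d \<delta>'' = \<delta> \<and>
              Pull (Ext \<C>) B A G f \<delta>'' = Push (Ext \<C>) B F G e \<delta>'"

definition inflation :: "('k, 'o, 'm, 'e, 'z) extricat_scheme \<Rightarrow> 'o \<Rightarrow> 'o \<Rightarrow> 'm \<Rightarrow> bool" where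
  "inflation \<C> A B x \<longleftrightarrow> (\<exists>y Z \<delta>. s_triangle \<C> A x B y Z \<delta>)"

definition deflation :: "('k, 'o, 'm, 'e, 'z) extricat_scheme \<Rightarrow> 'o \<Rightarrow> 'o \<Rightarrow> 'm \<Rightarrow> bool" where
  "deflation \<C> B Z y \<longleftrightarrow> (\<exists>A x \<delta>. s_triangle \<C> A x B y Z \<delta>)"

definition projective :: "('k, 'o, 'm, 'e, 'z) extricat_scheme \<Rightarrow> 'o \<Rightarrow> bool" where
  "projective \<C> P \<longleftrightarrow> (\<forall>A. Extn \<C> P A = {\<zero>\<^bsub>Val (Ext \<C>) P A\<^esub>})"

definition injective :: "('k, 'o, 'm, 'e, 'z) extricat_scheme \<Rightarrow> 'o \<Rightarrow> bool" where
  "injective \<C> I \<longleftrightarrow> (\<forall>Z. Extn \<C> Z I = {\<zero>\<^bsub>Val (Ext \<C>) Z I\<^esub>})"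

definition enough_projectives :: "('k, 'o, 'm, 'e, 'z) extricat_scheme \<Rightarrow> bool" where
  "enough_projectives \<C> \<longleftrightarrow> (\<forall>Z. \<exists>P y. projective \<C> P \<and> deflation \<C> P Z y)"

definition enough_injectives :: "('k, 'o, 'm, 'e, 'z) extricat_scheme \<Rightarrow> bool" where
  "enough_injectives \<C> \<longleftrightarrow> (\<forall>A. \<exists>I x. injective \<C> I \<and> inflation \<C> A I x)"

section \<open>Coends\<close>

text \<open>The \<open>mult\<close> and \<open>one\<close> fields, inherited from the ring record, are irrelevant for modules.\<close>

definition free_module :: "'k ring \<Rightarrow> 's set \<Rightarrow> ('k, 's \<Rightarrow> 'k) module" where
  "free_module K S = \<lparr>
     carrier = {v. (\<forall>s. v s \<in> carrier K) \<and> finite {s. v s \<noteq> \<zero>\<^bsub>K\<^esub>} \<and> {s. v s \<noteq> \<zero>\<^bsub>K\<^esub>} \<subseteq> S},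
     mult = undefined, one = undefined,
     zero = (\<lambda>s. \<zero>\<^bsub>K\<^esub>),
     add = (\<lambda>u v s. u s \<oplus>\<^bsub>K\<^esub> v s),
     smult = (\<lambda>k v s. k \<otimes>\<^bsub>K\<^esub> v s)\<rparr>"

definition unit_vec :: "'k ring \<Rightarrow> 's \<Rightarrow> 's \<Rightarrow> 'k" where
  "unit_vec K s = (\<lambda>t. if t = s then \<one>\<^bsub>K\<^esub> else \<zero>\<^bsub>K\<^esub>)"

text \<open>The linear map between free modules that extends the map \<open>\<phi>\<close> on generators.\<close>

definition free_map :: "'k ring \<Rightarrow> ('s \<Rightarrow> 't) \<Rightarrow> ('s \<Rightarrow> 'k) \<Rightarrow> 't \<Rightarrow> 'k" where
  "free_map K \<phi> v = (\<lambda>t. \<Oplus>\<^bsub>K\<^esub>s \<in> {s. v s \<noteq> \<zero>\<^bsub>K\<^esub> \<and> \<phi> s = t}. v s)"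

definition quot_module :: "('k, 'v) module \<Rightarrow> 'v set \<Rightarrow> ('k, 'v set) module" where
  "quot_module M N = \<lparr>
     carrier = a_rcosets\<^bsub>M\<^esub> N,
     mult = undefined, one = undefined,
     zero = N,
     add = (\<lambda>c d. c <+>\<^bsub>M\<^esub> d),
     smult = (\<lambda>k c. \<Union>v\<in>c. N +>\<^bsub>M\<^esub> (k \<odot>\<^bsub>M\<^esub> v))\<rparr>"

text \<open>
  The bifunctor \<open>(X, Y) \<mapsto> \<integral>\<^sup>M F(M, Y) \<otimes> G(X, M)\<close>. The generator \<open>(M, x, h)\<close> stands for \<open>x \<otimes> h\<close> in
  the summand at \<open>M\<close>. The first four families of relations are those of the tensor products over \<open>K\<close>,
  and the last one identifies \<open>f\<^sup>* x \<otimes> h\<close> with \<open>x \<otimes> f\<^sub>* h\<close> for \<open>f : M \<rightarrow> M'\<close>.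
\<close>

definition coend_gens ::
    "('k, 'o, 'm, 'x) bifunctor \<Rightarrow> ('k, 'o, 'm, 'y) bifunctor \<Rightarrow> 'o \<Rightarrow> 'o \<Rightarrow> ('o \<times> 'x \<times> 'y) set" where
  "coend_gens F G X Y = {(M, x, h). x \<in> carrier (Val F M Y) \<and> h \<in> carrier (Val G X M)}"

abbreviation coend_free :: "'k ring \<Rightarrow> ('k, 'o, 'm, 'x) bifunctor \<Rightarrow> ('k, 'o, 'm, 'y) bifunctor
    \<Rightarrow> 'o \<Rightarrow> 'o \<Rightarrow> ('k, 'o \<times> 'x \<times> 'y \<Rightarrow> 'k) module" where
  "coend_free K F G X Y \<equiv> free_module K (coend_gens F G X Y)"

definition coend_rels :: "'k ring \<Rightarrow> ('k, 'o, 'm, 'z) lincat_scheme \<Rightarrow> ('k, 'o, 'm, 'x) bifunctor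
    \<Rightarrow> ('k, 'o, 'm, 'y) bifunctor \<Rightarrow> 'o \<Rightarrow> 'o \<Rightarrow> ('o \<times> 'x \<times> 'y \<Rightarrow> 'k) set" where
  "coend_rels K \<C> F G X Y = (let V = coend_free K F G X Y; \<epsilon> = unit_vec K in
     {\<epsilon> (M, x \<oplus>\<^bsub>Val F M Y\<^esub> x', h) \<ominus>\<^bsub>V\<^esub> (\<epsilon> (M, x, h) \<oplus>\<^bsub>V\<^esub> \<epsilon> (M, x', h)) | M x x' h.
        x \<in> carrier (Val F M Y) \<and> x' \<in> carrier (Val F M Y) \<and> h \<in> carrier (Val G X M)}
   \<union> {\<epsilon> (M, x, h \<oplus>\<^bsub>Val G X M\<^esub> h') \<ominus>\<^bsub>V\<^esub> (\<epsilon> (M, x, h) \<oplus>\<^bsub>V\<^esub> \<epsilon> (M, x, h')) | M x h h'.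
        x \<in> carrier (Val F M Y) \<and> h \<in> carrier (Val G X M) \<and> h' \<in> carrier (Val G X M)}
   \<union> {\<epsilon> (M, k \<odot>\<^bsub>Val F M Y\<^esub> x, h) \<ominus>\<^bsub>V\<^esub> (k \<odot>\<^bsub>V\<^esub> \<epsilon> (M, x, h)) | M k x h.
        k \<in> carrier K \<and> x \<in> carrier (Val F M Y) \<and> h \<in> carrier (Val G X M)}
   \<union> {\<epsilon> (M, x, k \<odot>\<^bsub>Val G X M\<^esub> h) \<ominus>\<^bsub>V\<^esub> (k \<odot>\<^bsub>V\<^esub> \<epsilon> (M, x, h)) | M k x h.
        k \<in> carrier K \<and> x \<in> carrier (Val F M Y) \<and> h \<in> carrier (Val G X M)}
   \<union> {\<epsilon> (M, Pull F M M' Y f x, h) \<ominus>\<^bsub>V\<^esub> \<epsilon> (M', x, Push G X M M' f h) | M M' f x h.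
        f \<in> Arr \<C> M M' \<and> x \<in> carrier (Val F M' Y) \<and> h \<in> carrier (Val G X M)})"

definition coend_null :: "'k ring \<Rightarrow> ('k, 'o, 'm, 'z) lincat_scheme \<Rightarrow> ('k, 'o, 'm, 'x) bifunctor
    \<Rightarrow> ('k, 'o, 'm, 'y) bifunctor \<Rightarrow> 'o \<Rightarrow> 'o \<Rightarrow> ('o \<times> 'x \<times> 'y \<Rightarrow> 'k) set" where
  "coend_null K \<C> F G X Y = module.span K (coend_free K F G X Y) (coend_rels K \<C> F G X Y)"

definition coend_bifunctor :: "'k ring \<Rightarrow> ('k, 'o, 'm, 'z) lincat_scheme \<Rightarrow> ('k, 'o, 'm, 'x) bifunctor
    \<Rightarrow> ('k, 'o, 'm, 'y) bifunctor \<Rightarrow> ('k, 'o, 'm, ('o \<times> 'x \<times> 'y \<Rightarrow> 'k) set) bifunctor" where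
  "coend_bifunctor K \<C> F G = \<lparr>
     Val = (\<lambda>X Y. quot_module (coend_free K F G X Y) (coend_null K \<C> F G X Y)),
     Pull = (\<lambda>X X' Y c t. \<Union>v\<in>t. coend_null K \<C> F G X Y +>\<^bsub>coend_free K F G X Y\<^esub>
               free_map K (\<lambda>(M, x, h). (M, x, Pull G X X' M c h)) v),
     Push = (\<lambda>X Y Y' a t. \<Union>v\<in>t. coend_null K \<C> F G X Y' +>\<^bsub>coend_free K F G X Y'\<^esub>
               free_map K (\<lambda>(M, x, h). (M, Push F M Y Y' a x, h)) v)\<rparr>"

section \<open>Positive and negative extensions\<close>

text \<open>
  The coend construction changes the type of elements, so the higher extensions are moved, by
  transport of structure along an injection, into a type that contains all of them. A coset \<open>t\<close>
  of finitely supported functions is encoded by the graph, as an association list, of a chosen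
  member of \<open>t\<close>; distinct cosets, being disjoint, have distinct codes.
\<close>

datatype ('k, 'o, 'm, 'e) hext =
  Hext_Hom 'm
| Hext_Ext 'e
| Hext_Sum "(('o \<times> ('k, 'o, 'm, 'e) hext \<times> 'e) \<times> 'k) list"

definition encode_coset ::
    "'k ring \<Rightarrow> ('o \<times> ('k, 'o, 'm, 'e) hext \<times> 'e \<Rightarrow> 'k) set \<Rightarrow> ('k, 'o, 'm, 'e) hext" where
  "encode_coset K t =
     Hext_Sum (SOME l. (\<lambda>s. case map_of l s of None \<Rightarrow> \<zero>\<^bsub>K\<^esub> | Some k \<Rightarrow> k) \<in> t)"

definition transport_module :: "('a \<Rightarrow> 'b) \<Rightarrow> ('k, 'a) module \<Rightarrow> ('k, 'b) module" where
  "transport_module \<iota> M = (let \<rho> = inv_into (carrier M) \<iota> in \<lparr>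
     carrier = \<iota> ` carrier M,
     mult = undefined, one = undefined,
     zero = \<iota> \<zero>\<^bsub>M\<^esub>,
     add = (\<lambda>u v. \<iota> (\<rho> u \<oplus>\<^bsub>M\<^esub> \<rho> v)),
     smult = (\<lambda>k v. \<iota> (k \<odot>\<^bsub>M\<^esub> \<rho> v))\<rparr>)"

definition transport_bifunctor ::
    "('a \<Rightarrow> 'b) \<Rightarrow> ('k, 'o, 'm, 'a) bifunctor \<Rightarrow> ('k, 'o, 'm, 'b) bifunctor" where
  "transport_bifunctor \<iota> F = \<lparr>
     Val = (\<lambda>X Y. transport_module \<iota> (Val F X Y)),
     Pull = (\<lambda>X X' Y c u. \<iota> (Pull F X X' Y c (inv_into (carrier (Val F X' Y)) \<iota> u))),
     Push = (\<lambda>X Y Y' a u. \<iota> (Push F X Y Y' a (inv_into (carrier (Val F X Y)) \<iota> u)))\<rparr>"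

primrec pos_ext :: "'k ring \<Rightarrow> ('k, 'o, 'm, 'e, 'z) extricat_scheme \<Rightarrow> nat
    \<Rightarrow> ('k, 'o, 'm, ('k, 'o, 'm, 'e) hext) bifunctor" where
  "pos_ext K \<C> 0 = transport_bifunctor Hext_Hom (hom_bifunctor \<C>)"
| "pos_ext K \<C> (Suc n) =
     (if n = 0 then transport_bifunctor Hext_Ext (Ext \<C>)
      else transport_bifunctor (encode_coset K) (coend_bifunctor K \<C> (pos_ext K \<C> n) (Ext \<C>)))"

text \<open>
  The space of natural transformations \<open>F \<rightarrow> G\<close> of functors that are covariant on the arrow sets
  \<open>\<A> A B\<close>; contravariant functors on \<open>\<C>\<close> are handled by taking the arrow sets of the opposite
  category. Components are made extensional so that equal transformations are equal functions.
\<close>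

definition nat_space :: "'k ring \<Rightarrow> ('o \<Rightarrow> 'o \<Rightarrow> 'm set)
    \<Rightarrow> ('o \<Rightarrow> ('k, 'x) module) \<Rightarrow> ('o \<Rightarrow> 'o \<Rightarrow> 'm \<Rightarrow> 'x \<Rightarrow> 'x)
    \<Rightarrow> ('o \<Rightarrow> ('k, 'y) module) \<Rightarrow> ('o \<Rightarrow> 'o \<Rightarrow> 'm \<Rightarrow> 'y \<Rightarrow> 'y)
    \<Rightarrow> ('k, 'o \<Rightarrow> 'x \<Rightarrow> 'y) module" where
  "nat_space K \<A> F F_act G G_act = \<lparr>
     carrier = {\<eta>. (\<forall>A. \<eta> A \<in> module_hom K (F A) (G A) \<inter> extensional (carrier (F A))) \<and>
       (\<forall>A B. \<forall>f \<in> \<A> A B. \<forall>u \<in> carrier (F A). \<eta> B (F_act A B f u) = G_act A B f (\<eta> A u))},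
     mult = undefined, one = undefined,
     zero = (\<lambda>A. \<lambda>u \<in> carrier (F A). \<zero>\<^bsub>G A\<^esub>),
     add = (\<lambda>\<eta> \<theta> A. \<lambda>u \<in> carrier (F A). \<eta> A u \<oplus>\<^bsub>G A\<^esub> \<theta> A u),
     smult = (\<lambda>k \<eta> A. \<lambda>u \<in> carrier (F A). k \<odot>\<^bsub>G A\<^esub> \<eta> A u)\<rparr>"

text \<open>\<open>neg_ext_I K \<C> n X Y\<close> is \<open>\<E>\<^sub>I\<^sup>-\<^sup>n(X, Y)\<close>, and similarly for \<open>II\<close>; only \<open>n > 0\<close> is meaningful.
  If \<open>\<C>\<close> is Hom-finite with enough projectives and injectives, these spaces are finite-dimensional
  (they embed into \<open>\<C>(X, \<Omega>\<^sup>n Y)\<close> and \<open>\<C>(\<Sigma>\<^sup>n X, Y)\<close> for iterated syzygies \<open>\<Omega>\<^sup>n\<close> and cosyzygies \<open>\<Sigma>\<^sup>n\<close>),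
  so \<^const>\<open>vectorspace.dim\<close>, which is only specified in finite dimension, is their dimension.\<close>

definition neg_ext_I :: "'k ring \<Rightarrow> ('k, 'o, 'm, 'e, 'z) extricat_scheme \<Rightarrow> nat \<Rightarrow> 'o \<Rightarrow> 'o
    \<Rightarrow> ('k, 'o \<Rightarrow> ('k, 'o, 'm, 'e) hext \<Rightarrow> 'm) module" where
  "neg_ext_I K \<C> n X Y = nat_space K (\<lambda>A B. Arr \<C> A B)
     (\<lambda>A. Val (pos_ext K \<C> n) Y A) (\<lambda>A B f. Push (pos_ext K \<C> n) Y A B f)
     (\<lambda>A. Hom \<C> X A) (\<lambda>A B f g. f \<cdot>\<^bsub>\<C>\<^esub> g)"

definition neg_ext_II :: "'k ring \<Rightarrow> ('k, 'o, 'm, 'e, 'z) extricat_scheme \<Rightarrow> nat \<Rightarrow> 'o \<Rightarrow> 'o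
    \<Rightarrow> ('k, 'o \<Rightarrow> ('k, 'o, 'm, 'e) hext \<Rightarrow> 'm) module" where
  "neg_ext_II K \<C> n X Y = nat_space K (\<lambda>A B. Arr \<C> B A)
     (\<lambda>A. Val (pos_ext K \<C> n) A X) (\<lambda>A B f. Pull (pos_ext K \<C> n) B A X f)
     (\<lambda>A. Hom \<C> A Y) (\<lambda>A B f g. g \<cdot>\<^bsub>\<C>\<^esub> f)"

end

theory Submission
  imports Defs
begin

text \<open>
  Choose for every object \<open>Y\<close> a triangle \<open>\<Omega>Y \<rightarrow> P \<rightarrow> Y\<close> with \<open>P\<close> projective and inflation \<open>i\<close>, and for
  every \<open>X\<close> a triangle \<open>X \<rightarrow> J \<rightarrow> \<Sigma>X\<close> with \<open>J\<close> injective and deflation \<open>q\<close>. The long exact sequences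
  present \<open>\<E>(Y, -)\<close> as the cokernel of \<open>\<C>(i, -)\<close> and \<open>\<E>(-, X)\<close> as the cokernel of \<open>\<C>(-, q)\<close>. As the
  coend defining \<open>\<E>\<^sup>n\<^sup>+\<^sup>1\<close> is right exact in each factor and \<open>\<E>\<close> vanishes on projectives and
  injectives, \<open>\<E>\<^sup>n\<^sup>+\<^sup>1(Y, -)\<close> is \<open>\<E>(\<Omega>\<^sup>nY, -)\<close> and \<open>\<E>\<^sup>n\<^sup>+\<^sup>1(-, X)\<close> is \<open>\<E>(-, \<Sigma>\<^sup>nX)\<close> (\<open>presents_left\<close>,
  \<open>composite_presents_right\<close>). By the Yoneda lemma (\<open>presented_nat_space\<close>) the negative extensions
  become spaces of arrows: \<open>\<E>\<^sub>I\<^sup>-\<^sup>1(X, Y)\<close> is \<open>{u : X \<rightarrow> \<Omega>Y. i \<cdot> u = 0}\<close>, \<open>\<E>\<^sub>I\<^sub>I\<^sup>-\<^sup>1(X, Y)\<close> is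
  \<open>{v : \<Sigma>X \<rightarrow> Y. v \<cdot> q = 0}\<close>, and \<open>\<E>\<^sub>I\<^sup>-\<^sup>n\<^sup>-\<^sup>1(X, Y)\<close>, \<open>\<E>\<^sub>I\<^sub>I\<^sup>-\<^sup>n\<^sup>-\<^sup>1(X, Y)\<close> are \<open>\<E>\<^sub>I\<^sup>-\<^sup>1(X, \<Omega>\<^sup>nY)\<close>,
  \<open>\<E>\<^sub>I\<^sub>I\<^sup>-\<^sup>1(\<Sigma>\<^sup>nX, Y)\<close>.

  Equality of dimensions in degree \<open>-1\<close> implies the two injectivity conditions. If \<open>I\<close> is injective,
  \<open>\<E>\<^sub>I\<^sub>I\<^sup>-\<^sup>1(I, Y) = 0\<close> since \<open>\<E>(-, I) = 0\<close>; hence \<open>\<E>\<^sub>I\<^sup>-\<^sup>1(I, Y) = 0\<close>, which says that \<open>i\<close> cancels against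
  arrows from \<open>I\<close>. An arrow that is killed by an arbitrary inflation lifts to an arrow killed by
  some \<open>i\<close> (\<open>lift_along_inflation\<close>), so every inflation cancels. The other condition is dual.

  Conversely, assume the two conditions. The connecting maps from \<open>\<E>\<^sub>I\<^sup>-\<^sup>1(X, Y)\<close> and \<open>\<E>\<^sub>I\<^sub>I\<^sup>-\<^sup>1(X, Y)\<close> to
  \<open>\<E>(\<Sigma>X, \<Omega>Y)\<close> have the same image (\<open>connecting_subset\<close>), and by the conditions their kernels have
  the same dimension: each becomes the quotient of one subspace of \<open>\<C>(J, P)\<close> by another, and the
  two subspaces are described symmetrically (\<open>syzygy_dim_formula\<close>). This gives degree \<open>-1\<close>. For the
  other degrees, the conditions make \<open>\<E>\<^sub>I\<^sub>I\<^sup>-\<^sup>1(X, \<Omega>Y)\<close> and \<open>\<E>\<^sub>I\<^sup>-\<^sup>1(\<Sigma>X, Y)\<close> the same subspace of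
  \<open>\<C>(\<Sigma>X, \<Omega>Y)\<close>, so that \<open>\<Omega>\<close> in the second argument can be traded for \<open>\<Sigma>\<close> in the first.
\<close>

section \<open>Linear algebra of subspaces\<close>

definition subdim :: "'k ring \<Rightarrow> ('k, 'v, 'z) module_scheme \<Rightarrow> 'v set \<Rightarrow> nat" where
  "subdim K V A = vectorspace.dim K (V\<lparr>carrier := A\<rparr>)"

lemma linear_mapI:
  assumes "vectorspace K V" "vectorspace K W" "T \<in> module_hom K V W"
  shows "linear_map K V W T"
proof -
  interpret V: vectorspace K V by fact
  interpret W: vectorspace K W by fact
  show ?thesis
    using assms by (unfold_locales) auto
qed

lemma module_homI:
  assumes "\<And>x. x \<in> carrier M \<Longrightarrow> f x \<in> carrier N"
    and "\<And>x y. \<lbrakk>x \<in> carrier M; y \<in> carrier M\<rbrakk> \<Longrightarrow> f (x \<oplus>\<^bsub>M\<^esub> y) = f x \<oplus>\<^bsub>N\<^esub> f y"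
    and "\<And>k x. \<lbrakk>k \<in> carrier K; x \<in> carrier M\<rbrakk> \<Longrightarrow> f (k \<odot>\<^bsub>M\<^esub> x) = k \<odot>\<^bsub>N\<^esub> f x"
  shows "f \<in> module_hom K M N"
  using assms unfolding module_hom_def by auto

lemma module_homD:
  assumes "f \<in> module_hom K M N"
  shows "x \<in> carrier M \<Longrightarrow> f x \<in> carrier N"
    and "\<lbrakk>x \<in> carrier M; y \<in> carrier M\<rbrakk> \<Longrightarrow> f (x \<oplus>\<^bsub>M\<^esub> y) = f x \<oplus>\<^bsub>N\<^esub> f y"
    and "\<lbrakk>k \<in> carrier K; x \<in> carrier M\<rbrakk> \<Longrightarrow> f (k \<odot>\<^bsub>M\<^esub> x) = k \<odot>\<^bsub>N\<^esub> f x"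
  using assms unfolding module_hom_def by auto

lemma module_hom_zero:
  assumes "module K M" "module K N" "f \<in> module_hom K M N"
  shows "f \<zero>\<^bsub>M\<^esub> = \<zero>\<^bsub>N\<^esub>"
proof -
  interpret mod_hom K M N f
    using assms by (simp add: mod_hom_def mod_hom_axioms_def)
  show ?thesis by (rule f0_is_0)
qed

lemma subspaceI:
  assumes "vectorspace K V" "A \<subseteq> carrier V" "\<zero>\<^bsub>V\<^esub> \<in> A"
    and "\<And>u v. \<lbrakk>u \<in> A; v \<in> A\<rbrakk> \<Longrightarrow> u \<oplus>\<^bsub>V\<^esub> v \<in> A"
    and "\<And>k v. \<lbrakk>k \<in> carrier K; v \<in> A\<rbrakk> \<Longrightarrow> k \<odot>\<^bsub>V\<^esub> v \<in> A"
  shows "subspace K A V"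
  using assms by (auto simp: subspace_def submodule_def vectorspace_def)

lemma subspaceD:
  assumes "subspace K A V"
  shows "A \<subseteq> carrier V" "\<zero>\<^bsub>V\<^esub> \<in> A"
    "\<lbrakk>u \<in> A; v \<in> A\<rbrakk> \<Longrightarrow> u \<oplus>\<^bsub>V\<^esub> v \<in> A"
    "\<lbrakk>k \<in> carrier K; v \<in> A\<rbrakk> \<Longrightarrow> k \<odot>\<^bsub>V\<^esub> v \<in> A"
  using assms by (auto simp: subspace_def submodule_def)

lemma subspace_vectorspace:
  assumes "subspace K A V" shows "vectorspace K (V\<lparr>carrier := A\<rparr>)"
  using assms vectorspace.subspace_is_vs by (auto simp: subspace_def)

text \<open>
  Linearly independent subsets of the subspace are independent in the whole space, so their
  cardinalities are bounded by its dimension; a maximal one generates the subspace.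
\<close>

lemma fin_dim_subspace:
  assumes "subspace K A V" and "vectorspace.fin_dim K V"
  shows "vectorspace.fin_dim K (V\<lparr>carrier := A\<rparr>)"
proof -
  interpret V: vectorspace K V using assms(1) by (simp add: subspace_def)
  interpret A: vectorspace K "V\<lparr>carrier := A\<rparr>" by (rule subspace_vectorspace) fact
  have sub: "LinearCombinations.submodule K A V" using assms(1) by (simp add: subspace_def)
  let ?P = "\<lambda>S. S \<subseteq> A \<and> A.lin_indpt S"
  have small: "finite S \<and> card S \<le> V.dim" if "?P S" for S
  proof -
    have "V.lin_indpt S" using that V.span_li_not_depend(2)[OF _ sub] by auto
    moreover have "S \<subseteq> carrier V" using that subspaceD(1)[OF assms(1)] by auto
    ultimately show ?thesis using V.li_le_dim[OF assms(2)] by auto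
  qed
  have "?P {}" by (auto simp: A.lin_dep_def)
  then obtain B where B: "finite B" "maximal B ?P"
    using maximal_exists[of ?P V.dim "{}"] small by auto
  then have "A.gen_set B" using A.max_li_is_gen by simp
  moreover have "B \<subseteq> carrier (V\<lparr>carrier := A\<rparr>)" using B by (simp add: maximal_def)
  ultimately show ?thesis using B unfolding A.fin_dim_def by blast
qed

lemma linear_kernel_subspace:
  assumes "vectorspace K V" "vectorspace K W" "T \<in> module_hom K V W" "subspace K A V"
  shows "subspace K {a \<in> A. T a = \<zero>\<^bsub>W\<^esub>} V"
proof (rule subspaceI)
  note T = module_homD[OF assms(3)] and A = subspaceD[OF assms(4)]
  interpret linear_map K V W T by (rule linear_mapI) fact+
  show "\<zero>\<^bsub>V\<^esub> \<in> {a \<in> A. T a = \<zero>\<^bsub>W\<^esub>}" using A by simp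
  show "u \<oplus>\<^bsub>V\<^esub> v \<in> {a \<in> A. T a = \<zero>\<^bsub>W\<^esub>}"
    if "u \<in> {a \<in> A. T a = \<zero>\<^bsub>W\<^esub>}" "v \<in> {a \<in> A. T a = \<zero>\<^bsub>W\<^esub>}" for u v
    using that A(1) A(3)[of u v] T(2)[of u v] by (simp add: subset_iff)
  show "k \<odot>\<^bsub>V\<^esub> v \<in> {a \<in> A. T a = \<zero>\<^bsub>W\<^esub>}"
    if "k \<in> carrier K" "v \<in> {a \<in> A. T a = \<zero>\<^bsub>W\<^esub>}" for k v
    using that A(1) A(4)[of k v] T(3)[of k v] by (simp add: subset_iff)
  show "{a \<in> A. T a = \<zero>\<^bsub>W\<^esub>} \<subseteq> carrier V" using A(1) by auto
qed fact

lemma rank_nullity_subspace: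
  assumes "vectorspace K V" "vectorspace.fin_dim K V" "vectorspace K W"
    and "T \<in> module_hom K V W" "subspace K A V"
  shows "subdim K V A = subdim K W (T ` A) + subdim K V {a \<in> A. T a = \<zero>\<^bsub>W\<^esub>}"
proof -
  have T: "T \<in> module_hom K (V\<lparr>carrier := A\<rparr>) W"
    by (rule module_homI) (simp_all add: module_homD[OF assms(4)]
        subsetD[OF subspaceD(1)[OF assms(5)]])
  interpret linear_map K "V\<lparr>carrier := A\<rparr>" W T
    by (rule linear_mapI) (rule subspace_vectorspace T assms)+
  show ?thesis
    using rank_nullity[OF fin_dim_subspace[OF assms(5,2)]] by (simp add: subdim_def im_def ker_def)
qed

lemma subdim_zero:
  assumes "vectorspace K V" shows "subdim K V {\<zero>\<^bsub>V\<^esub>} = 0"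
proof -
  interpret V: vectorspace K V by fact
  have "subspace K {\<zero>\<^bsub>V\<^esub>} V" by (rule subspaceI) (auto intro: assms)
  then interpret Z: vectorspace K "V\<lparr>carrier := {\<zero>\<^bsub>V\<^esub>}\<rparr>" by (rule subspace_vectorspace)
  show ?thesis using Z.span_empty Z.gen_ge_dim[of "{}"] by (simp add: subdim_def)
qed

lemma subdim_eq_0_imp_trivial:
  assumes "subspace K A V" "vectorspace.fin_dim K V" "subdim K V A = 0"
  shows "A = {\<zero>\<^bsub>V\<^esub>}"
proof -
  interpret A: vectorspace K "V\<lparr>carrier := A\<rparr>" by (rule subspace_vectorspace) fact
  obtain B where "finite B" "A.basis B"
    using A.finite_basis_exists fin_dim_subspace[OF assms(1,2)] by blast
  then have "A.span {} = A"
    using A.dim_basis[of B] assms(3) by (auto simp: A.basis_def subdim_def)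
  then show ?thesis using A.span_empty by simp
qed

lemma subdim_injective_image:
  assumes "vectorspace K V" "vectorspace.fin_dim K V" "vectorspace K W"
    and "T \<in> module_hom K V W" "subspace K A V"
    and "\<And>a. \<lbrakk>a \<in> A; T a = \<zero>\<^bsub>W\<^esub>\<rbrakk> \<Longrightarrow> a = \<zero>\<^bsub>V\<^esub>"
  shows "subdim K W (T ` A) = subdim K V A"
proof -
  have "T \<zero>\<^bsub>V\<^esub> = \<zero>\<^bsub>W\<^esub>"
    using assms by (intro module_hom_zero[of K]) (auto simp: vectorspace_def)
  then have "{a \<in> A. T a = \<zero>\<^bsub>W\<^esub>} = {\<zero>\<^bsub>V\<^esub>}"
    using assms(6) subspaceD(2)[OF assms(5)] by blast
  then show ?thesis using rank_nullity_subspace[OF assms(1-5)] subdim_zero[OF assms(1)] by simp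
qed

text \<open>
  The vector space axioms are equations, closure conditions and the existence of inverses, all of
  which an image inherits. This serves for quotients and for structures carried along a bijection.
\<close>

lemma vectorspace_surjective_image:
  assumes V: "vectorspace K V" and surj: "\<phi> ` carrier V = carrier W"
    and add: "\<And>x y. \<lbrakk>x \<in> carrier V; y \<in> carrier V\<rbrakk> \<Longrightarrow> \<phi> (x \<oplus>\<^bsub>V\<^esub> y) = \<phi> x \<oplus>\<^bsub>W\<^esub> \<phi> y"
    and smult: "\<And>k x. \<lbrakk>k \<in> carrier K; x \<in> carrier V\<rbrakk> \<Longrightarrow> \<phi> (k \<odot>\<^bsub>V\<^esub> x) = k \<odot>\<^bsub>W\<^esub> \<phi> x"
    and zero: "\<phi> \<zero>\<^bsub>V\<^esub> = \<zero>\<^bsub>W\<^esub>"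
  shows "vectorspace K W" and "\<phi> \<in> module_hom K V W"
proof -
  interpret V: vectorspace K V by fact
  have W: "carrier W = \<phi> ` carrier V" using surj by simp
  have z: "v \<oplus>\<^bsub>W\<^esub> \<zero>\<^bsub>W\<^esub> = v" if "v \<in> carrier W" for v
    using that add[of _ "\<zero>\<^bsub>V\<^esub>"] by (auto simp: W zero)
  have n: "\<exists>w \<in> carrier W. v \<oplus>\<^bsub>W\<^esub> w = \<zero>\<^bsub>W\<^esub>" if v: "v \<in> carrier W" for v
  proof -
    obtain x where x: "x \<in> carrier V" "v = \<phi> x" using v W by auto
    then have "\<phi> x \<oplus>\<^bsub>W\<^esub> \<phi> (\<ominus>\<^bsub>V\<^esub> x) = \<zero>\<^bsub>W\<^esub>"
      using add[of x "\<ominus>\<^bsub>V\<^esub> x"] zero by (simp add: V.M.r_neg)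
    then show ?thesis using x W by auto
  qed
  have a: "\<phi> x \<oplus>\<^bsub>W\<^esub> \<phi> y = \<phi> (x \<oplus>\<^bsub>V\<^esub> y)" if "x \<in> carrier V" "y \<in> carrier V" for x y
    using add that by simp
  have s: "k \<odot>\<^bsub>W\<^esub> \<phi> x = \<phi> (k \<odot>\<^bsub>V\<^esub> x)" if "k \<in> carrier K" "x \<in> carrier V" for k x
    using smult that by simp
  show "vectorspace K W"
  proof (rule vs_criteria)
    show "field K" ..
    show "\<zero>\<^bsub>W\<^esub> \<in> carrier W" using zero W by (metis V.M.zero_closed imageI)
    show "\<forall>v w. v \<in> carrier W \<and> w \<in> carrier W \<longrightarrow> v \<oplus>\<^bsub>W\<^esub> w = w \<oplus>\<^bsub>W\<^esub> v"
      using V.M.a_comm by (auto simp: W a)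
  qed (use z n in \<open>auto simp: W a s V.M.a_assoc V.smult_assoc1 V.smult_l_distr V.smult_r_distr\<close>)
  show "\<phi> \<in> module_hom K V W"
    using add smult W by (intro module_homI) auto
qed

lemma dim_transport:
  assumes "vectorspace K V" "vectorspace.fin_dim K V" "vectorspace K W"
    and "\<phi> \<in> module_hom K V W" "bij_betw \<phi> (carrier V) (carrier W)"
  shows "vectorspace.dim K W = vectorspace.dim K V"
proof -
  interpret linear_map K V W \<phi> by (rule linear_mapI) fact+
  show ?thesis using dim_eq assms by (simp add: bij_betw_def)
qed

section \<open>Linear functors and the Yoneda lemma\<close>

lemma (in linear_category) module_Hom: "module K (Hom \<C> A B)"
  using vectorspace_Hom by (simp add: vectorspace_def)

context linear_category
begin

sublocale Hom: vectorspace K "Hom \<C> A B" for A B by (rule vectorspace_Hom)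

lemma Comp_zero_right: "g \<in> Arr \<C> B D \<Longrightarrow> g \<cdot> \<zero>\<^bsub>Hom \<C> A B\<^esub> = \<zero>\<^bsub>Hom \<C> A D\<^esub>"
  using module_hom_zero[OF module_Hom module_Hom Comp_linear_right] .

lemma Comp_zero_left: "f \<in> Arr \<C> A B \<Longrightarrow> \<zero>\<^bsub>Hom \<C> B D\<^esub> \<cdot> f = \<zero>\<^bsub>Hom \<C> A D\<^esub>"
  using module_hom_zero[OF module_Hom module_Hom Comp_linear_left] .

lemma Comp_add_right:
  "\<lbrakk>g \<in> Arr \<C> B D; f \<in> Arr \<C> A B; f' \<in> Arr \<C> A B\<rbrakk>
    \<Longrightarrow> g \<cdot> (f \<oplus>\<^bsub>Hom \<C> A B\<^esub> f') = g \<cdot> f \<oplus>\<^bsub>Hom \<C> A D\<^esub> g \<cdot> f'"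
  using module_homD(2)[OF Comp_linear_right] by blast

lemma Comp_add_left:
  "\<lbrakk>f \<in> Arr \<C> A B; g \<in> Arr \<C> B D; g' \<in> Arr \<C> B D\<rbrakk>
    \<Longrightarrow> (g \<oplus>\<^bsub>Hom \<C> B D\<^esub> g') \<cdot> f = g \<cdot> f \<oplus>\<^bsub>Hom \<C> A D\<^esub> g' \<cdot> f"
  using module_homD(2)[OF Comp_linear_left] by blast

lemma Comp_smult_right:
  "\<lbrakk>g \<in> Arr \<C> B D; k \<in> carrier K; f \<in> Arr \<C> A B\<rbrakk>
    \<Longrightarrow> g \<cdot> (k \<odot>\<^bsub>Hom \<C> A B\<^esub> f) = k \<odot>\<^bsub>Hom \<C> A D\<^esub> (g \<cdot> f)"
  using module_homD(3)[OF Comp_linear_right] by blast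

lemma Comp_smult_left:
  "\<lbrakk>f \<in> Arr \<C> A B; k \<in> carrier K; g \<in> Arr \<C> B D\<rbrakk>
    \<Longrightarrow> (k \<odot>\<^bsub>Hom \<C> B D\<^esub> g) \<cdot> f = k \<odot>\<^bsub>Hom \<C> A D\<^esub> (g \<cdot> f)"
  using module_homD(3)[OF Comp_linear_left] by blast

lemma Comp_neg_right:
  assumes "g \<in> Arr \<C> B D" "f \<in> Arr \<C> A B"
  shows "g \<cdot> (\<ominus>\<^bsub>Hom \<C> A B\<^esub> f) = \<ominus>\<^bsub>Hom \<C> A D\<^esub> (g \<cdot> f)"
proof -
  interpret mod_hom K "Hom \<C> A B" "Hom \<C> A D" "\<lambda>f. g \<cdot> f"
    using Comp_linear_right[OF assms(1)] module_Hom by (simp add: mod_hom_def mod_hom_axioms_def)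
  show ?thesis by (rule f_neg) fact
qed

lemma Comp_neg_left:
  assumes "f \<in> Arr \<C> A B" "g \<in> Arr \<C> B D"
  shows "(\<ominus>\<^bsub>Hom \<C> B D\<^esub> g) \<cdot> f = \<ominus>\<^bsub>Hom \<C> A D\<^esub> (g \<cdot> f)"
proof -
  interpret mod_hom K "Hom \<C> B D" "Hom \<C> A D" "\<lambda>g. g \<cdot> f"
    using Comp_linear_left[OF assms(1)] module_Hom by (simp add: mod_hom_def mod_hom_axioms_def)
  show ?thesis by (rule f_neg) fact
qed

lemma Comp_diff_right:
  assumes "g \<in> Arr \<C> B D" "f \<in> Arr \<C> A B" "f' \<in> Arr \<C> A B"
  shows "g \<cdot> (f \<ominus>\<^bsub>Hom \<C> A B\<^esub> f') = g \<cdot> f \<ominus>\<^bsub>Hom \<C> A D\<^esub> g \<cdot> f'"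
  using assms by (simp add: a_minus_def Comp_add_right Comp_neg_right)

lemma Comp_diff_left:
  assumes "f \<in> Arr \<C> A B" "g \<in> Arr \<C> B D" "g' \<in> Arr \<C> B D"
  shows "(g \<ominus>\<^bsub>Hom \<C> B D\<^esub> g') \<cdot> f = g \<cdot> f \<ominus>\<^bsub>Hom \<C> A D\<^esub> g' \<cdot> f"
  using assms by (simp add: a_minus_def Comp_add_left Comp_neg_left)

lemma annihilated_subspace:
  assumes "i \<in> Arr \<C> B D"
  shows "subspace K {u \<in> Arr \<C> A B. i \<cdot> u = \<zero>\<^bsub>Hom \<C> A D\<^esub>} (Hom \<C> A B)"
proof -
  have "subspace K (Arr \<C> A B) (Hom \<C> A B)" by (rule subspaceI[OF vectorspace_Hom]) auto
  from linear_kernel_subspace[OF vectorspace_Hom vectorspace_Hom Comp_linear_right[OF assms] this]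
  show ?thesis .
qed

end

locale linear_functor = linear_category K \<C>
  for K :: "'k ring" and \<C> :: "('k, 'o, 'm, 'z) lincat_scheme" (structure) +
  fixes F :: "'o \<Rightarrow> ('k, 'x) module" and act :: "'o \<Rightarrow> 'o \<Rightarrow> 'm \<Rightarrow> 'x \<Rightarrow> 'x"
  assumes vectorspace_F: "vectorspace K (F A)"
    and act_hom: "f \<in> Arr \<C> A B \<Longrightarrow> act A B f \<in> module_hom K (F A) (F B)"
    and act_linear: "\<xi> \<in> carrier (F A) \<Longrightarrow> (\<lambda>f. act A B f \<xi>) \<in> module_hom K (Hom \<C> A B) (F B)"
    and act_Ident: "\<xi> \<in> carrier (F A) \<Longrightarrow> act A A (Ident \<C> A) \<xi> = \<xi>"
    and act_Comp: "\<lbrakk>f \<in> Arr \<C> A B; g \<in> Arr \<C> B D; \<xi> \<in> carrier (F A)\<rbrakk>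
          \<Longrightarrow> act A D (g \<cdot> f) \<xi> = act B D g (act A B f \<xi>)"

text \<open>
  A presentation of a covariant functor \<open>F\<close> as the cokernel of \<open>\<C>(i, -) : \<C>(P, -) \<rightarrow> \<C>(W, -)\<close>:
  the element \<open>e\<close> is the image of the identity of \<open>W\<close>, and exactness of
  \<open>\<C>(P, A) \<rightarrow> \<C>(W, A) \<rightarrow> F(A) \<rightarrow> 0\<close> is spelled out elementwise.
\<close>

definition presents :: "('k, 'o, 'm, 'z) lincat_scheme \<Rightarrow> ('o \<Rightarrow> ('k, 'x) module)
    \<Rightarrow> ('o \<Rightarrow> 'o \<Rightarrow> 'm \<Rightarrow> 'x \<Rightarrow> 'x) \<Rightarrow> 'o \<Rightarrow> 'o \<Rightarrow> 'm \<Rightarrow> 'x \<Rightarrow> bool" where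
  "presents \<C> F act W P i e \<longleftrightarrow> i \<in> Arr \<C> W P \<and> e \<in> carrier (F W) \<and>
     (\<forall>A. \<forall>\<xi> \<in> carrier (F A). \<exists>h \<in> Arr \<C> W A. act W A h e = \<xi>) \<and>
     (\<forall>A. \<forall>h \<in> Arr \<C> W A. act W A h e = \<zero>\<^bsub>F A\<^esub> \<longleftrightarrow> (\<exists>g \<in> Arr \<C> P A. h = g \<cdot>\<^bsub>\<C>\<^esub> i))"

context linear_functor
begin

abbreviation "Trans X \<equiv> nat_space K (\<lambda>A B. Arr \<C> A B) F act (\<lambda>A. Hom \<C> X A) (\<lambda>A B f g. f \<cdot> g)"

text \<open>
  By the Yoneda lemma a transformation \<open>\<C>(W, -) \<rightarrow> \<C>(X, -)\<close> is precomposition with some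
  \<open>u : X \<rightarrow> W\<close>, and it factors through the cokernel \<open>F\<close> of \<open>\<C>(i, -)\<close> iff \<open>i \<cdot> u = 0\<close>. So \<open>u\<close>
  corresponds to \<open>h\<^sub>* e \<mapsto> h \<cdot> u\<close>, and conversely a transformation \<open>\<eta>\<close> to its value at \<open>e\<close>.
\<close>

lemma presented_nat_space:
  assumes pres: "presents \<C> F act W P i e"
  defines "U \<equiv> \<lambda>X. {u \<in> Arr \<C> X W. i \<cdot> u = \<zero>\<^bsub>Hom \<C> X P\<^esub>}"
  shows "vectorspace K (Trans X)"
    and "vectorspace.fin_dim K (Hom \<C> X W) \<Longrightarrow>
      vectorspace.dim K (Trans X) = subdim K (Hom \<C> X W) (U X)"
proof -
  let ?H = "Hom \<C> X W"
  interpret F: vectorspace K "F A" for A by (rule vectorspace_F)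
  have i: "i \<in> Arr \<C> W P" and e: "e \<in> carrier (F W)"
    using pres by (auto simp: presents_def)
  have ac: "act A B f \<xi> \<in> carrier (F B)" if "f \<in> Arr \<C> A B" "\<xi> \<in> carrier (F A)" for A B f \<xi>
    using module_homD(1)[OF act_hom] that by blast
  define ch where "ch A \<xi> = (SOME h. h \<in> Arr \<C> W A \<and> act W A h e = \<xi>)" for A \<xi>
  have ch: "ch A \<xi> \<in> Arr \<C> W A" "act W A (ch A \<xi>) e = \<xi>" if "\<xi> \<in> carrier (F A)" for A \<xi>
  proof -
    have "\<exists>h. h \<in> Arr \<C> W A \<and> act W A h e = \<xi>" using pres that unfolding presents_def by blast
    from someI_ex[OF this] show "ch A \<xi> \<in> Arr \<C> W A" "act W A (ch A \<xi>) e = \<xi>"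
      by (auto simp: ch_def)
  qed
  \<comment> \<open>the arrows \<open>h\<close> and \<open>ch A (h\<^sub>* e)\<close> differ by one that factors through \<open>i\<close>\<close>
  have wd: "ch A (act W A h e) \<cdot> u = h \<cdot> u" if h: "h \<in> Arr \<C> W A" and u: "u \<in> U X" for A h u
  proof -
    let ?h = "ch A (act W A h e)"
    have h': "?h \<in> Arr \<C> W A" "act W A ?h e = act W A h e" using ch[OF ac[OF h e]] by auto
    interpret mh: mod_hom K "Hom \<C> W A" "F A" "\<lambda>f. act W A f e"
      using act_linear[OF e] module_Hom F.module_axioms by (simp add: mod_hom_def mod_hom_axioms_def)
    have "act W A (?h \<ominus>\<^bsub>Hom \<C> W A\<^esub> h) e = \<zero>\<^bsub>F A\<^esub>"
      using mh.f_minus[OF h'(1) h] h' ac[OF h e] by simp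
    then obtain g where g: "g \<in> Arr \<C> P A" "?h \<ominus>\<^bsub>Hom \<C> W A\<^esub> h = g \<cdot> i"
      using pres Hom.M.minus_closed[OF h'(1) h] unfolding presents_def by blast
    have u': "u \<in> Arr \<C> X W" "i \<cdot> u = \<zero>\<^bsub>Hom \<C> X P\<^esub>" using u by (auto simp: U_def)
    have "?h \<cdot> u \<ominus>\<^bsub>Hom \<C> X A\<^esub> h \<cdot> u = (g \<cdot> i) \<cdot> u"
      using Comp_diff_left[OF u'(1) h'(1) h] g(2) by simp
    also have "\<dots> = \<zero>\<^bsub>Hom \<C> X A\<^esub>"
      using Comp_assoc[OF u'(1) i g(1)] u'(2) Comp_zero_right[OF g(1)] by simp
    finally show ?thesis using Comp_Arr[OF u'(1) h'(1)] Comp_Arr[OF u'(1) h] by simp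
  qed
  define \<phi> where "\<phi> u = (\<lambda>A. \<lambda>\<xi> \<in> carrier (F A). ch A \<xi> \<cdot> u)" for u
  have \<phi>: "\<phi> u A (act W A h e) = h \<cdot> u" if "h \<in> Arr \<C> W A" "u \<in> U X" for A h u
    using wd[OF that] ac[OF that(1) e] by (simp add: \<phi>_def)
  have gen: "\<exists>h \<in> Arr \<C> W A. \<xi> = act W A h e" if "\<xi> \<in> carrier (F A)" for A \<xi>
    using ch[OF that] by metis
  have U: "subspace K (U X) ?H" unfolding U_def by (rule annihilated_subspace[OF i])
  have UA: "u \<in> Arr \<C> X W" if "u \<in> U X" for u using that by (simp add: U_def)
  have vU: "vectorspace K (?H\<lparr>carrier := U X\<rparr>)" by (rule subspace_vectorspace[OF U])
  have in_Nat: "\<phi> u \<in> carrier (Trans X)" if u: "u \<in> U X" for u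
  proof -
    have "\<phi> u A \<in> module_hom K (F A) (Hom \<C> X A)" for A
    proof (rule module_homI)
      fix x assume "x \<in> carrier (F A)"
      then obtain h where h: "h \<in> Arr \<C> W A" "x = act W A h e" using gen by blast
      then show "\<phi> u A x \<in> Arr \<C> X A" using \<phi>[OF h(1) u] Comp_Arr[OF UA[OF u] h(1)] by simp
      fix y assume "y \<in> carrier (F A)"
      then obtain h' where h': "h' \<in> Arr \<C> W A" "y = act W A h' e" using gen by blast
      have "x \<oplus>\<^bsub>F A\<^esub> y = act W A (h \<oplus>\<^bsub>Hom \<C> W A\<^esub> h') e"
        using module_homD(2)[OF act_linear[OF e]] h h' by simp
      then show "\<phi> u A (x \<oplus>\<^bsub>F A\<^esub> y) = \<phi> u A x \<oplus>\<^bsub>Hom \<C> X A\<^esub> \<phi> u A y"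
        using \<phi>[OF _ u] h h' Comp_add_left[OF UA[OF u] h(1) h'(1)] by simp
    next
      fix k x assume k: "k \<in> carrier K" and "x \<in> carrier (F A)"
      then obtain h where h: "h \<in> Arr \<C> W A" "x = act W A h e" using gen by blast
      have "k \<odot>\<^bsub>F A\<^esub> x = act W A (k \<odot>\<^bsub>Hom \<C> W A\<^esub> h) e"
        using module_homD(3)[OF act_linear[OF e]] h k by simp
      then show "\<phi> u A (k \<odot>\<^bsub>F A\<^esub> x) = k \<odot>\<^bsub>Hom \<C> X A\<^esub> \<phi> u A x"
        using \<phi>[OF _ u] h k Comp_smult_left[OF UA[OF u] k h(1)] by simp
    qed
    moreover have "\<phi> u A \<in> extensional (carrier (F A))" for A by (simp add: \<phi>_def)
    moreover have "\<phi> u B (act A B f \<xi>) = f \<cdot> \<phi> u A \<xi>"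
      if f: "f \<in> Arr \<C> A B" and \<xi>: "\<xi> \<in> carrier (F A)" for A B f \<xi>
    proof -
      obtain h where h: "h \<in> Arr \<C> W A" "\<xi> = act W A h e" using gen[OF \<xi>] by blast
      have "act A B f \<xi> = act W B (f \<cdot> h) e" using act_Comp[OF h(1) f e] h(2) by simp
      then show ?thesis
        using \<phi>[OF Comp_Arr[OF h(1) f] u] \<phi>[OF h(1) u] h(2) Comp_assoc[OF UA[OF u] h(1) f] by simp
    qed
    ultimately show ?thesis by (simp add: nat_space_def)
  qed
  have inj: "u = v" if "u \<in> U X" "v \<in> U X" "\<phi> u = \<phi> v" for u v
  proof -
    have "\<phi> u W (act W W (Ident \<C> W) e) = u" "\<phi> v W (act W W (Ident \<C> W) e) = v"
      using \<phi>[OF Ident_Arr] Comp_Ident_left[OF UA] that(1,2) by auto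
    then show ?thesis using that(3) by metis
  qed
  have surj: "\<exists>u \<in> U X. \<eta> = \<phi> u" if \<eta>: "\<eta> \<in> carrier (Trans X)" for \<eta>
  proof -
    have hom: "\<eta> A \<in> module_hom K (F A) (Hom \<C> X A)" and ext: "\<eta> A \<in> extensional (carrier (F A))"
      and nat: "\<And>B f \<xi>. \<lbrakk>f \<in> Arr \<C> A B; \<xi> \<in> carrier (F A)\<rbrakk> \<Longrightarrow> \<eta> B (act A B f \<xi>) = f \<cdot> \<eta> A \<xi>" for A
      using \<eta> by (auto simp: nat_space_def)
    let ?u = "\<eta> W e"
    have u: "?u \<in> Arr \<C> X W" using module_homD(1)[OF hom e] .
    have "act W P i e = \<zero>\<^bsub>F P\<^esub>"
    proof -
      have "i = Ident \<C> P \<cdot> i" using Comp_Ident_left[OF i] by simp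
      then have "\<exists>g \<in> Arr \<C> P P. i = g \<cdot> i" using Ident_Arr by blast
      then show ?thesis using pres i by (simp add: presents_def)
    qed
    then have "i \<cdot> ?u = \<zero>\<^bsub>Hom \<C> X P\<^esub>"
      using nat[OF i e] module_hom_zero[OF F.module_axioms module_Hom hom] by simp
    then have uU: "?u \<in> U X" using u by (simp add: U_def)
    have "\<eta> A \<xi> = \<phi> ?u A \<xi>" for A \<xi>
    proof (cases "\<xi> \<in> carrier (F A)")
      case True
      then obtain h where h: "h \<in> Arr \<C> W A" "\<xi> = act W A h e" using gen by blast
      then show ?thesis using nat[OF h(1) e] \<phi>[OF h(1) uU] by simp
    next
      case False
      then show ?thesis using extensional_arb[OF ext] by (simp add: \<phi>_def)
    qed
    then have "\<eta> = \<phi> ?u" unfolding fun_eq_iff by blast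
    then show ?thesis using uU by blast
  qed
  have bij: "bij_betw \<phi> (carrier (?H\<lparr>carrier := U X\<rparr>)) (carrier (Trans X))"
  proof (rule bij_betw_imageI)
    show "inj_on \<phi> (carrier (?H\<lparr>carrier := U X\<rparr>))" by (rule inj_onI, rule inj) simp_all
    show "\<phi> ` carrier (?H\<lparr>carrier := U X\<rparr>) = carrier (Trans X)"
      using surj in_Nat by (simp add: set_eq_iff image_iff) blast
  qed
  have lin: "\<phi> (x \<oplus>\<^bsub>?H\<^esub> y) = \<phi> x \<oplus>\<^bsub>Trans X\<^esub> \<phi> y" if "x \<in> U X" "y \<in> U X" for x y
    using that by (auto simp: \<phi>_def nat_space_def fun_eq_iff restrict_def
        intro!: Comp_add_right[OF ch(1) UA UA])
  have lin': "\<phi> (k \<odot>\<^bsub>?H\<^esub> x) = k \<odot>\<^bsub>Trans X\<^esub> \<phi> x" if "k \<in> carrier K" "x \<in> U X" for k x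
    using that by (auto simp: \<phi>_def nat_space_def fun_eq_iff restrict_def
        intro!: Comp_smult_right[OF ch(1) _ UA])
  have zero: "\<phi> \<zero>\<^bsub>?H\<^esub> = \<zero>\<^bsub>Trans X\<^esub>"
    by (auto simp: \<phi>_def nat_space_def fun_eq_iff restrict_def intro!: Comp_zero_right[OF ch(1)])
  note T = vectorspace_surjective_image[of K "?H\<lparr>carrier := U X\<rparr>" \<phi> "Trans X",
      OF vU bij_betw_imp_surj_on[OF bij]]
  show vN: "vectorspace K (Trans X)" by (rule T(1)) (use lin lin' zero in auto)
  show "vectorspace.dim K (Trans X) = subdim K ?H (U X)" if "vectorspace.fin_dim K ?H"
    unfolding subdim_def
  proof (rule dim_transport[OF vU fin_dim_subspace[OF U that] vN _ bij])
    show "\<phi> \<in> module_hom K (?H\<lparr>carrier := U X\<rparr>) (Trans X)"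
      by (rule T(2)) (use lin lin' zero in auto)
  qed
qed

end

section \<open>Bilinear bifunctors\<close>

lemma module_hom_diff:
  assumes "module K M" "module K N" "f \<in> module_hom K M N" "x \<in> carrier M" "y \<in> carrier M"
  shows "f (x \<ominus>\<^bsub>M\<^esub> y) = f x \<ominus>\<^bsub>N\<^esub> f y"
proof -
  interpret mod_hom K M N f
    using assms by (simp add: mod_hom_def mod_hom_axioms_def)
  show ?thesis using assms by (intro f_minus)
qed

context bilinear_bifunctor
begin

lemma module_Val: "module K (Val F X Y)"
  using vectorspace_Val by (simp add: vectorspace_def)

sublocale Val: vectorspace K "Val F X Y" for X Y by (rule vectorspace_Val)

lemma Pull_closed:
  "\<lbrakk>c \<in> Arr \<C> X X'; \<delta> \<in> carrier (Val F X' Y)\<rbrakk> \<Longrightarrow> Pull F X X' Y c \<delta> \<in> carrier (Val F X Y)"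
  using module_homD(1)[OF Pull_hom] by blast

lemma Push_closed:
  "\<lbrakk>a \<in> Arr \<C> Y Y'; \<delta> \<in> carrier (Val F X Y)\<rbrakk> \<Longrightarrow> Push F X Y Y' a \<delta> \<in> carrier (Val F X Y')"
  using module_homD(1)[OF Push_hom] by blast

lemma Pull_zero: "c \<in> Arr \<C> X X' \<Longrightarrow> Pull F X X' Y c \<zero>\<^bsub>Val F X' Y\<^esub> = \<zero>\<^bsub>Val F X Y\<^esub>"
  by (rule module_hom_zero[OF module_Val module_Val Pull_hom])

lemma Push_zero: "a \<in> Arr \<C> Y Y' \<Longrightarrow> Push F X Y Y' a \<zero>\<^bsub>Val F X Y\<^esub> = \<zero>\<^bsub>Val F X Y'\<^esub>"
  by (rule module_hom_zero[OF module_Val module_Val Push_hom])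

lemma Pull_zero_arrow:
  "\<delta> \<in> carrier (Val F X' Y) \<Longrightarrow> Pull F X X' Y \<zero>\<^bsub>Hom \<C> X X'\<^esub> \<delta> = \<zero>\<^bsub>Val F X Y\<^esub>"
  by (rule module_hom_zero[OF module_Hom module_Val Pull_linear])

lemma Push_zero_arrow:
  "\<delta> \<in> carrier (Val F X Y) \<Longrightarrow> Push F X Y Y' \<zero>\<^bsub>Hom \<C> Y Y'\<^esub> \<delta> = \<zero>\<^bsub>Val F X Y'\<^esub>"
  by (rule module_hom_zero[OF module_Hom module_Val Push_linear])

lemma Pull_diff_arrow:
  "\<lbrakk>\<delta> \<in> carrier (Val F X' Y); c \<in> Arr \<C> X X'; c' \<in> Arr \<C> X X'\<rbrakk> \<Longrightarrow>
    Pull F X X' Y (c \<ominus>\<^bsub>Hom \<C> X X'\<^esub> c') \<delta> = Pull F X X' Y c \<delta> \<ominus>\<^bsub>Val F X Y\<^esub> Pull F X X' Y c' \<delta>"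
  by (rule module_hom_diff[OF module_Hom module_Val Pull_linear])

lemma Push_diff_arrow:
  "\<lbrakk>\<delta> \<in> carrier (Val F X Y); a \<in> Arr \<C> Y Y'; a' \<in> Arr \<C> Y Y'\<rbrakk> \<Longrightarrow>
    Push F X Y Y' (a \<ominus>\<^bsub>Hom \<C> Y Y'\<^esub> a') \<delta> = Push F X Y Y' a \<delta> \<ominus>\<^bsub>Val F X Y'\<^esub> Push F X Y Y' a' \<delta>"
  by (rule module_hom_diff[OF module_Hom module_Val Push_linear])

lemma linear_functor_Push: "linear_functor K \<C> (\<lambda>A. Val F X A) (\<lambda>A B f. Push F X A B f)"
  by unfold_locales (simp_all add: vectorspace_Val Push_hom Push_linear Push_Ident Push_Comp)

end

section \<open>The opposite category\<close>

text \<open>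
  Passing to the opposite category exchanges the two negative extensions in degree \<open>-1\<close>, inflations
  with deflations, and projectives with injectives. The lifting of arrows along inflations and the
  dimension count are proved on one side and transferred to the other in this way.
\<close>

definition opp :: "('k, 'o, 'm, 'e, 'z) extricat_scheme \<Rightarrow> ('k, 'o, 'm, 'e) extricat" where
  "opp \<C> = \<lparr>Hom = (\<lambda>A B. Hom \<C> B A), Comp = (\<lambda>g f. Comp \<C> f g), Ident = Ident \<C>,
     Ext = \<lparr>Val = (\<lambda>X Y. Val (Ext \<C>) Y X),
       Pull = (\<lambda>X X' Y c. Push (Ext \<C>) Y X' X c), Push = (\<lambda>X Y Y' a. Pull (Ext \<C>) Y' Y X a)\<rparr>,
     Rlz = (\<lambda>Z A \<delta>. {(y, B, x). (x, B, y) \<in> Rlz \<C> A Z \<delta>})\<rparr>"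

lemma opp_simps [simp]:
  "Hom (opp \<C>) A B = Hom \<C> B A"
  "Comp (opp \<C>) g f = Comp \<C> f g"
  "Ident (opp \<C>) = Ident \<C>"
  "Val (Ext (opp \<C>)) X Y = Val (Ext \<C>) Y X"
  "Pull (Ext (opp \<C>)) X X' Y c = Push (Ext \<C>) Y X' X c"
  "Push (Ext (opp \<C>)) X Y Y' a = Pull (Ext \<C>) Y' Y X a"
  "(y, B, x) \<in> Rlz (opp \<C>) Z A \<delta> \<longleftrightarrow> (x, B, y) \<in> Rlz \<C> A Z \<delta>"
  by (simp_all add: opp_def)

lemma s_triangle_opp: "s_triangle (opp \<C>) Z y B x A \<delta> \<longleftrightarrow> s_triangle \<C> A x B y Z \<delta>"
  by (simp add: s_triangle_def)

lemma injective_opp: "injective (opp \<C>) P \<longleftrightarrow> projective \<C> P"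
  and projective_opp: "projective (opp \<C>) I \<longleftrightarrow> injective \<C> I"
  by (simp_all add: injective_def projective_def)

lemma inflation_opp: "inflation (opp \<C>) Z B y \<longleftrightarrow> deflation \<C> B Z y"
  by (auto simp: inflation_def deflation_def s_triangle_opp)

lemma linear_category_opp:
  assumes "linear_category K \<C>" shows "linear_category K (opp \<C>)"
proof -
  interpret linear_category K \<C> by fact
  show ?thesis
    by (rule linear_category.intro; (unfold opp_simps)?)
      (rule field_K vectorspace_Hom Ident_Arr Comp_Arr
        Comp_assoc[symmetric] Comp_Ident_left Comp_Ident_right Comp_linear_left Comp_linear_right;
        assumption)+
qed

text \<open>
  A contravariant functor on \<open>\<C>\<close> is a covariant one on the opposite category, so presentations and
  the Yoneda lemma cover both variances.
\<close>

lemma linear_functor_Pull: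
  assumes "bilinear_bifunctor K \<C> F"
  shows "linear_functor K (opp \<C>) (\<lambda>A. Val F A Y) (\<lambda>A B f. Pull F B A Y f)"
proof -
  interpret bilinear_bifunctor K \<C> F by fact
  interpret opp: linear_category K "opp \<C>" by (rule linear_category_opp) unfold_locales
  show ?thesis
    by unfold_locales
      (simp_all only: opp_simps, (rule vectorspace_Val Pull_hom Pull_linear Pull_Ident Pull_Comp;
        assumption)+)
qed

lemma iso_arrow_opp: "iso_arrow (opp \<C>) B A b \<longleftrightarrow> iso_arrow \<C> A B b"
  unfolding iso_arrow_def opp_simps by auto

lemma iso_arrow_inverse:
  assumes "iso_arrow \<C> A B f"
  obtains g where "iso_arrow \<C> B A g" "Comp \<C> g f = Ident \<C> A" "Comp \<C> f g = Ident \<C> B"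
  using assms unfolding iso_arrow_def by blast

text \<open>
  Reversing the arrows of two equivalent sequences turns the connecting isomorphism into its
  inverse.
\<close>

lemma (in linear_category) seq_class_reverse:
  assumes x: "x \<in> Arr \<C> A B" and y: "y \<in> Arr \<C> B Z" and x': "x' \<in> Arr \<C> A B'" and y': "y' \<in> Arr \<C> B' Z"
  shows "(\<exists>b. iso_arrow \<C> B B' b \<and> b \<cdot> x = x' \<and> y' \<cdot> b = y) \<longleftrightarrow>
    (\<exists>b. iso_arrow \<C> B' B b \<and> b \<cdot> x' = x \<and> y \<cdot> b = y')"
proof -
  have "\<exists>b. iso_arrow \<C> B' B b \<and> b \<cdot> x' = x \<and> y \<cdot> b = y'"
    if iso: "iso_arrow \<C> B B' b" "b \<cdot> x = x'" "y' \<cdot> b = y"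
      "x \<in> Arr \<C> A B" "y' \<in> Arr \<C> B' Z" for b x x' y y' B B'
  proof -
    obtain g where g: "iso_arrow \<C> B' B g" "g \<cdot> b = Ident \<C> B" "b \<cdot> g = Ident \<C> B'"
      using iso_arrow_inverse[OF iso(1)] by blast
    then have "g \<in> Arr \<C> B' B" "b \<in> Arr \<C> B B'" using iso(1) by (auto simp: iso_arrow_def)
    then have "g \<cdot> x' = x" "y \<cdot> g = y'"
      using g iso Comp_assoc[OF iso(4), of b B' g] Comp_assoc[of g B' B b B' y' Z]
      by (auto simp: Comp_Ident_left Comp_Ident_right)
    then show ?thesis using g(1) by blast
  qed
  from this[of B B' _ x x' y' y] this[of B' B _ x' x y y'] show ?thesis using assms by auto
qed

lemma seq_class_opp:
  assumes "linear_category K \<C>" "x \<in> Arr \<C> A B" "y \<in> Arr \<C> B Z"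
  shows "(y', B', x') \<in> seq_class (opp \<C>) Z y B x A \<longleftrightarrow> (x', B', y') \<in> seq_class \<C> A x B y Z"
proof -
  interpret linear_category K \<C> by fact
  show ?thesis
    using seq_class_reverse[OF assms(2,3), of x' B' y']
    by (auto simp: seq_class_def iso_arrow_opp)
qed

lemma is_biproduct_opp: "is_biproduct (opp \<C>) A B S i j p q \<longleftrightarrow> is_biproduct \<C> A B S p q i j"
  unfolding is_biproduct_def opp_simps by blast

lemma bilinear_bifunctor_Ext_opp:
  assumes "bilinear_bifunctor K \<C> (Ext \<C>)" shows "bilinear_bifunctor K (opp \<C>) (Ext (opp \<C>))"
proof -
  interpret bilinear_bifunctor K \<C> "Ext \<C>" by fact
  show ?thesis
    by (intro bilinear_bifunctor.intro bilinear_bifunctor_axioms.intro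
        linear_category_opp linear_category_axioms; (unfold opp_simps)?)
      (rule vectorspace_Val Pull_hom Push_hom Pull_linear Push_linear
        Pull_Ident Push_Ident Pull_Comp Push_Comp Push_Pull[symmetric]; assumption)+
qed

lemma Rlz_opp_eq:
  assumes "linear_category K \<C>" "x \<in> Arr \<C> A B" "y \<in> Arr \<C> B Z"
    and "Rlz \<C> Z A \<delta> = seq_class \<C> A x B y Z"
  shows "Rlz (opp \<C>) A Z \<delta> = seq_class (opp \<C>) Z y B x A"
  unfolding set_eq_iff
proof
  fix t show "t \<in> Rlz (opp \<C>) A Z \<delta> \<longleftrightarrow> t \<in> seq_class (opp \<C>) Z y B x A"
    using seq_class_opp[OF assms(1-3)] assms(4) by (cases t) simp
qed

lemma extriangulated_category_opp:
  fixes \<C> (structure)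
  assumes "extriangulated_category K \<C>" shows "extriangulated_category K (opp \<C>)"
proof -
  interpret extriangulated_category K \<C> by fact
  have lc: "linear_category K \<C>" by unfold_locales
  interpret opp: bilinear_bifunctor K "opp \<C>" "Ext (opp \<C>)"
    by (rule bilinear_bifunctor_Ext_opp) unfold_locales
  show ?thesis
  proof (unfold_locales, goal_cases)
    case 1
    show ?case using zero_object by auto
  next
    case (2 A B)
    obtain S i j p q where "is_biproduct \<C> A B S i j p q" using biproducts by blast
    then have "is_biproduct (opp \<C>) A B S p q i j" by (simp add: is_biproduct_opp)
    then show ?case by blast
  next
    case (3 \<delta> Z A)
    then obtain x B y where "x \<in> Arr \<C> Z B" "y \<in> Arr \<C> B A" "Rlz \<C> A Z \<delta> = seq_class \<C> Z x B y A"
      using Rlz_class[of \<delta> A Z] by auto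
    then show ?case using Rlz_opp_eq[OF lc] by (metis opp_simps(1))
  next
    case (4 A x B y Z \<delta> A' x' B' y' Z' \<delta>' a c)
    then show ?case
      using realization[of Z' y' B' x' A' \<delta>' Z y B x A \<delta> c a] by (auto simp: s_triangle_opp)
  next
    case (5 A Z S i j p q)
    then have "is_biproduct \<C> A Z S p q i j" by (simp add: is_biproduct_opp)
    then have bp: "is_biproduct \<C> Z A S q p j i"
      using Hom.M.a_comm[OF Comp_Arr[of i S A p S] Comp_Arr[of j S Z q S]]
      by (simp add: is_biproduct_def)
    then have "q \<in> Arr \<C> Z S" "i \<in> Arr \<C> S A" by (auto simp: is_biproduct_def)
    from Rlz_opp_eq[OF lc this realization_zero[OF bp]] show ?case by simp
  next
    case (6 A x B y Z \<delta> A' x' B' y' Z' \<delta>' SA iA jA pA qA SB iB jB pB qB SZ iZ jZ pZ qZ \<sigma>)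
    note bp = 6(3-5)[unfolded is_biproduct_opp] 
    note bpA = bp(1)[unfolded is_biproduct_def] and bpB = bp(2)[unfolded is_biproduct_def]
      and bpZ = bp(3)[unfolded is_biproduct_def]
    have tr: "s_triangle \<C> Z y B x A \<delta>" "s_triangle \<C> Z' y' B' x' A' \<delta>'"
      using 6(1,2) by (simp_all add: s_triangle_opp)
    have xy: "x \<in> Arr \<C> B A" "y \<in> Arr \<C> Z B" "x' \<in> Arr \<C> B' A'" "y' \<in> Arr \<C> Z' B'"
      using tr Rlz_class[of \<delta> A Z] Rlz_class[of \<delta>' A' Z']
      by (auto simp: s_triangle_def seq_class_def)
    have \<sigma>: "\<sigma> \<in> Extn \<C> SA SZ" using 6(6) by simp
    let ?X = "(pB \<cdot> y \<cdot> iZ) \<oplus>\<^bsub>Hom \<C> SZ SB\<^esub> (qB \<cdot> y' \<cdot> jZ)"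
    let ?Y = "(pA \<cdot> x \<cdot> iB) \<oplus>\<^bsub>Hom \<C> SB SA\<^esub> (qA \<cdot> x' \<cdot> jB)"
    have "Rlz \<C> SA SZ \<sigma> = seq_class \<C> SZ ?X SB ?Y SA"
    proof (rule realization_sum[OF tr bp(3) bp(2) bp(1) \<sigma>])
      show "Push (Ext \<C>) A SZ Z iZ (Pull (Ext \<C>) A SA SZ pA \<sigma>) = \<delta>"
        using 6(7) bpA bpZ \<sigma> by (simp add: Push_Pull)
      show "Push (Ext \<C>) A' SZ Z' jZ (Pull (Ext \<C>) A' SA SZ qA \<sigma>) = \<delta>'"
        using 6(8) bpA bpZ \<sigma> by (simp add: Push_Pull)
      show "Push (Ext \<C>) A SZ Z' jZ (Pull (Ext \<C>) A SA SZ pA \<sigma>) = \<zero>\<^bsub>Val (Ext \<C>) A Z'\<^esub>"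
        using 6(10) bpA bpZ \<sigma> by (simp add: Push_Pull)
      show "Push (Ext \<C>) A' SZ Z iZ (Pull (Ext \<C>) A' SA SZ qA \<sigma>) = \<zero>\<^bsub>Val (Ext \<C>) A' Z\<^esub>"
        using 6(9) bpA bpZ \<sigma> by (simp add: Push_Pull)
    qed
    moreover have "?X \<in> Arr \<C> SZ SB" "?Y \<in> Arr \<C> SB SA"
      using bpA bpB bpZ xy by (auto intro!: Hom.M.a_closed Comp_Arr)
    ultimately have "Rlz (opp \<C>) SZ SA \<sigma> = seq_class (opp \<C>) SA ?Y SB ?X SZ"
      by (rule Rlz_opp_eq[OF lc, rotated 2])
    moreover have "pA \<cdot> x \<cdot> iB = pA \<cdot> (x \<cdot> iB)" "qA \<cdot> x' \<cdot> jB = qA \<cdot> (x' \<cdot> jB)"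
      "pB \<cdot> y \<cdot> iZ = pB \<cdot> (y \<cdot> iZ)" "qB \<cdot> y' \<cdot> jZ = qB \<cdot> (y' \<cdot> jZ)"
      using bpA bpB bpZ xy by (auto intro: Comp_assoc)
    ultimately show ?case by simp
  next
    case (7 A x B y Z \<delta> A' x' B' y' Z' \<delta>' a b)
    then show ?case
      using ET3_op[of Z' y' B' x' A' \<delta>' Z y B x A \<delta> b a] by (auto simp: s_triangle_opp)
  next
    case (8 A x B y Z \<delta> A' x' B' y' Z' \<delta>' b c)
    then show ?case
      using ET3[of Z' y' B' x' A' \<delta>' Z y B x A \<delta> c b] by (simp add: s_triangle_opp) metis
  next
    case (9 A f B f' D \<delta> g Z g' F \<delta>')
    then show ?case
      using ET4_op[of D f' B f A \<delta> F g' Z g \<delta>'] by (simp add: s_triangle_opp)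
  next
    case (10 D f' B f A \<delta> F g' Z g \<delta>')
    then show ?case
      using ET4[of A f B f' D \<delta> g Z g' F \<delta>'] by (simp add: s_triangle_opp)
  qed
qed

section \<open>Exact sequences of extensions\<close>

context extriangulated_category
begin

abbreviation "pl X X' Y c \<equiv> Pull (Ext \<C>) X X' Y c"
abbreviation "ps X Y Y' a \<equiv> Push (Ext \<C>) X Y Y' a"

lemma Ident_Ident: "Ident \<C> A \<cdot> Ident \<C> A = Ident \<C> A"
  by (rule Comp_Ident_left[OF Ident_Arr])

lemma seq_class_refl: "\<lbrakk>x \<in> Arr \<C> A B; y \<in> Arr \<C> B Z\<rbrakk> \<Longrightarrow> (x, B, y) \<in> seq_class \<C> A x B y Z"
  unfolding seq_class_def iso_arrow_def
  by (auto intro!: exI[of _ "Ident \<C> B"] bexI[of _ "Ident \<C> B"]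
      simp: Ident_Arr Ident_Ident Comp_Ident_left Comp_Ident_right)

lemma s_triangleD:
  assumes "s_triangle \<C> A x B y Z \<delta>"
  shows "x \<in> Arr \<C> A B" "y \<in> Arr \<C> B Z" "\<delta> \<in> Extn \<C> Z A"
  using assms Rlz_class[of \<delta> Z A] by (auto simp: s_triangle_def seq_class_def)

lemma s_triangle_exists:
  assumes "\<delta> \<in> Extn \<C> Z A" obtains x B y where "s_triangle \<C> A x B y Z \<delta>"
proof -
  obtain x B y where "x \<in> Arr \<C> A B" "y \<in> Arr \<C> B Z" "Rlz \<C> Z A \<delta> = seq_class \<C> A x B y Z"
    using Rlz_class[OF assms] by blast
  then have "s_triangle \<C> A x B y Z \<delta>" using assms seq_class_refl by (simp add: s_triangle_def)
  then show thesis by (rule that)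
qed

lemma s_triangle_biproduct:
  assumes "is_biproduct \<C> A Z S i j p q"
  shows "s_triangle \<C> A i S q Z \<zero>\<^bsub>Val (Ext \<C>) Z A\<^esub>"
proof -
  have "i \<in> Arr \<C> A S" "q \<in> Arr \<C> S Z" using assms by (simp_all add: is_biproduct_def)
  then show ?thesis
    using realization_zero[OF assms] seq_class_refl by (simp add: s_triangle_def)
qed

definition Zobj where
  "Zobj = (SOME N. \<forall>A. Arr \<C> N A = {\<zero>\<^bsub>Hom \<C> N A\<^esub>} \<and> Arr \<C> A N = {\<zero>\<^bsub>Hom \<C> A N\<^esub>})"

lemma Zobj: "Arr \<C> Zobj A = {\<zero>\<^bsub>Hom \<C> Zobj A\<^esub>}" "Arr \<C> A Zobj = {\<zero>\<^bsub>Hom \<C> A Zobj\<^esub>}"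
  using someI_ex[OF zero_object] by (auto simp: Zobj_def)

text \<open>
  Splitting off a zero object makes \<open>A = A \<rightarrow> 0\<close> and \<open>0 \<rightarrow> A = A\<close> into triangles. Comparing a
  triangle with one of these two, through (ET3), its dual or the realization of morphisms, yields
  the first exactness statements, from which the others follow.
\<close>

lemma biproduct_zero_right:
  "is_biproduct \<C> A Zobj A (Ident \<C> A) \<zero>\<^bsub>Hom \<C> Zobj A\<^esub> (Ident \<C> A) \<zero>\<^bsub>Hom \<C> A Zobj\<^esub>"
  using Zobj Ident_Arr[of Zobj]
  by (simp add: is_biproduct_def Ident_Arr Ident_Ident Comp_Ident_left Comp_Ident_right
      Comp_zero_left Comp_zero_right)

lemma biproduct_zero_left:
  "is_biproduct \<C> Zobj A A \<zero>\<^bsub>Hom \<C> Zobj A\<^esub> (Ident \<C> A) \<zero>\<^bsub>Hom \<C> A Zobj\<^esub> (Ident \<C> A)"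
  using Zobj Ident_Arr[of Zobj]
  by (simp add: is_biproduct_def Ident_Arr Ident_Ident Comp_Ident_left Comp_Ident_right
      Comp_zero_left Comp_zero_right)

lemmas triv_right = s_triangle_biproduct[OF biproduct_zero_right]
lemmas triv_left = s_triangle_biproduct[OF biproduct_zero_left]

lemma zero_arrow [intro, simp]: "\<zero>\<^bsub>Hom \<C> A B\<^esub> \<in> Arr \<C> A B" by simp

context
  fixes A x B y Z \<delta>
  assumes tri: "s_triangle \<C> A x B y Z \<delta>"
begin

lemma arrows: "x \<in> Arr \<C> A B" "y \<in> Arr \<C> B Z" "\<delta> \<in> Extn \<C> Z A"
  using s_triangleD[OF tri] .

lemma deflation_inflation_zero: "y \<cdot> x = \<zero>\<^bsub>Hom \<C> A Z\<^esub>"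
proof -
  have "x \<cdot> Ident \<C> A = x \<cdot> Ident \<C> A" ..
  from ET3[OF triv_right tri Ident_Arr arrows(1) this]
  obtain c where "c \<in> Arr \<C> Zobj Z" "c \<cdot> \<zero>\<^bsub>Hom \<C> A Zobj\<^esub> = y \<cdot> x" by blast
  then show ?thesis using Comp_zero_right by metis
qed

lemma factor_through_inflation:
  assumes "f \<in> Arr \<C> X B" "y \<cdot> f = \<zero>\<^bsub>Hom \<C> X Z\<^esub>"
  shows "\<exists>g \<in> Arr \<C> X A. f = x \<cdot> g"
proof -
  have "\<zero>\<^bsub>Hom \<C> Zobj Z\<^esub> \<cdot> \<zero>\<^bsub>Hom \<C> X Zobj\<^esub> = y \<cdot> f"
    using assms Comp_zero_left by simp
  from ET3_op[OF triv_right tri assms(1) zero_arrow this]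
  obtain a where "a \<in> Arr \<C> X A" "f \<cdot> Ident \<C> X = x \<cdot> a" by blast
  then show ?thesis using assms(1) Comp_Ident_right by auto
qed

lemma factor_through_deflation:
  assumes "f \<in> Arr \<C> B X" "f \<cdot> x = \<zero>\<^bsub>Hom \<C> A X\<^esub>"
  shows "\<exists>g \<in> Arr \<C> Z X. f = g \<cdot> y"
proof -
  have "f \<cdot> x = \<zero>\<^bsub>Hom \<C> Zobj X\<^esub> \<cdot> \<zero>\<^bsub>Hom \<C> A Zobj\<^esub>"
    unfolding Comp_zero_left[OF zero_arrow] by (rule assms(2))
  from ET3[OF tri triv_left zero_arrow assms(1) this]
  obtain c where "c \<in> Arr \<C> Z X" "c \<cdot> y = Ident \<C> X \<cdot> f" by blast
  then show ?thesis using assms(1) Comp_Ident_left by auto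
qed

lemma Pull_deflation: "pl B Z A y \<delta> = \<zero>\<^bsub>Val (Ext \<C>) B A\<^esub>"
proof -
  have "y \<cdot> Ident \<C> B = y \<cdot> Ident \<C> B" ..
  from ET3_op[OF triv_left tri Ident_Arr arrows(2) this]
  obtain a where "a \<in> Arr \<C> Zobj A" "ps B Zobj A a \<zero>\<^bsub>Val (Ext \<C>) B Zobj\<^esub> = pl B Z A y \<delta>" by blast
  then show ?thesis using Push_zero by metis
qed

lemma Push_inflation: "ps Z A B x \<delta> = \<zero>\<^bsub>Val (Ext \<C>) Z B\<^esub>"
proof -
  have "Ident \<C> B \<cdot> x = Ident \<C> B \<cdot> x" ..
  from ET3[OF tri triv_right arrows(1) Ident_Arr this]
  obtain c where "c \<in> Arr \<C> Z Zobj" "ps Z A B x \<delta> = pl Z Zobj B c \<zero>\<^bsub>Val (Ext \<C>) Zobj B\<^esub>" by blast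
  then show ?thesis using Pull_zero by metis
qed

lemma Pull_eq_zero_iff:
  assumes c: "c \<in> Arr \<C> X Z"
  shows "pl X Z A c \<delta> = \<zero>\<^bsub>Val (Ext \<C>) X A\<^esub> \<longleftrightarrow> (\<exists>g \<in> Arr \<C> X B. c = y \<cdot> g)"
proof
  assume "pl X Z A c \<delta> = \<zero>\<^bsub>Val (Ext \<C>) X A\<^esub>"
  then have "ps X Zobj A \<zero>\<^bsub>Hom \<C> Zobj A\<^esub> \<zero>\<^bsub>Val (Ext \<C>) X Zobj\<^esub> = pl X Z A c \<delta>"
    using Push_zero by simp
  from realization[OF triv_left tri zero_arrow c this] show "\<exists>g \<in> Arr \<C> X B. c = y \<cdot> g"
    using Comp_Ident_right[OF c] by metis
next
  assume "\<exists>g \<in> Arr \<C> X B. c = y \<cdot> g"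
  then show "pl X Z A c \<delta> = \<zero>\<^bsub>Val (Ext \<C>) X A\<^esub>"
    using Pull_Comp[OF _ arrows(2,3)] Pull_deflation Pull_zero by auto
qed

lemma Push_eq_zero_iff:
  assumes a: "a \<in> Arr \<C> A X"
  shows "ps Z A X a \<delta> = \<zero>\<^bsub>Val (Ext \<C>) Z X\<^esub> \<longleftrightarrow> (\<exists>g \<in> Arr \<C> B X. a = g \<cdot> x)"
proof
  assume "ps Z A X a \<delta> = \<zero>\<^bsub>Val (Ext \<C>) Z X\<^esub>"
  then have "ps Z A X a \<delta> = pl Z Zobj X \<zero>\<^bsub>Hom \<C> Z Zobj\<^esub> \<zero>\<^bsub>Val (Ext \<C>) Zobj X\<^esub>"
    using Pull_zero by simp
  from realization[OF tri triv_right a zero_arrow this] show "\<exists>g \<in> Arr \<C> B X. a = g \<cdot> x"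
    using Comp_Ident_left[OF a] by metis
next
  assume "\<exists>g \<in> Arr \<C> B X. a = g \<cdot> x"
  then show "ps Z A X a \<delta> = \<zero>\<^bsub>Val (Ext \<C>) Z X\<^esub>"
    using Push_Comp[OF arrows(1) _ arrows(3)] Push_inflation Push_zero by auto
qed

text \<open>
  An extension \<open>\<epsilon>\<close> killed by \<open>y\<^sup>*\<close> is realized by some \<open>w\<close> through which \<open>y\<close> factors; completing
  the factorization and the identity of \<open>Z\<close> to a morphism of triangles exhibits \<open>\<epsilon>\<close> as \<open>a\<^sub>* \<delta>\<close>.
\<close>

lemma Push_surjective_on_kernel:
  assumes \<epsilon>: "\<epsilon> \<in> Extn \<C> Z X" and "pl B Z X y \<epsilon> = \<zero>\<^bsub>Val (Ext \<C>) B X\<^esub>"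
  shows "\<exists>a \<in> Arr \<C> A X. ps Z A X a \<delta> = \<epsilon>"
proof -
  obtain x' W w where t: "s_triangle \<C> X x' W w Z \<epsilon>" using s_triangle_exists[OF \<epsilon>] .
  from extriangulated_category.Pull_eq_zero_iff[OF extriangulated_category_axioms t arrows(2)] assms(2)
  obtain g where g: "g \<in> Arr \<C> B W" "y = w \<cdot> g" by blast
  have "Ident \<C> Z \<cdot> y = w \<cdot> g" using g arrows Comp_Ident_left by simp
  from ET3_op[OF tri t g(1) Ident_Arr this] show ?thesis
    using Pull_Ident[OF \<epsilon>] by auto
qed

lemma Pull_surjective_on_kernel:
  assumes \<epsilon>: "\<epsilon> \<in> Extn \<C> X A" and "ps X A B x \<epsilon> = \<zero>\<^bsub>Val (Ext \<C>) X B\<^esub>"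
  shows "\<exists>c \<in> Arr \<C> X Z. pl X Z A c \<delta> = \<epsilon>"
proof -
  obtain x' W w where t: "s_triangle \<C> A x' W w X \<epsilon>" using s_triangle_exists[OF \<epsilon>] .
  from extriangulated_category.Push_eq_zero_iff[OF extriangulated_category_axioms t arrows(1)] assms(2)
  obtain g where g: "g \<in> Arr \<C> W B" "x = g \<cdot> x'" by blast
  have "g \<cdot> x' = x \<cdot> Ident \<C> A" using g arrows Comp_Ident_right by simp
  from ET3[OF t tri Ident_Arr g(1) this] show ?thesis
    using Push_Ident[OF \<epsilon>] by metis
qed

end

text \<open>
  Let \<open>\<epsilon> \<in> \<E>(Z, W)\<close> have a projective middle term \<open>P\<close>. Since \<open>\<delta>\<close> vanishes on \<open>P\<close>, it is \<open>a\<^sub>* \<epsilon>\<close> for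
  some \<open>a : W \<rightarrow> A\<close>. The point is that \<open>W \<rightarrow> A \<oplus> P\<close> with components \<open>a\<close> and \<open>i\<close> is an inflation
  whose deflation restricts on \<open>A\<close> to \<open>x\<close>, up to an isomorphism and a sign: then an
  arrow \<open>f\<close> with \<open>x \<cdot> f = 0\<close>, seen as an arrow to \<open>A \<oplus> P\<close>, is killed by this deflation and lifts to \<open>W\<close>.

  The inflation is the composite of the graph \<open>W \<rightarrow> W \<oplus> A\<close> of \<open>a\<close>, which is a split inflation, and
  of \<open>i \<oplus> 1 : W \<oplus> A \<rightarrow> P \<oplus> A\<close>, which is one as a direct sum; (ET4) describes its deflation.
\<close>

lemma lift_along_inflation:
  assumes tri: "s_triangle \<C> A x B y Z \<delta>" and pres: "s_triangle \<C> W i P p Z \<epsilon>"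
    and P: "projective \<C> P"
    and f: "f \<in> Arr \<C> X A" "x \<cdot> f = \<zero>\<^bsub>Hom \<C> X B\<^esub>"
  shows "\<exists>a \<in> Arr \<C> W A. \<exists>k \<in> Arr \<C> X W. f = a \<cdot> k \<and> i \<cdot> k = \<zero>\<^bsub>Hom \<C> X P\<^esub>"
proof -
  note T = s_triangleD[OF tri] and Q = s_triangleD[OF pres]
  have "pl P Z A p \<delta> = \<zero>\<^bsub>Val (Ext \<C>) P A\<^esub>"
    using P Pull_closed[OF Q(2) T(3)] by (auto simp: projective_def)
  then obtain a where a: "a \<in> Arr \<C> W A" "ps Z W A a \<epsilon> = \<delta>"
    using Push_surjective_on_kernel[OF pres T(3)] by blast
  \<comment> \<open>the direct sum of the triangle of \<open>\<epsilon>\<close> with \<open>A = A \<rightarrow> 0\<close>\<close>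
  obtain S iW jA pW qA where bpS: "is_biproduct \<C> W A S iW jA pW qA" using biproducts by blast
  obtain S' iP jA' pP qA' where bpS': "is_biproduct \<C> P A S' iP jA' pP qA'" using biproducts by blast
  note b = bpS[unfolded is_biproduct_def] and b' = bpS'[unfolded is_biproduct_def]
  define \<sigma> where "\<sigma> = ps Z W S iW \<epsilon>"
  have \<sigma>: "\<sigma> \<in> Extn \<C> Z S" unfolding \<sigma>_def using b Q by (intro Push_closed) auto
  let ?g = "(iP \<cdot> i \<cdot> pW) \<oplus>\<^bsub>Hom \<C> S S'\<^esub> (jA' \<cdot> Ident \<C> A \<cdot> qA)"
  let ?h = "(Ident \<C> Z \<cdot> p \<cdot> pP) \<oplus>\<^bsub>Hom \<C> S' Z\<^esub> (\<zero>\<^bsub>Hom \<C> Zobj Z\<^esub> \<cdot> \<zero>\<^bsub>Hom \<C> A Zobj\<^esub> \<cdot> qA')"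
  have gA: "?g \<in> Arr \<C> S S'"
    by (intro Hom.M.a_closed Comp_Arr) (use b b' Q in \<open>auto intro: Comp_Arr Ident_Arr\<close>)
  have hA: "?h \<in> Arr \<C> S' Z"
    by (intro Hom.M.a_closed Comp_Arr) (use b b' Q in \<open>auto intro: Comp_Arr Ident_Arr\<close>)
  have "Rlz \<C> Z S \<sigma> = seq_class \<C> S ?g S' ?h Z"
  proof (rule realization_sum[OF pres triv_right bpS bpS' biproduct_zero_right \<sigma>])
    show "ps Z S W pW (pl Z Z S (Ident \<C> Z) \<sigma>) = \<epsilon>"
      using Pull_Ident[OF \<sigma>] Push_Comp[of iW W S pW W \<epsilon> Z] b Q Push_Ident by (simp add: \<sigma>_def)
    show "ps Z S A qA (pl Z Z S (Ident \<C> Z) \<sigma>) = \<zero>\<^bsub>Val (Ext \<C>) Z A\<^esub>"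
      using Pull_Ident[OF \<sigma>] Push_Comp[of iW W S qA A \<epsilon> Z] b Q Push_zero_arrow by (simp add: \<sigma>_def)
    show "ps Zobj S A qA (pl Zobj Z S \<zero>\<^bsub>Hom \<C> Zobj Z\<^esub> \<sigma>) = \<zero>\<^bsub>Val (Ext \<C>) Zobj A\<^esub>"
      using Pull_zero_arrow[OF \<sigma>] Push_zero b by simp
    show "ps Zobj S W pW (pl Zobj Z S \<zero>\<^bsub>Hom \<C> Zobj Z\<^esub> \<sigma>) = \<zero>\<^bsub>Val (Ext \<C>) Zobj W\<^esub>"
      using Pull_zero_arrow[OF \<sigma>] Push_zero b by simp
  qed
  then have tg: "s_triangle \<C> S ?g S' ?h Z \<sigma>"
    using seq_class_refl[OF gA hA] \<sigma> by (simp add: s_triangle_def)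
  \<comment> \<open>the split triangle on the graph of \<open>a\<close>\<close>
  let ?m = "iW \<oplus>\<^bsub>Hom \<C> W S\<^esub> jA \<cdot> a"
  let ?n = "qA \<ominus>\<^bsub>Hom \<C> S A\<^esub> a \<cdot> pW"
  have ja: "jA \<cdot> a \<in> Arr \<C> W S" and ap: "a \<cdot> pW \<in> Arr \<C> S A"
    using a b by (auto intro: Comp_Arr)
  have mA: "?m \<in> Arr \<C> W S" and nA: "?n \<in> Arr \<C> S A" using ja ap b by auto
  have iW: "iW \<in> Arr \<C> W S" and jA: "jA \<in> Arr \<C> A S" and pW: "pW \<in> Arr \<C> S W"
    and qA: "qA \<in> Arr \<C> S A" using b by auto
  have pm: "pW \<cdot> ?m = Ident \<C> W"
    using Comp_add_right[OF pW iW ja] Comp_assoc[OF a(1) jA pW, symmetric] Comp_zero_left[OF a(1)] b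
    by (simp add: Ident_Arr)
  have qm: "qA \<cdot> ?m = a"
    using Comp_add_right[OF qA iW ja] Comp_assoc[OF a(1) jA qA, symmetric] Comp_Ident_left[OF a(1)] b a
    by simp
  have nj: "?n \<cdot> jA = Ident \<C> A"
    using Comp_diff_left[OF jA qA ap] Comp_assoc[OF jA pW a(1)] Comp_zero_right[OF a(1)] b
    by (simp add: Ident_Arr a_minus_def)
  have nm: "?n \<cdot> ?m = \<zero>\<^bsub>Hom \<C> W A\<^esub>"
    using Comp_diff_left[OF mA qA ap] Comp_assoc[OF mA pW a(1)] Comp_Ident_right[OF a(1)] pm qm a
    by simp
  have "(?m \<cdot> pW) \<oplus>\<^bsub>Hom \<C> S S\<^esub> (jA \<cdot> ?n) = Ident \<C> S"
  proof -
    let ?r = "jA \<cdot> (a \<cdot> pW)"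
    have m: "?m \<cdot> pW = iW \<cdot> pW \<oplus>\<^bsub>Hom \<C> S S\<^esub> ?r"
      using Comp_add_left[OF pW iW ja] Comp_assoc[OF pW a(1) jA] by simp
    have n: "jA \<cdot> ?n = jA \<cdot> qA \<ominus>\<^bsub>Hom \<C> S S\<^esub> ?r"
      using Comp_diff_right[OF jA qA ap] .
    have r: "?r \<in> Arr \<C> S S" "iW \<cdot> pW \<in> Arr \<C> S S" "jA \<cdot> qA \<in> Arr \<C> S S"
      using Comp_Arr[OF ap jA] Comp_Arr[OF pW iW] Comp_Arr[OF qA jA] by auto
    have "(?m \<cdot> pW) \<oplus>\<^bsub>Hom \<C> S S\<^esub> (jA \<cdot> ?n) = iW \<cdot> pW \<oplus>\<^bsub>Hom \<C> S S\<^esub> jA \<cdot> qA"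
      unfolding m n
      using r by (simp add: a_minus_def Hom.M.a_assoc
          Hom.M.a_lcomm[where x = ?r and y = "jA \<cdot> qA"] Hom.M.r_neg)
    then show ?thesis using b by simp
  qed
  then have "is_biproduct \<C> W A S ?m jA pW ?n"
    using mA nA pm nj nm b by (simp add: is_biproduct_def)
  from s_triangle_biproduct[OF this]
  have tm: "s_triangle \<C> W ?m S ?n A \<zero>\<^bsub>Val (Ext \<C>) A W\<^esub>" .
  from ET4[OF tm tg] obtain G d e h' \<delta>'' where
    d: "d \<in> Arr \<C> A G" and th: "s_triangle \<C> W (?g \<cdot> ?m) S' h' G \<delta>''"
    and hg: "h' \<cdot> ?g = d \<cdot> ?n" and td: "s_triangle \<C> A d G e Z (ps Z S A ?n \<sigma>)" by blast
  \<comment> \<open>the triangle on \<open>d\<close> realizes \<open>- \<delta>\<close>, hence \<open>d\<close> factors through \<open>x\<close>\<close>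
  let ?minus = "\<ominus>\<^bsub>Hom \<C> A A\<^esub> Ident \<C> A"
  have minus: "?minus \<in> Arr \<C> A A" using Ident_Arr by simp
  have "ps Z S A ?n \<sigma> = ps Z W A (?n \<cdot> iW) \<epsilon>"
    using Push_Comp[OF iW nA Q(3)] by (simp add: \<sigma>_def)
  also have "?n \<cdot> iW = ?minus \<cdot> a"
    using Comp_diff_left[OF iW qA ap] Comp_assoc[OF iW pW a(1)] Comp_Ident_right[OF a(1)] b a
      Comp_neg_left[OF a(1) Ident_Arr] Comp_Ident_left[OF a(1)] by (simp add: a_minus_def)
  also have "ps Z W A (?minus \<cdot> a) \<epsilon> = pl Z Z A (Ident \<C> Z) (ps Z W A (?minus \<cdot> a) \<epsilon>)"
    using Pull_Ident Push_closed[OF Comp_Arr[OF a(1) minus] Q(3)] by simp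
  finally have "ps Z A A ?minus \<delta> = pl Z Z A (Ident \<C> Z) (ps Z S A ?n \<sigma>)"
    using Push_Comp[OF a(1) minus Q(3)] a(2) Pull_Ident Push_closed[OF minus T(3)] by simp
  from realization[OF tri td minus Ident_Arr this]
  obtain \<beta> where \<beta>: "\<beta> \<in> Arr \<C> B G" "\<beta> \<cdot> x = d \<cdot> ?minus" by blast
  have "d \<cdot> ?minus = \<ominus>\<^bsub>Hom \<C> A G\<^esub> d"
    using Comp_neg_right[OF d Ident_Arr] Comp_Ident_right[OF d] by simp
  then have "\<ominus>\<^bsub>Hom \<C> X G\<^esub> (d \<cdot> f) = (\<beta> \<cdot> x) \<cdot> f"
    using \<beta>(2) Comp_neg_left[OF f(1) d] by simp
  also have "\<dots> = \<zero>\<^bsub>Hom \<C> X G\<^esub>"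
    using Comp_assoc[OF f(1) T(1) \<beta>(1)] f(2) Comp_zero_right[OF \<beta>(1)] by simp
  finally have df: "d \<cdot> f = \<zero>\<^bsub>Hom \<C> X G\<^esub>"
    using Comp_Arr[OF f(1) d] Hom.M.add.inv_eq_1_iff by fastforce
  have iP: "iP \<in> Arr \<C> P S'" and jA': "jA' \<in> Arr \<C> A S'" and pP: "pP \<in> Arr \<C> S' P"
    and qA': "qA' \<in> Arr \<C> S' A" using b' by auto
  have ipW: "i \<cdot> pW \<in> Arr \<C> S P" using Comp_Arr[OF pW Q(1)] .
  have g: "?g = iP \<cdot> (i \<cdot> pW) \<oplus>\<^bsub>Hom \<C> S S'\<^esub> jA' \<cdot> qA"
    using Comp_assoc[OF pW Q(1) iP] Comp_Ident_right[OF jA'] by simp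
  note parts = Comp_Arr[OF ipW iP] Comp_Arr[OF qA jA']
  have gj: "?g \<cdot> jA = jA'"
    unfolding g using Comp_add_left[OF jA parts] Comp_assoc[OF jA ipW iP] Comp_assoc[OF jA pW Q(1)]
      Comp_assoc[OF jA qA jA'] Comp_Ident_right[OF jA'] Comp_zero_right[OF Q(1)]
      Comp_zero_right[OF iP] b jA' by simp
  have qg: "qA' \<cdot> ?g = qA"
    unfolding g using Comp_add_right[OF qA' parts] Comp_assoc[OF ipW iP qA', symmetric]
      Comp_assoc[OF qA jA' qA', symmetric] Comp_Ident_left[OF qA] Comp_zero_left[OF ipW] b' qA by simp
  have pg: "pP \<cdot> ?g = i \<cdot> pW"
    unfolding g using Comp_add_right[OF pP parts] Comp_assoc[OF ipW iP pP, symmetric]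
      Comp_assoc[OF qA jA' pP, symmetric] Comp_Ident_left[OF ipW] Comp_zero_left[OF qA] b' ipW by simp
  have h': "h' \<in> Arr \<C> S' G" using s_triangleD[OF th] by simp
  have "h' \<cdot> jA' = (h' \<cdot> ?g) \<cdot> jA" using Comp_assoc[OF jA gA h'] gj by simp
  also have "\<dots> = d" using Comp_assoc[OF jA nA d] hg nj Comp_Ident_right[OF d] by simp
  finally have "h' \<cdot> (jA' \<cdot> f) = \<zero>\<^bsub>Hom \<C> X G\<^esub>"
    using Comp_assoc[OF f(1) jA' h'] df by simp
  from factor_through_inflation[OF th Comp_Arr[OF f(1) jA'] this]
  obtain k where k: "k \<in> Arr \<C> X W" "jA' \<cdot> f = (?g \<cdot> ?m) \<cdot> k" by blast
  have mk: "?m \<cdot> k \<in> Arr \<C> X S" using Comp_Arr[OF k(1) mA] .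
  have jf: "jA' \<cdot> f = ?g \<cdot> (?m \<cdot> k)" using k(2) Comp_assoc[OF k(1) mA gA] by simp
  have "f = qA' \<cdot> (jA' \<cdot> f)"
    using Comp_assoc[OF f(1) jA' qA', symmetric] Comp_Ident_left[OF f(1)] b' by simp
  also have "\<dots> = qA \<cdot> (?m \<cdot> k)" using Comp_assoc[OF mk gA qA'] jf qg by simp
  also have "\<dots> = a \<cdot> k" using Comp_assoc[OF k(1) mA qA] qm by simp
  finally have fak: "f = a \<cdot> k" .
  have "i \<cdot> k = i \<cdot> ((pW \<cdot> ?m) \<cdot> k)" using pm Comp_Ident_left[OF k(1)] by simp
  also have "\<dots> = (i \<cdot> pW) \<cdot> (?m \<cdot> k)"
    using Comp_assoc[OF k(1) mA pW] Comp_assoc[OF mk pW Q(1)] by simp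
  also have "\<dots> = pP \<cdot> (jA' \<cdot> f)" using Comp_assoc[OF mk gA pP] jf pg by simp
  also have "\<dots> = \<zero>\<^bsub>Hom \<C> X P\<^esub>"
    using Comp_assoc[OF f(1) jA' pP, symmetric] Comp_zero_left[OF f(1)] b' by simp
  finally show ?thesis using fak a(1) k(1) by blast
qed

end

section \<open>Free modules and quotients\<close>

text \<open>
  The linear map on a free module with prescribed values \<open>\<beta>\<close> on the generators.
\<close>

definition lin_ext :: "'k ring \<Rightarrow> ('k, 'w) module \<Rightarrow> ('s \<Rightarrow> 'w) \<Rightarrow> ('s \<Rightarrow> 'k) \<Rightarrow> 'w" where
  "lin_ext K W \<beta> v = (\<Oplus>\<^bsub>W\<^esub>s \<in> {s. v s \<noteq> \<zero>\<^bsub>K\<^esub>}. v s \<odot>\<^bsub>W\<^esub> \<beta> s)"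

context
  fixes K :: "'k ring" (structure)
  assumes K: "field K"
begin

interpretation field K by (rule K)

lemma free_simps:
  "\<zero>\<^bsub>free_module K S\<^esub> = (\<lambda>s. \<zero>)"
  "u \<oplus>\<^bsub>free_module K S\<^esub> v = (\<lambda>s. u s \<oplus> v s)"
  "k \<odot>\<^bsub>free_module K S\<^esub> v = (\<lambda>s. k \<otimes> v s)"
  "v \<in> carrier (free_module K S) \<longleftrightarrow>
     (\<forall>s. v s \<in> carrier K) \<and> finite {s. v s \<noteq> \<zero>} \<and> {s. v s \<noteq> \<zero>} \<subseteq> S"
  by (simp_all add: free_module_def)

lemma supp_add: "{s. u s \<oplus> v s \<noteq> \<zero>} \<subseteq> {s. u s \<noteq> \<zero>} \<union> {s. v s \<noteq> \<zero>}"
  by auto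

lemma free_add_closed:
  "\<lbrakk>u \<in> carrier (free_module K S); v \<in> carrier (free_module K S)\<rbrakk>
    \<Longrightarrow> u \<oplus>\<^bsub>free_module K S\<^esub> v \<in> carrier (free_module K S)"
  unfolding free_simps
  using finite_subset[OF supp_add[of u v]] supp_add[of u v] by auto

lemma free_smult_closed:
  assumes "k \<in> carrier K" "v \<in> carrier (free_module K S)"
  shows "k \<odot>\<^bsub>free_module K S\<^esub> v \<in> carrier (free_module K S)"
proof -
  have "{s. k \<otimes> v s \<noteq> \<zero>} \<subseteq> {s. v s \<noteq> \<zero>}" using assms(1) by auto
  then show ?thesis using assms unfolding free_simps by (auto intro: finite_subset)
qed

lemma vectorspace_free: "vectorspace K (free_module K S)"
proof (rule vs_criteria)
  show "field K" by (rule K)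
  show "\<forall>v\<in>carrier (free_module K S).
      \<exists>w\<in>carrier (free_module K S). v \<oplus>\<^bsub>free_module K S\<^esub> w = \<zero>\<^bsub>free_module K S\<^esub>"
  proof
    fix v assume v: "v \<in> carrier (free_module K S)"
    then have "(\<ominus> \<one>) \<odot>\<^bsub>free_module K S\<^esub> v \<in> carrier (free_module K S)"
      by (intro free_smult_closed) auto
    moreover have "v \<oplus>\<^bsub>free_module K S\<^esub> ((\<ominus> \<one>) \<odot>\<^bsub>free_module K S\<^esub> v) = \<zero>\<^bsub>free_module K S\<^esub>"
      using v by (auto simp: free_simps l_minus r_neg)
    ultimately show "\<exists>w\<in>carrier (free_module K S).
        v \<oplus>\<^bsub>free_module K S\<^esub> w = \<zero>\<^bsub>free_module K S\<^esub>" by blast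
  qed
  show "\<forall>v w. v \<in> carrier (free_module K S) \<and> w \<in> carrier (free_module K S) \<longrightarrow>
      v \<oplus>\<^bsub>free_module K S\<^esub> w \<in> carrier (free_module K S)"
    using free_add_closed by blast
  show "\<forall>c v. c \<in> carrier K \<and> v \<in> carrier (free_module K S) \<longrightarrow>
      c \<odot>\<^bsub>free_module K S\<^esub> v \<in> carrier (free_module K S)"
    using free_smult_closed by blast
qed (auto simp: free_simps a_assoc m_assoc l_distr r_distr intro!: ext a_comm)

lemma unit_vec_closed: "s \<in> S \<Longrightarrow> unit_vec K s \<in> carrier (free_module K S)"
  by (auto simp: free_simps unit_vec_def)

lemma free_module_induct [consumes 1, case_names zero add]:
  assumes "v \<in> carrier (free_module K S)"
    and zero: "P \<zero>\<^bsub>free_module K S\<^esub>"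
    and add: "\<And>s k v. \<lbrakk>s \<in> S; k \<in> carrier K; v \<in> carrier (free_module K S); P v\<rbrakk>
      \<Longrightarrow> P ((k \<odot>\<^bsub>free_module K S\<^esub> unit_vec K s) \<oplus>\<^bsub>free_module K S\<^esub> v)"
  shows "P v"
proof -
  have "finite T \<Longrightarrow> \<forall>v \<in> carrier (free_module K S). {s. v s \<noteq> \<zero>} = T \<longrightarrow> P v" for T
  proof (induction T rule: finite_induct)
    case empty
    show ?case
    proof (intro ballI impI)
      fix v assume "v \<in> carrier (free_module K S)" "{s. v s \<noteq> \<zero>} = {}"
      then have "v = \<zero>\<^bsub>free_module K S\<^esub>" by (auto simp: free_simps)
      then show "P v" using zero by simp
    qed
  next
    case (insert s T)
    show ?case
    proof (intro ballI impI)
      fix v assume v: "v \<in> carrier (free_module K S)" and supp: "{s. v s \<noteq> \<zero>} = insert s T"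
      let ?w = "v(s := \<zero>)"
      have "{t. ?w t \<noteq> \<zero>} = {t. v t \<noteq> \<zero>} - {s}" by auto
      then have wT: "{t. ?w t \<noteq> \<zero>} = T" using supp insert.hyps by auto
      then have w: "?w \<in> carrier (free_module K S)"
        using v supp insert.hyps by (auto simp: free_simps)
      have s: "s \<in> S" using v supp by (auto simp: free_simps)
      have "v = (v s \<odot>\<^bsub>free_module K S\<^esub> unit_vec K s) \<oplus>\<^bsub>free_module K S\<^esub> ?w"
        using v by (auto simp: free_simps unit_vec_def)
      moreover have "P ((v s \<odot>\<^bsub>free_module K S\<^esub> unit_vec K s) \<oplus>\<^bsub>free_module K S\<^esub> ?w)"
        using add[OF s _ w] insert.IH wT w v by (auto simp: free_simps)
      ultimately show "P v" by simp
    qed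
  qed
  then show ?thesis using assms(1) by (auto simp: free_simps)
qed

lemma finsum_support:
  assumes "finite T" "{s. v s \<noteq> \<zero>} \<subseteq> T" "\<And>s. v s \<in> carrier K"
  shows "(\<Oplus>s \<in> {s. v s \<noteq> \<zero> \<and> Q s}. v s) = (\<Oplus>s \<in> {s \<in> T. Q s}. v s)"
  by (rule add.finprod_mono_neutral_cong_left) (use assms in auto)

lemma free_map_hom:
  assumes "\<phi> ` S \<subseteq> S'"
  shows "free_map K \<phi> \<in> module_hom K (free_module K S) (free_module K S')"
proof (rule module_homI)
  fix u assume u: "u \<in> carrier (free_module K S)"
  let ?U = "{s. u s \<noteq> \<zero>}"
  have U: "finite ?U" "?U \<subseteq> S" "\<And>s. u s \<in> carrier K" using u by (auto simp: free_simps)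
  have supp: "{t. free_map K \<phi> u t \<noteq> \<zero>} \<subseteq> \<phi> ` ?U"
  proof
    fix t assume t: "t \<in> {t. free_map K \<phi> u t \<noteq> \<zero>}"
    have "{s. u s \<noteq> \<zero> \<and> \<phi> s = t} \<noteq> {}"
      using t by (auto simp: free_map_def simp del: Collect_empty_eq)
    then show "t \<in> \<phi> ` ?U" by auto
  qed
  then have "{t. free_map K \<phi> u t \<noteq> \<zero>} \<subseteq> S'" using U(2) assms by blast
  moreover have "free_map K \<phi> u t \<in> carrier K" for t
    unfolding free_map_def using U by (intro finsum_closed) auto
  ultimately show "free_map K \<phi> u \<in> carrier (free_module K S')"
    using U(1) finite_subset[OF supp] unfolding free_simps by auto
  {
    fix v assume v: "v \<in> carrier (free_module K S)"
    let ?T = "?U \<union> {s. v s \<noteq> \<zero>}"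
    have V: "finite {s. v s \<noteq> \<zero>}" "\<And>s. v s \<in> carrier K" using v by (auto simp: free_simps)
    have "free_map K \<phi> (u \<oplus>\<^bsub>free_module K S\<^esub> v) t = free_map K \<phi> u t \<oplus> free_map K \<phi> v t" for t
    proof -
      have "free_map K \<phi> (u \<oplus>\<^bsub>free_module K S\<^esub> v) t = (\<Oplus>s \<in> {s \<in> ?T. \<phi> s = t}. u s \<oplus> v s)"
        unfolding free_map_def free_simps by (rule finsum_support) (use U V supp_add in auto)
      also have "\<dots> = (\<Oplus>s \<in> {s \<in> ?T. \<phi> s = t}. u s) \<oplus> (\<Oplus>s \<in> {s \<in> ?T. \<phi> s = t}. v s)"
        using U V by (intro finsum_addf) auto
      also have "(\<Oplus>s \<in> {s \<in> ?T. \<phi> s = t}. u s) = free_map K \<phi> u t"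
        unfolding free_map_def by (rule finsum_support[symmetric]) (use U V in auto)
      also have "(\<Oplus>s \<in> {s \<in> ?T. \<phi> s = t}. v s) = free_map K \<phi> v t"
        unfolding free_map_def by (rule finsum_support[symmetric]) (use U V in auto)
      finally show ?thesis .
    qed
    then show "free_map K \<phi> (u \<oplus>\<^bsub>free_module K S\<^esub> v)
        = free_map K \<phi> u \<oplus>\<^bsub>free_module K S'\<^esub> free_map K \<phi> v"
      by (auto simp: free_simps(2))
  }
  fix k assume k: "k \<in> carrier K"
  have "free_map K \<phi> (k \<odot>\<^bsub>free_module K S\<^esub> u) t = k \<otimes> free_map K \<phi> u t" for t
  proof -
    have "free_map K \<phi> (k \<odot>\<^bsub>free_module K S\<^esub> u) t = (\<Oplus>s \<in> {s \<in> ?U. \<phi> s = t}. k \<otimes> u s)"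
      unfolding free_map_def free_simps by (rule finsum_support) (use U k in auto)
    also have "\<dots> = k \<otimes> (\<Oplus>s \<in> {s \<in> ?U. \<phi> s = t}. u s)"
      using U k by (intro finsum_rdistr[symmetric]) auto
    finally show ?thesis by (simp add: free_map_def)
  qed
  then show "free_map K \<phi> (k \<odot>\<^bsub>free_module K S\<^esub> u) = k \<odot>\<^bsub>free_module K S'\<^esub> free_map K \<phi> u"
    by (auto simp: free_simps(3))
qed

lemma free_map_unit_vec: "free_map K \<phi> (unit_vec K s) = unit_vec K (\<phi> s)"
proof
  fix t
  have "{r. unit_vec K s r \<noteq> \<zero> \<and> \<phi> r = t} = (if \<phi> s = t then {s} else {})"
    by (auto simp: unit_vec_def)
  then show "free_map K \<phi> (unit_vec K s) t = unit_vec K (\<phi> s) t"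
    by (auto simp: free_map_def unit_vec_def)
qed

lemma
  fixes W :: "('k, 'w) module"
  assumes W: "vectorspace K W" and \<beta>: "\<And>s. s \<in> S \<Longrightarrow> \<beta> s \<in> carrier W"
  shows lin_ext_hom: "lin_ext K W \<beta> \<in> module_hom K (free_module K S) W"
    and lin_ext_unit_vec: "s \<in> S \<Longrightarrow> lin_ext K W \<beta> (unit_vec K s) = \<beta> s"
proof -
  interpret W: vectorspace K W by fact
  have supp: "lin_ext K W \<beta> v = (\<Oplus>\<^bsub>W\<^esub>s \<in> T. v s \<odot>\<^bsub>W\<^esub> \<beta> s)"
    if "finite T" "{s. v s \<noteq> \<zero>} \<subseteq> T" "T \<subseteq> S" "\<And>s. v s \<in> carrier K" for v T
    unfolding lin_ext_def
  proof (rule W.M.add.finprod_mono_neutral_cong_left)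
    show "(\<lambda>s. v s \<odot>\<^bsub>W\<^esub> \<beta> s) \<in> T \<rightarrow> carrier W" using that \<beta> by auto
    show "v s \<odot>\<^bsub>W\<^esub> \<beta> s = \<zero>\<^bsub>W\<^esub>" if "s \<in> T - {s. v s \<noteq> \<zero>}" for s
      using that \<beta>[of s] \<open>T \<subseteq> S\<close> by auto
  qed (use that in auto)
  show "lin_ext K W \<beta> \<in> module_hom K (free_module K S) W"
  proof (rule module_homI)
    fix u assume u: "u \<in> carrier (free_module K S)"
    let ?U = "{s. u s \<noteq> \<zero>}"
    have U: "finite ?U" "?U \<subseteq> S" "\<And>s. u s \<in> carrier K" using u by (auto simp: free_simps)
    show "lin_ext K W \<beta> u \<in> carrier W" unfolding lin_ext_def using U \<beta> by (intro W.M.finsum_closed) auto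
    {
      fix v assume v: "v \<in> carrier (free_module K S)"
      let ?T = "?U \<union> {s. v s \<noteq> \<zero>}"
      have V: "finite {s. v s \<noteq> \<zero>}" "{s. v s \<noteq> \<zero>} \<subseteq> S" "\<And>s. v s \<in> carrier K"
        using v by (auto simp: free_simps)
      have T: "finite ?T" "?T \<subseteq> S" using U V by auto
      have "lin_ext K W \<beta> (\<lambda>s. u s \<oplus> v s) = (\<Oplus>\<^bsub>W\<^esub>s \<in> ?T. (u s \<oplus> v s) \<odot>\<^bsub>W\<^esub> \<beta> s)"
        using T U V supp_add[of u v] by (intro supp) auto
      also have "\<dots> = (\<Oplus>\<^bsub>W\<^esub>s \<in> ?T. u s \<odot>\<^bsub>W\<^esub> \<beta> s \<oplus>\<^bsub>W\<^esub> v s \<odot>\<^bsub>W\<^esub> \<beta> s)"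
        by (rule W.M.finsum_cong') (use U V T \<beta> W.smult_l_distr in \<open>auto simp: subset_iff\<close>)
      also have "\<dots> = lin_ext K W \<beta> u \<oplus>\<^bsub>W\<^esub> lin_ext K W \<beta> v"
        using supp[of ?T u] supp[of ?T v] T U V \<beta>
        by (subst W.M.finsum_addf) (auto simp: subset_iff)
      finally show "lin_ext K W \<beta> (u \<oplus>\<^bsub>free_module K S\<^esub> v) = lin_ext K W \<beta> u \<oplus>\<^bsub>W\<^esub> lin_ext K W \<beta> v"
        by (simp add: free_simps(2))
    }
    fix k assume k: "k \<in> carrier K"
    have "lin_ext K W \<beta> (\<lambda>s. k \<otimes> u s) = (\<Oplus>\<^bsub>W\<^esub>s \<in> ?U. (k \<otimes> u s) \<odot>\<^bsub>W\<^esub> \<beta> s)"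
      using U k by (intro supp) auto
    also have "\<dots> = (\<Oplus>\<^bsub>W\<^esub>s \<in> ?U. k \<odot>\<^bsub>W\<^esub> (u s \<odot>\<^bsub>W\<^esub> \<beta> s))"
      by (rule W.M.finsum_cong') (use U k \<beta> W.smult_assoc1 in \<open>auto simp: subset_iff\<close>)
    also have "\<dots> = k \<odot>\<^bsub>W\<^esub> lin_ext K W \<beta> u"
      unfolding lin_ext_def using U k \<beta>
      by (intro W.finsum_smult_ldistr[symmetric]) (auto simp: subset_iff)
    finally show "lin_ext K W \<beta> (k \<odot>\<^bsub>free_module K S\<^esub> u) = k \<odot>\<^bsub>W\<^esub> lin_ext K W \<beta> u"
      by (simp add: free_simps(3))
  qed
  show "lin_ext K W \<beta> (unit_vec K s) = \<beta> s" if "s \<in> S"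
    using supp[of "{s}" "unit_vec K s"] that \<beta>[OF that] by (auto simp: unit_vec_def)
qed

end

lemma abelian_subgroup_of_subspace:
  assumes "subspace K N V" shows "abelian_subgroup N V"
proof -
  interpret V: vectorspace K V using assms by (simp add: subspace_def)
  note N = subspaceD[OF assms]
  have "\<ominus>\<^bsub>V\<^esub> v \<in> N" if "v \<in> N" for v
    using N(4)[of "\<ominus>\<^bsub>K\<^esub> \<one>\<^bsub>K\<^esub>" v] that N(1) V.smult_minus_1[of v] by auto
  then have "subgroup N (add_monoid V)"
    using N by (intro V.M.add.subgroupI) (auto simp: a_inv_def)
  then show ?thesis
    by (intro abelian_subgroupI3) (simp_all add: additive_subgroup_def V.M.abelian_group_axioms)
qed

context
  fixes K :: "'k ring" and V :: "('k, 'v) module" and N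
  assumes N: "subspace K N V"
begin

interpretation V: vectorspace K V using N by (simp add: subspace_def)
interpretation N: abelian_subgroup N V by (rule abelian_subgroup_of_subspace[OF N])

lemma coset_zero: "N +>\<^bsub>V\<^esub> \<zero>\<^bsub>V\<^esub> = N"
  using N.a_rcos_const[OF subspaceD(2)[OF N]] .

lemma coset_eq_iff:
  assumes "u \<in> carrier V" "v \<in> carrier V"
  shows "N +>\<^bsub>V\<^esub> u = N +>\<^bsub>V\<^esub> v \<longleftrightarrow> u \<ominus>\<^bsub>V\<^esub> v \<in> N"
proof
  assume "N +>\<^bsub>V\<^esub> u = N +>\<^bsub>V\<^esub> v"
  then have "u \<in> N +>\<^bsub>V\<^esub> v" using N.a_rcos_self[OF assms(1)] by simp
  then obtain n where "n \<in> N" "u = n \<oplus>\<^bsub>V\<^esub> v" by (auto simp: a_r_coset_def')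
  moreover from this have "n \<in> carrier V" using subspaceD(1)[OF N] by auto
  ultimately show "u \<ominus>\<^bsub>V\<^esub> v \<in> N"
    using assms by (simp add: a_minus_def V.M.a_assoc V.M.r_neg)
next
  assume d: "u \<ominus>\<^bsub>V\<^esub> v \<in> N"
  have "u = (u \<ominus>\<^bsub>V\<^esub> v) \<oplus>\<^bsub>V\<^esub> v"
    using assms by (simp add: a_minus_def V.M.a_assoc V.M.l_neg)
  then have "u \<in> N +>\<^bsub>V\<^esub> v" using d by (auto simp: a_r_coset_def')
  then show "N +>\<^bsub>V\<^esub> u = N +>\<^bsub>V\<^esub> v" using N.a_repr_independence' assms by metis
qed

lemma coset_eq_null_iff:
  assumes "v \<in> carrier V" shows "N +>\<^bsub>V\<^esub> v = N \<longleftrightarrow> v \<in> N"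
proof -
  have "v \<ominus>\<^bsub>V\<^esub> \<zero>\<^bsub>V\<^esub> = v" 
    using assms V.M.r_neg[OF V.M.zero_closed] by (simp add: a_minus_def)
  then show ?thesis using coset_eq_iff[OF assms V.M.zero_closed] coset_zero by simp
qed

text \<open>
  The maps between quotients are defined as unions over the representatives of a coset; a linear
  map that respects the subspaces takes only one value there.
\<close>

lemma induced_coset_map:
  assumes "vectorspace K V'" "subspace K N' V'" "L \<in> module_hom K V V'" "L ` N \<subseteq> N'"
    and v: "v \<in> carrier V"
  shows "(\<Union>u \<in> N +>\<^bsub>V\<^esub> v. N' +>\<^bsub>V'\<^esub> L u) = N' +>\<^bsub>V'\<^esub> L v"
proof -
  interpret V': vectorspace K V' by fact
  have "N' +>\<^bsub>V'\<^esub> L u = N' +>\<^bsub>V'\<^esub> L v" if u: "u \<in> N +>\<^bsub>V\<^esub> v" for u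
  proof -
    obtain n where n: "n \<in> N" "u = n \<oplus>\<^bsub>V\<^esub> v" using u by (auto simp: a_r_coset_def')
    have nV: "n \<in> carrier V" using n subspaceD(1)[OF N] by auto
    note L = module_homD[OF assms(3)]
    have "L u \<ominus>\<^bsub>V'\<^esub> L v = L n"
      using L(2)[OF nV v] L(1)[OF nV] L(1)[OF v] n(2)
      by (simp add: a_minus_def V'.M.a_assoc V'.M.r_neg)
    then have d: "L u \<ominus>\<^bsub>V'\<^esub> L v \<in> N'" using n assms(4) by auto
    interpret N': abelian_subgroup N' V' by (rule abelian_subgroup_of_subspace[OF assms(2)])
    have Lu: "L u \<in> carrier V'" "L v \<in> carrier V'" using n nV v L(1) by auto
    have "L u = (L u \<ominus>\<^bsub>V'\<^esub> L v) \<oplus>\<^bsub>V'\<^esub> L v"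
      using Lu by (simp add: a_minus_def V'.M.a_assoc V'.M.l_neg)
    then have "L u \<in> N' +>\<^bsub>V'\<^esub> L v" using d by (auto simp: a_r_coset_def')
    then show ?thesis using N'.a_repr_independence' Lu by metis
  qed
  then show ?thesis using N.a_rcos_self[OF v] by blast
qed

lemma quot_simps:
  "carrier (quot_module V N) = (\<lambda>v. N +>\<^bsub>V\<^esub> v) ` carrier V"
  "\<zero>\<^bsub>quot_module V N\<^esub> = N"
  "\<lbrakk>u \<in> carrier V; v \<in> carrier V\<rbrakk> \<Longrightarrow>
     (N +>\<^bsub>V\<^esub> u) \<oplus>\<^bsub>quot_module V N\<^esub> (N +>\<^bsub>V\<^esub> v) = N +>\<^bsub>V\<^esub> (u \<oplus>\<^bsub>V\<^esub> v)"
  "\<lbrakk>k \<in> carrier K; v \<in> carrier V\<rbrakk> \<Longrightarrow>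
     k \<odot>\<^bsub>quot_module V N\<^esub> (N +>\<^bsub>V\<^esub> v) = N +>\<^bsub>V\<^esub> (k \<odot>\<^bsub>V\<^esub> v)"
proof -
  show "carrier (quot_module V N) = (\<lambda>v. N +>\<^bsub>V\<^esub> v) ` carrier V"
    by (auto simp: quot_module_def A_RCOSETS_def')
  show "\<zero>\<^bsub>quot_module V N\<^esub> = N" by (simp add: quot_module_def)
  show "(N +>\<^bsub>V\<^esub> u) \<oplus>\<^bsub>quot_module V N\<^esub> (N +>\<^bsub>V\<^esub> v) = N +>\<^bsub>V\<^esub> (u \<oplus>\<^bsub>V\<^esub> v)"
    if "u \<in> carrier V" "v \<in> carrier V"
    using N.a_rcos_sum[OF that] by (simp add: quot_module_def)
  show "k \<odot>\<^bsub>quot_module V N\<^esub> (N +>\<^bsub>V\<^esub> v) = N +>\<^bsub>V\<^esub> (k \<odot>\<^bsub>V\<^esub> v)"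
    if k: "k \<in> carrier K" and v: "v \<in> carrier V"
  proof -
    have "(\<lambda>v. k \<odot>\<^bsub>V\<^esub> v) \<in> module_hom K V V"
    proof (rule module_homI)
      fix l x assume l: "l \<in> carrier K" and x: "x \<in> carrier V"
      then show "k \<odot>\<^bsub>V\<^esub> (l \<odot>\<^bsub>V\<^esub> x) = l \<odot>\<^bsub>V\<^esub> (k \<odot>\<^bsub>V\<^esub> x)"
        using k V.smult_assoc1 V.R.m_comm by metis
    qed (use k V.smult_r_distr in auto)
    from induced_coset_map[OF V.vectorspace_axioms N this _ v]
    show ?thesis using subspaceD(4)[OF N k] by (auto simp: quot_module_def)
  qed
qed

lemma vectorspace_quot: "vectorspace K (quot_module V N)"
  and quot_hom: "(\<lambda>v. N +>\<^bsub>V\<^esub> v) \<in> module_hom K V (quot_module V N)"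
proof -
  show "vectorspace K (quot_module V N)"
    by (rule vectorspace_surjective_image(1)[OF V.vectorspace_axioms, of "\<lambda>v. N +>\<^bsub>V\<^esub> v"])
      (simp_all add: quot_simps coset_zero)
  show "(\<lambda>v. N +>\<^bsub>V\<^esub> v) \<in> module_hom K V (quot_module V N)"
    by (rule module_homI) (simp_all add: quot_simps)
qed

end

section \<open>The coend of two bilinear bifunctors\<close>

lemma module_hom_comp:
  assumes "f \<in> module_hom K L M" "g \<in> module_hom K M N"
  shows "(\<lambda>x. g (f x)) \<in> module_hom K L N"
  using module_homD[OF assms(1)] module_homD[OF assms(2)] by (intro module_homI) simp_all

text \<open>
  A family \<open>\<beta>\<close> is balanced if it is bilinear and dinatural in \<open>M\<close>. These are the families that factor
  through the coend of \<open>F(M, Y) \<otimes> G(X, M)\<close>.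
\<close>

definition balanced :: "'k ring \<Rightarrow> ('k, 'o, 'm, 'z) lincat_scheme \<Rightarrow> ('k, 'o, 'm, 'x) bifunctor
    \<Rightarrow> ('k, 'o, 'm, 'y) bifunctor \<Rightarrow> 'o \<Rightarrow> 'o \<Rightarrow> ('k, 'w) module \<Rightarrow> ('o \<Rightarrow> 'x \<Rightarrow> 'y \<Rightarrow> 'w) \<Rightarrow> bool" where
  "balanced K \<C> F G X Y W \<beta> \<longleftrightarrow>
     (\<forall>M. \<forall>x \<in> carrier (Val F M Y). \<forall>h \<in> carrier (Val G X M). \<beta> M x h \<in> carrier W) \<and>
     (\<forall>M. \<forall>x \<in> carrier (Val F M Y). \<forall>x' \<in> carrier (Val F M Y). \<forall>h \<in> carrier (Val G X M).
        \<beta> M (x \<oplus>\<^bsub>Val F M Y\<^esub> x') h = \<beta> M x h \<oplus>\<^bsub>W\<^esub> \<beta> M x' h) \<and>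
     (\<forall>M. \<forall>x \<in> carrier (Val F M Y). \<forall>h \<in> carrier (Val G X M). \<forall>h' \<in> carrier (Val G X M).
        \<beta> M x (h \<oplus>\<^bsub>Val G X M\<^esub> h') = \<beta> M x h \<oplus>\<^bsub>W\<^esub> \<beta> M x h') \<and>
     (\<forall>M. \<forall>k \<in> carrier K. \<forall>x \<in> carrier (Val F M Y). \<forall>h \<in> carrier (Val G X M).
        \<beta> M (k \<odot>\<^bsub>Val F M Y\<^esub> x) h = k \<odot>\<^bsub>W\<^esub> \<beta> M x h) \<and>
     (\<forall>M. \<forall>k \<in> carrier K. \<forall>x \<in> carrier (Val F M Y). \<forall>h \<in> carrier (Val G X M).
        \<beta> M x (k \<odot>\<^bsub>Val G X M\<^esub> h) = k \<odot>\<^bsub>W\<^esub> \<beta> M x h) \<and>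
     (\<forall>M M'. \<forall>f \<in> Arr \<C> M M'. \<forall>x \<in> carrier (Val F M' Y). \<forall>h \<in> carrier (Val G X M).
        \<beta> M (Pull F M M' Y f x) h = \<beta> M' x (Push G X M M' f h))"

lemma balancedI:
  assumes "\<And>M x h. \<lbrakk>x \<in> carrier (Val F M Y); h \<in> carrier (Val G X M)\<rbrakk> \<Longrightarrow> \<beta> M x h \<in> carrier W"
    and "\<And>M x x' h. \<lbrakk>x \<in> carrier (Val F M Y); x' \<in> carrier (Val F M Y); h \<in> carrier (Val G X M)\<rbrakk>
      \<Longrightarrow> \<beta> M (x \<oplus>\<^bsub>Val F M Y\<^esub> x') h = \<beta> M x h \<oplus>\<^bsub>W\<^esub> \<beta> M x' h"
    and "\<And>M x h h'. \<lbrakk>x \<in> carrier (Val F M Y); h \<in> carrier (Val G X M); h' \<in> carrier (Val G X M)\<rbrakk>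
      \<Longrightarrow> \<beta> M x (h \<oplus>\<^bsub>Val G X M\<^esub> h') = \<beta> M x h \<oplus>\<^bsub>W\<^esub> \<beta> M x h'"
    and "\<And>M k x h. \<lbrakk>k \<in> carrier K; x \<in> carrier (Val F M Y); h \<in> carrier (Val G X M)\<rbrakk>
      \<Longrightarrow> \<beta> M (k \<odot>\<^bsub>Val F M Y\<^esub> x) h = k \<odot>\<^bsub>W\<^esub> \<beta> M x h"
    and "\<And>M k x h. \<lbrakk>k \<in> carrier K; x \<in> carrier (Val F M Y); h \<in> carrier (Val G X M)\<rbrakk>
      \<Longrightarrow> \<beta> M x (k \<odot>\<^bsub>Val G X M\<^esub> h) = k \<odot>\<^bsub>W\<^esub> \<beta> M x h"
    and "\<And>M M' f x h. \<lbrakk>f \<in> Arr \<C> M M'; x \<in> carrier (Val F M' Y); h \<in> carrier (Val G X M)\<rbrakk>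
      \<Longrightarrow> \<beta> M (Pull F M M' Y f x) h = \<beta> M' x (Push G X M M' f h)"
  shows "balanced K \<C> F G X Y W \<beta>"
  unfolding balanced_def by (intro conjI allI ballI) (rule assms; assumption)+

lemma balancedD:
  assumes "balanced K \<C> F G X Y W \<beta>"
  shows "\<lbrakk>x \<in> carrier (Val F M Y); h \<in> carrier (Val G X M)\<rbrakk> \<Longrightarrow> \<beta> M x h \<in> carrier W"
    and "\<lbrakk>x \<in> carrier (Val F M Y); x' \<in> carrier (Val F M Y); h \<in> carrier (Val G X M)\<rbrakk>
      \<Longrightarrow> \<beta> M (x \<oplus>\<^bsub>Val F M Y\<^esub> x') h = \<beta> M x h \<oplus>\<^bsub>W\<^esub> \<beta> M x' h"
    and "\<lbrakk>x \<in> carrier (Val F M Y); h \<in> carrier (Val G X M); h' \<in> carrier (Val G X M)\<rbrakk>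
      \<Longrightarrow> \<beta> M x (h \<oplus>\<^bsub>Val G X M\<^esub> h') = \<beta> M x h \<oplus>\<^bsub>W\<^esub> \<beta> M x h'"
    and "\<lbrakk>k \<in> carrier K; x \<in> carrier (Val F M Y); h \<in> carrier (Val G X M)\<rbrakk>
      \<Longrightarrow> \<beta> M (k \<odot>\<^bsub>Val F M Y\<^esub> x) h = k \<odot>\<^bsub>W\<^esub> \<beta> M x h"
    and "\<lbrakk>k \<in> carrier K; x \<in> carrier (Val F M Y); h \<in> carrier (Val G X M)\<rbrakk>
      \<Longrightarrow> \<beta> M x (k \<odot>\<^bsub>Val G X M\<^esub> h) = k \<odot>\<^bsub>W\<^esub> \<beta> M x h"
    and "\<lbrakk>f \<in> Arr \<C> M M'; x \<in> carrier (Val F M' Y); h \<in> carrier (Val G X M)\<rbrakk>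
      \<Longrightarrow> \<beta> M (Pull F M M' Y f x) h = \<beta> M' x (Push G X M M' f h)"
  using assms by (simp_all add: balanced_def)

locale bifunctor_pair = F: bilinear_bifunctor K \<C> F + G: bilinear_bifunctor K \<C> G
  for K :: "'k ring" and \<C> :: "('k, 'o, 'm, 'z) lincat_scheme" (structure)
    and F :: "('k, 'o, 'm, 'x) bifunctor" and G :: "('k, 'o, 'm, 'y) bifunctor"
begin

abbreviation "Fr X Y \<equiv> coend_free K F G X Y"
abbreviation "Nl X Y \<equiv> coend_null K \<C> F G X Y"
abbreviation "Cd X Y \<equiv> quot_module (Fr X Y) (Nl X Y)"
abbreviation "\<epsilon> \<equiv> unit_vec K"
abbreviation "cls X Y M x h \<equiv> Nl X Y +>\<^bsub>Fr X Y\<^esub> \<epsilon> (M, x, h)"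

lemma vectorspace_Fr: "vectorspace K (Fr X Y)"
  by (rule vectorspace_free[OF F.field_K])

sublocale Fr: vectorspace K "Fr X Y" for X Y by (rule vectorspace_Fr)

lemma gen_closed [simp]:
  "\<lbrakk>x \<in> carrier (Val F M Y); h \<in> carrier (Val G X M)\<rbrakk> \<Longrightarrow> \<epsilon> (M, x, h) \<in> carrier (Fr X Y)"
  by (rule unit_vec_closed[OF F.field_K]) (simp add: coend_gens_def)

lemma coend_rels_closed: "coend_rels K \<C> F G X Y \<subseteq> carrier (Fr X Y)"
  unfolding coend_rels_def Let_def
  by (auto intro!: Fr.M.minus_closed Fr.M.a_closed Fr.smult_closed gen_closed
      F.Val.M.a_closed G.Val.M.a_closed F.Pull_closed G.Push_closed)

lemma subspace_Nl: "subspace K (Nl X Y) (Fr X Y)"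
  unfolding coend_null_def by (rule Fr.span_is_subspace[OF coend_rels_closed])

lemma rel_in_Nl: "r \<in> coend_rels K \<C> F G X Y \<Longrightarrow> r \<in> Nl X Y"
  unfolding coend_null_def using Fr.in_own_span[OF coend_rels_closed] by blast

lemmas coset_eq = coset_eq_iff[OF subspace_Nl]
lemmas Cd_simps = quot_simps[OF subspace_Nl]

lemma vectorspace_Cd: "vectorspace K (Cd X Y)"
  by (rule vectorspace_quot[OF subspace_Nl])

sublocale Cd: vectorspace K "Cd X Y" for X Y by (rule vectorspace_Cd)

lemma cls_closed:
  "\<lbrakk>x \<in> carrier (Val F M Y); h \<in> carrier (Val G X M)\<rbrakk> \<Longrightarrow> cls X Y M x h \<in> carrier (Cd X Y)"
  by (simp add: Cd_simps)

lemma coset_rel: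
  "\<lbrakk>u \<in> carrier (Fr X Y); v \<in> carrier (Fr X Y); u \<ominus>\<^bsub>Fr X Y\<^esub> v \<in> coend_rels K \<C> F G X Y\<rbrakk>
    \<Longrightarrow> Nl X Y +>\<^bsub>Fr X Y\<^esub> u = Nl X Y +>\<^bsub>Fr X Y\<^esub> v"
  by (simp add: coset_eq rel_in_Nl)

lemma cls_balanced: "balanced K \<C> F G X Y (Cd X Y) (cls X Y)"
proof (rule balancedI)
  let ?R = "coend_rels K \<C> F G X Y"
  fix M x x' h
  assume a: "x \<in> carrier (Val F M Y)" "x' \<in> carrier (Val F M Y)" "h \<in> carrier (Val G X M)"
  have "\<epsilon> (M, x \<oplus>\<^bsub>Val F M Y\<^esub> x', h) \<ominus>\<^bsub>Fr X Y\<^esub> (\<epsilon> (M, x, h) \<oplus>\<^bsub>Fr X Y\<^esub> \<epsilon> (M, x', h)) \<in> ?R"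
    unfolding coend_rels_def Let_def
    by (rule UnI1, rule UnI1, rule UnI1, rule UnI1, rule CollectI, intro exI conjI, rule refl) (rule a)+
  then show "cls X Y M (x \<oplus>\<^bsub>Val F M Y\<^esub> x') h = cls X Y M x h \<oplus>\<^bsub>Cd X Y\<^esub> cls X Y M x' h"
    using a by (simp add: Cd_simps(3) coset_rel)
next
  let ?R = "coend_rels K \<C> F G X Y"
  fix M x h h'
  assume a: "x \<in> carrier (Val F M Y)" "h \<in> carrier (Val G X M)" "h' \<in> carrier (Val G X M)"
  have "\<epsilon> (M, x, h \<oplus>\<^bsub>Val G X M\<^esub> h') \<ominus>\<^bsub>Fr X Y\<^esub> (\<epsilon> (M, x, h) \<oplus>\<^bsub>Fr X Y\<^esub> \<epsilon> (M, x, h')) \<in> ?R"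
    unfolding coend_rels_def Let_def
    by (rule UnI1, rule UnI1, rule UnI1, rule UnI2, rule CollectI, intro exI conjI, rule refl) (rule a)+
  then show "cls X Y M x (h \<oplus>\<^bsub>Val G X M\<^esub> h') = cls X Y M x h \<oplus>\<^bsub>Cd X Y\<^esub> cls X Y M x h'"
    using a by (simp add: Cd_simps(3) coset_rel)
next
  let ?R = "coend_rels K \<C> F G X Y"
  fix M k x h
  assume a: "k \<in> carrier K" "x \<in> carrier (Val F M Y)" "h \<in> carrier (Val G X M)"
  have "\<epsilon> (M, k \<odot>\<^bsub>Val F M Y\<^esub> x, h) \<ominus>\<^bsub>Fr X Y\<^esub> (k \<odot>\<^bsub>Fr X Y\<^esub> \<epsilon> (M, x, h)) \<in> ?R"
    unfolding coend_rels_def Let_def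
    by (rule UnI1, rule UnI1, rule UnI2, rule CollectI, intro exI conjI, rule refl) (rule a)+
  then show "cls X Y M (k \<odot>\<^bsub>Val F M Y\<^esub> x) h = k \<odot>\<^bsub>Cd X Y\<^esub> cls X Y M x h"
    using a by (simp add: Cd_simps(4) coset_rel)
  have "\<epsilon> (M, x, k \<odot>\<^bsub>Val G X M\<^esub> h) \<ominus>\<^bsub>Fr X Y\<^esub> (k \<odot>\<^bsub>Fr X Y\<^esub> \<epsilon> (M, x, h)) \<in> ?R"
    unfolding coend_rels_def Let_def
    by (rule UnI1, rule UnI2, rule CollectI, intro exI conjI, rule refl) (rule a)+
  then show "cls X Y M x (k \<odot>\<^bsub>Val G X M\<^esub> h) = k \<odot>\<^bsub>Cd X Y\<^esub> cls X Y M x h"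
    using a by (simp add: Cd_simps(4) coset_rel)
next
  let ?R = "coend_rels K \<C> F G X Y"
  fix M M' f x h
  assume a: "f \<in> Arr \<C> M M'" "x \<in> carrier (Val F M' Y)" "h \<in> carrier (Val G X M)"
  have "\<epsilon> (M, Pull F M M' Y f x, h) \<ominus>\<^bsub>Fr X Y\<^esub> \<epsilon> (M', x, Push G X M M' f h) \<in> ?R"
    unfolding coend_rels_def Let_def
    by (rule UnI2, rule CollectI, intro exI conjI, rule refl) (rule a)+
  then show "cls X Y M (Pull F M M' Y f x) h = cls X Y M' x (Push G X M M' f h)"
    using a F.Pull_closed G.Push_closed by (simp add: coset_rel)
qed (rule cls_closed)

lemma coend_induct [consumes 1, case_names zero cls add]:
  assumes t: "t \<in> carrier (Cd X Y)"
    and zero: "P \<zero>\<^bsub>Cd X Y\<^esub>"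
    and cls: "\<And>M x h. \<lbrakk>x \<in> carrier (Val F M Y); h \<in> carrier (Val G X M)\<rbrakk> \<Longrightarrow> P (cls X Y M x h)"
    and add: "\<And>s t. \<lbrakk>s \<in> carrier (Cd X Y); t \<in> carrier (Cd X Y); P s; P t\<rbrakk> \<Longrightarrow> P (s \<oplus>\<^bsub>Cd X Y\<^esub> t)"
  shows "P t"
proof -
  obtain v where v: "v \<in> carrier (Fr X Y)" "t = Nl X Y +>\<^bsub>Fr X Y\<^esub> v"
    using t by (auto simp: Cd_simps)
  have "P (Nl X Y +>\<^bsub>Fr X Y\<^esub> v)"
    using v(1)
  proof (induction v rule: free_module_induct[OF F.field_K, consumes 1, case_names zero add])
    case zero
    then show ?case using assms(2) coset_zero[OF subspace_Nl] by (simp add: Cd_simps)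
  next
    case (add s k v)
    obtain M x h where s: "s = (M, x, h)" "x \<in> carrier (Val F M Y)" "h \<in> carrier (Val G X M)"
      using add(1) by (auto simp: coend_gens_def)
    have kx: "k \<odot>\<^bsub>Val F M Y\<^esub> x \<in> carrier (Val F M Y)" using add(2) s by simp
    have "Nl X Y +>\<^bsub>Fr X Y\<^esub> (k \<odot>\<^bsub>Fr X Y\<^esub> \<epsilon> s \<oplus>\<^bsub>Fr X Y\<^esub> v)
        = cls X Y M (k \<odot>\<^bsub>Val F M Y\<^esub> x) h \<oplus>\<^bsub>Cd X Y\<^esub> (Nl X Y +>\<^bsub>Fr X Y\<^esub> v)"
      using add(2,3) s balancedD(4)[OF cls_balanced add(2) s(2,3)] by (simp add: Cd_simps)
    moreover have "Nl X Y +>\<^bsub>Fr X Y\<^esub> v \<in> carrier (Cd X Y)" using add(3) by (simp add: Cd_simps)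
    ultimately show ?case using assms(4)[OF cls_closed[OF kx s(3)] _ cls[OF kx s(3)] add(4)] by simp
  qed
  then show ?thesis using v(2) by simp
qed

text \<open>
  Half of the universal property of the coend: the kernel of a linear map is a subspace, and
  balancedness says that it contains the defining relations.
\<close>

lemma kills_null:
  assumes W: "vectorspace K W" and T: "T \<in> module_hom K (Fr X Y) W"
    and bal: "balanced K \<C> F G X Y W (\<lambda>M x h. T (\<epsilon> (M, x, h)))"
    and v: "v \<in> Nl X Y"
  shows "T v = \<zero>\<^bsub>W\<^esub>"
proof -
  interpret W: vectorspace K W by fact
  let ?ker = "{v \<in> carrier (Fr X Y). T v = \<zero>\<^bsub>W\<^esub>}"
  have "subspace K (carrier (Fr X Y)) (Fr X Y)"
    by (rule subspaceI[OF vectorspace_Fr]) auto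
  then have "subspace K ?ker (Fr X Y)"
    by (rule linear_kernel_subspace[OF vectorspace_Fr W T])
  then have ker: "LinearCombinations.submodule K ?ker (Fr X Y)" by (simp add: subspace_def)
  note Td = module_hom_diff[OF Fr.module_axioms W.module_axioms T]
  note Ta = module_homD[OF T]
  note B = balancedD[OF bal]
  have "coend_rels K \<C> F G X Y \<subseteq> ?ker"
  proof
    fix r assume r: "r \<in> coend_rels K \<C> F G X Y"
    have "T r = \<zero>\<^bsub>W\<^esub>"
      using r unfolding coend_rels_def Let_def Un_iff mem_Collect_eq
    proof (elim disjE exE conjE, goal_cases)
      case (1 M x x' h)
      then show ?case using B(2)[of x M x' h] B(1)[of x M h] B(1)[of x' M h]
        by (simp add: Td Ta F.Val.M.a_closed)
    next
      case (2 M x h h')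
      then show ?case using B(3)[of x M h h'] B(1)[of x M h] B(1)[of x M h']
        by (simp add: Td Ta G.Val.M.a_closed)
    next
      case (3 M k x h)
      then show ?case using B(4)[of k x M h] B(1)[of x M h]
        by (simp add: Td Ta F.Val.smult_closed)
    next
      case (4 M k x h)
      then show ?case using B(5)[of k x M h] B(1)[of x M h]
        by (simp add: Td Ta G.Val.smult_closed)
    next
      case (5 M M' f x h)
      then show ?case using B(6)[of f M M' x h] B(1)[of x M' "Push G X M M' f h"]
        by (simp add: Td Ta F.Pull_closed G.Push_closed)
    qed
    then show "r \<in> ?ker" using r coend_rels_closed by auto
  qed
  then show ?thesis using Fr.span_is_subset[OF _ ker] v by (auto simp: coend_null_def)
qed

text \<open>
  The other half, in the only form in which it is needed: balanced families detect that an
  elementary tensor is not zero.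
\<close>

lemma zero_test:
  assumes W: "vectorspace K W" and bal: "balanced K \<C> F G X Y W \<beta>"
    and xh: "x \<in> carrier (Val F M Y)" "h \<in> carrier (Val G X M)"
    and zero: "cls X Y M x h = \<zero>\<^bsub>Cd X Y\<^esub>"
  shows "\<beta> M x h = \<zero>\<^bsub>W\<^esub>"
proof -
  define \<beta>' where "\<beta>' = (\<lambda>(M, x, h). \<beta> M x h)"
  have \<beta>': "\<beta>' s \<in> carrier W" if "s \<in> coend_gens F G X Y" for s
    using that balancedD(1)[OF bal] by (auto simp: coend_gens_def \<beta>'_def)
  have L: "lin_ext K W \<beta>' \<in> module_hom K (Fr X Y) W" by (rule lin_ext_hom[OF F.field_K W \<beta>'])
  have u: "lin_ext K W \<beta>' (\<epsilon> (M, x, h)) = \<beta> M x h"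
    if "x \<in> carrier (Val F M Y)" "h \<in> carrier (Val G X M)" for M x h
  proof -
    have "(M, x, h) \<in> coend_gens F G X Y" using that by (simp add: coend_gens_def)
    from lin_ext_unit_vec[where \<beta> = \<beta>' and S = "coend_gens F G X Y", OF F.field_K W \<beta>' this]
    show ?thesis by (simp add: \<beta>'_def)
  qed
  have "balanced K \<C> F G X Y W (\<lambda>M x h. lin_ext K W \<beta>' (\<epsilon> (M, x, h)))"
    by (rule balancedI)
      (simp_all add: u balancedD[OF bal] F.Pull_closed G.Push_closed)
  moreover have "\<epsilon> (M, x, h) \<in> Nl X Y"
    using zero coset_eq_null_iff[OF subspace_Nl gen_closed[OF xh]] by (simp add: Cd_simps)
  ultimately show ?thesis using kills_null[OF W L] u[OF xh] by metis
qed

text \<open>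
  Both functorial actions on the coend relabel the generators. Such a relabelling descends to the
  quotient as soon as the resulting elementary tensors are balanced.
\<close>

lemma
  assumes \<phi>: "\<And>M x h. \<phi> (M, x, h) = (M, \<alpha> M x, \<gamma> M h)"
    and closed: "\<And>M x h. \<lbrakk>x \<in> carrier (Val F M Y); h \<in> carrier (Val G X M)\<rbrakk>
      \<Longrightarrow> \<alpha> M x \<in> carrier (Val F M Y') \<and> \<gamma> M h \<in> carrier (Val G X' M)"
    and bal: "balanced K \<C> F G X Y (Cd X' Y') (\<lambda>M x h. cls X' Y' M (\<alpha> M x) (\<gamma> M h))"
  defines "D \<equiv> \<lambda>t. \<Union>v\<in>t. Nl X' Y' +>\<^bsub>Fr X' Y'\<^esub> free_map K \<phi> v"
  shows coend_map_hom: "D \<in> module_hom K (Cd X Y) (Cd X' Y')"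
    and coend_map_cls: "\<lbrakk>x \<in> carrier (Val F M Y); h \<in> carrier (Val G X M)\<rbrakk>
      \<Longrightarrow> D (cls X Y M x h) = cls X' Y' M (\<alpha> M x) (\<gamma> M h)"
proof -
  have gens: "\<phi> ` coend_gens F G X Y \<subseteq> coend_gens F G X' Y'"
    using \<phi> closed by (auto simp: coend_gens_def)
  have L: "free_map K \<phi> \<in> module_hom K (Fr X Y) (Fr X' Y')"
    by (rule free_map_hom[OF F.field_K gens])
  note T = module_hom_comp[OF L quot_hom[OF subspace_Nl]]
  have "free_map K \<phi> v \<in> Nl X' Y'" if v: "v \<in> Nl X Y" for v
  proof -
    have "balanced K \<C> F G X Y (Cd X' Y')
        (\<lambda>M x h. Nl X' Y' +>\<^bsub>Fr X' Y'\<^esub> free_map K \<phi> (\<epsilon> (M, x, h)))"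
      using bal by (simp add: free_map_unit_vec[OF F.field_K] \<phi>)
    from kills_null[OF vectorspace_Cd T this v]
    have "Nl X' Y' +>\<^bsub>Fr X' Y'\<^esub> free_map K \<phi> v = Nl X' Y'" by (simp add: Cd_simps)
    then show ?thesis
      using coset_eq_null_iff[OF subspace_Nl module_homD(1)[OF L]] v subspaceD(1)[OF subspace_Nl]
      by blast
  qed
  then have sub: "free_map K \<phi> ` Nl X Y \<subseteq> Nl X' Y'" by blast
  have D: "D (Nl X Y +>\<^bsub>Fr X Y\<^esub> v) = Nl X' Y' +>\<^bsub>Fr X' Y'\<^esub> free_map K \<phi> v"
    if "v \<in> carrier (Fr X Y)" for v
    unfolding D_def by (rule induced_coset_map[OF subspace_Nl vectorspace_Fr subspace_Nl L sub that])
  show "D \<in> module_hom K (Cd X Y) (Cd X' Y')"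
  proof (rule module_homI)
    fix s assume "s \<in> carrier (Cd X Y)"
    then obtain u where u: "u \<in> carrier (Fr X Y)" "s = Nl X Y +>\<^bsub>Fr X Y\<^esub> u" by (auto simp: Cd_simps)
    show "D s \<in> carrier (Cd X' Y')" using D u module_homD(1)[OF T] by simp
    show "D (k \<odot>\<^bsub>Cd X Y\<^esub> s) = k \<odot>\<^bsub>Cd X' Y'\<^esub> D s" if "k \<in> carrier K" for k
      using D u module_homD(3)[OF T] that Cd_simps(4) by simp
    fix t assume "t \<in> carrier (Cd X Y)"
    then obtain v where v: "v \<in> carrier (Fr X Y)" "t = Nl X Y +>\<^bsub>Fr X Y\<^esub> v" by (auto simp: Cd_simps)
    show "D (s \<oplus>\<^bsub>Cd X Y\<^esub> t) = D s \<oplus>\<^bsub>Cd X' Y'\<^esub> D t"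
      using D u v module_homD(2)[OF T] Cd_simps(3) by simp
  qed
  show "D (cls X Y M x h) = cls X' Y' M (\<alpha> M x) (\<gamma> M h)"
    if "x \<in> carrier (Val F M Y)" "h \<in> carrier (Val G X M)"
    using D[OF gen_closed[OF that]] by (simp add: free_map_unit_vec[OF F.field_K] \<phi>)
qed

abbreviation "B \<equiv> coend_bifunctor K \<C> F G"

lemma Val_coend: "Val B X Y = Cd X Y"
  by (simp add: coend_bifunctor_def)

lemma
  assumes c: "c \<in> Arr \<C> X X'"
  shows coend_Pull_hom: "Pull B X X' Y c \<in> module_hom K (Cd X' Y) (Cd X Y)"
    and coend_Pull_cls: "\<lbrakk>x \<in> carrier (Val F M Y); h \<in> carrier (Val G X' M)\<rbrakk>
      \<Longrightarrow> Pull B X X' Y c (cls X' Y M x h) = cls X Y M x (Pull G X X' M c h)"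
proof -
  let ?\<phi> = "\<lambda>(M, x, h). (M, x, Pull G X X' M c h)"
  note cb = balancedD[OF cls_balanced]
  have closed: "x \<in> carrier (Val F M Y) \<and> Pull G X X' M c h \<in> carrier (Val G X M)"
    if "x \<in> carrier (Val F M Y)" "h \<in> carrier (Val G X' M)" for M x h
    using that G.Pull_closed[OF c] by simp
  have bal: "balanced K \<C> F G X' Y (Cd X Y) (\<lambda>M x h. cls X Y M x (Pull G X X' M c h))"
  proof (rule balancedI)
    fix M M' f x h
    assume a: "f \<in> Arr \<C> M M'" "x \<in> carrier (Val F M' Y)" "h \<in> carrier (Val G X' M)"
    then show "cls X Y M (Pull F M M' Y f x) (Pull G X X' M c h)
        = cls X Y M' x (Pull G X X' M' c (Push G X' M M' f h))"
      using cb(6)[OF a(1,2) G.Pull_closed[OF c a(3)]] G.Push_Pull[OF c a(1,3)] by simp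
  qed (simp_all add: cb(2-5) cls_closed G.Pull_closed[OF c] module_homD[OF G.Pull_hom[OF c]])
  have eq: "Pull B X X' Y c = (\<lambda>t. \<Union>v\<in>t. Nl X Y +>\<^bsub>Fr X Y\<^esub> free_map K ?\<phi> v)"
    by (simp add: coend_bifunctor_def)
  show "Pull B X X' Y c \<in> module_hom K (Cd X' Y) (Cd X Y)"
    unfolding eq by (rule coend_map_hom[OF _ closed bal]) simp_all
  show "Pull B X X' Y c (cls X' Y M x h) = cls X Y M x (Pull G X X' M c h)"
    if "x \<in> carrier (Val F M Y)" "h \<in> carrier (Val G X' M)"
    unfolding eq by (rule coend_map_cls[OF _ closed bal]) (simp_all add: that)
qed

lemma
  assumes a: "a \<in> Arr \<C> Y Y'"
  shows coend_Push_hom: "Push B X Y Y' a \<in> module_hom K (Cd X Y) (Cd X Y')"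
    and coend_Push_cls: "\<lbrakk>x \<in> carrier (Val F M Y); h \<in> carrier (Val G X M)\<rbrakk>
      \<Longrightarrow> Push B X Y Y' a (cls X Y M x h) = cls X Y' M (Push F M Y Y' a x) h"
proof -
  let ?\<phi> = "\<lambda>(M, x, h). (M, Push F M Y Y' a x, h)"
  note cb = balancedD[OF cls_balanced]
  have closed: "Push F M Y Y' a x \<in> carrier (Val F M Y') \<and> h \<in> carrier (Val G X M)"
    if "x \<in> carrier (Val F M Y)" "h \<in> carrier (Val G X M)" for M x h
    using that F.Push_closed[OF a] by simp
  have bal: "balanced K \<C> F G X Y (Cd X Y') (\<lambda>M x h. cls X Y' M (Push F M Y Y' a x) h)"
  proof (rule balancedI)
    fix M M' f x h
    assume b: "f \<in> Arr \<C> M M'" "x \<in> carrier (Val F M' Y)" "h \<in> carrier (Val G X M)"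
    then show "cls X Y' M (Push F M Y Y' a (Pull F M M' Y f x)) h
        = cls X Y' M' (Push F M' Y Y' a x) (Push G X M M' f h)"
      using cb(6)[OF b(1) F.Push_closed[OF a b(2)] b(3)] F.Push_Pull[OF b(1) a b(2)] by simp
  qed (simp_all add: cb(2-5) cls_closed F.Push_closed[OF a] module_homD[OF F.Push_hom[OF a]])
  have eq: "Push B X Y Y' a = (\<lambda>t. \<Union>v\<in>t. Nl X Y' +>\<^bsub>Fr X Y'\<^esub> free_map K ?\<phi> v)"
    by (simp add: coend_bifunctor_def)
  show "Push B X Y Y' a \<in> module_hom K (Cd X Y) (Cd X Y')"
    unfolding eq by (rule coend_map_hom[OF _ closed bal]) simp_all
  show "Push B X Y Y' a (cls X Y M x h) = cls X Y' M (Push F M Y Y' a x) h"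
    if "x \<in> carrier (Val F M Y)" "h \<in> carrier (Val G X M)"
    unfolding eq by (rule coend_map_cls[OF _ closed bal]) (simp_all add: that)
qed

lemma coend_hom_eqI:
  assumes "vectorspace K W" "f \<in> module_hom K (Cd X Y) W" "g \<in> module_hom K (Cd X Y) W"
    and "\<And>M x h. \<lbrakk>x \<in> carrier (Val F M Y); h \<in> carrier (Val G X M)\<rbrakk>
      \<Longrightarrow> f (cls X Y M x h) = g (cls X Y M x h)"
    and "t \<in> carrier (Cd X Y)"
  shows "f t = g t"
  using assms(5)
proof (induction t rule: coend_induct)
  case zero
  interpret W: vectorspace K W by fact
  show ?case
    using module_hom_zero[OF Cd.module_axioms W.module_axioms assms(2)]
      module_hom_zero[OF Cd.module_axioms W.module_axioms assms(3)] by simp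
qed (simp_all add: assms(4) module_homD(2)[OF assms(2)] module_homD(2)[OF assms(3)])

text \<open>
  Linearity of \<open>c \<mapsto> c\<^sup>* t\<close> and \<open>a \<mapsto> a\<^sub>* t\<close> passes from elementary tensors to sums of them.
\<close>

lemma coend_linear_family:
  assumes A: "module K A" and W: "vectorspace K W"
    and D: "\<And>c. c \<in> carrier A \<Longrightarrow> D c \<in> module_hom K (Cd X Y) W"
    and lin: "\<And>M x h. \<lbrakk>x \<in> carrier (Val F M Y); h \<in> carrier (Val G X M)\<rbrakk>
      \<Longrightarrow> (\<lambda>c. D c (cls X Y M x h)) \<in> module_hom K A W"
    and t: "t \<in> carrier (Cd X Y)"
  shows "(\<lambda>c. D c t) \<in> module_hom K A W"
  using t
proof (induction t rule: coend_induct)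
  case zero
  interpret W: vectorspace K W by fact
  interpret A: module K A by fact
  show ?case
    using module_hom_zero[OF Cd.module_axioms W.module_axioms D]
    by (intro module_homI) simp_all
next
  case (cls M x h)
  then show ?case by (rule lin)
next
  case (add s t)
  interpret W: vectorspace K W by fact
  interpret A: module K A by fact
  note s = module_homD[OF add(3)] and t = module_homD[OF add(4)]
  have eq: "D c (s \<oplus>\<^bsub>Cd X Y\<^esub> t) = D c s \<oplus>\<^bsub>W\<^esub> D c t" if "c \<in> carrier A" for c
    by (rule module_homD(2)[OF D[OF that] add(1,2)])
  show ?case
  proof (rule module_homI)
    show "D (x \<oplus>\<^bsub>A\<^esub> y) (s \<oplus>\<^bsub>Cd X Y\<^esub> t) = D x (s \<oplus>\<^bsub>Cd X Y\<^esub> t) \<oplus>\<^bsub>W\<^esub> D y (s \<oplus>\<^bsub>Cd X Y\<^esub> t)"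
      if "x \<in> carrier A" "y \<in> carrier A" for x y
      using that s(1,2) t(1,2)
      by (simp add: eq W.M.a_assoc W.M.a_lcomm[where x = "D y s" and y = "D x t"])
  qed (simp_all add: eq s(1,3) t(1,3) W.smult_r_distr)
qed

lemma bilinear_bifunctor_coend: "bilinear_bifunctor K \<C> B"
proof -
  note cb = balancedD[OF cls_balanced]
  note Pullh = coend_Pull_hom and Pushh = coend_Push_hom
  have id: "(\<lambda>t. t) \<in> module_hom K (Cd X Y) (Cd X Y)" for X Y by (rule module_homI) simp_all
  show ?thesis
  proof (intro bilinear_bifunctor.intro bilinear_bifunctor_axioms.intro, unfold Val_coend)
    show "linear_category K \<C>" ..
    show "vectorspace K (Cd X Y)" for X Y by (rule vectorspace_Cd)
  next
    fix c X X' Y assume "c \<in> Arr \<C> X X'"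
    then show "Pull B X X' Y c \<in> module_hom K (Cd X' Y) (Cd X Y)" by (rule Pullh)
  next
    fix a X Y Y' assume "a \<in> Arr \<C> Y Y'"
    then show "Push B X Y Y' a \<in> module_hom K (Cd X Y) (Cd X Y')" by (rule Pushh)
  next
    fix \<delta> X Y assume "\<delta> \<in> carrier (Cd X Y)"
    then show "Pull B X X Y (Ident \<C> X) \<delta> = \<delta>"
      by (rule coend_hom_eqI[OF vectorspace_Cd Pullh[OF F.Ident_Arr] id, rotated])
        (simp add: coend_Pull_cls F.Ident_Arr G.Pull_Ident)
  next
    fix \<delta> X Y assume "\<delta> \<in> carrier (Cd X Y)"
    then show "Push B X Y Y (Ident \<C> Y) \<delta> = \<delta>"
      by (rule coend_hom_eqI[OF vectorspace_Cd Pushh[OF F.Ident_Arr] id, rotated])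
        (simp add: coend_Push_cls F.Ident_Arr F.Push_Ident)
  next
    fix c X X' c' X'' \<delta> Y
    assume c: "c \<in> Arr \<C> X X'" "c' \<in> Arr \<C> X' X''" and d: "\<delta> \<in> carrier (Cd X'' Y)"
    show "Pull B X X'' Y (c' \<cdot> c) \<delta> = Pull B X X' Y c (Pull B X' X'' Y c' \<delta>)"
      by (rule coend_hom_eqI[OF vectorspace_Cd Pullh[OF F.Comp_Arr[OF c]]
            module_hom_comp[OF Pullh[OF c(2)] Pullh[OF c(1)]] _ d])
        (simp add: c coend_Pull_cls F.Comp_Arr[OF c] G.Pull_Comp[OF c] G.Pull_closed)
  next
    fix a Y Y' a' Y'' \<delta> X
    assume a: "a \<in> Arr \<C> Y Y'" "a' \<in> Arr \<C> Y' Y''" and d: "\<delta> \<in> carrier (Cd X Y)"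
    show "Push B X Y Y'' (a' \<cdot> a) \<delta> = Push B X Y' Y'' a' (Push B X Y Y' a \<delta>)"
      by (rule coend_hom_eqI[OF vectorspace_Cd Pushh[OF F.Comp_Arr[OF a]]
            module_hom_comp[OF Pushh[OF a(1)] Pushh[OF a(2)]] _ d])
        (simp add: a coend_Push_cls F.Comp_Arr[OF a] F.Push_Comp[OF a] F.Push_closed)
  next
    fix c X X' a Y Y' \<delta>
    assume c: "c \<in> Arr \<C> X X'" and a: "a \<in> Arr \<C> Y Y'" and d: "\<delta> \<in> carrier (Cd X' Y)"
    show "Push B X Y Y' a (Pull B X X' Y c \<delta>) = Pull B X X' Y' c (Push B X' Y Y' a \<delta>)"
      by (rule coend_hom_eqI[OF vectorspace_Cd module_hom_comp[OF Pullh[OF c] Pushh[OF a]]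
            module_hom_comp[OF Pushh[OF a] Pullh[OF c]] _ d])
        (simp add: c a coend_Pull_cls coend_Push_cls G.Pull_closed F.Push_closed)
  next
    fix \<delta> X' Y X assume "\<delta> \<in> carrier (Cd X' Y)"
    then show "(\<lambda>c. Pull B X X' Y c \<delta>) \<in> module_hom K (Hom \<C> X X') (Cd X Y)"
    proof (rule coend_linear_family[OF F.module_Hom vectorspace_Cd Pullh, rotated 2])
      fix M x h assume xh: "x \<in> carrier (Val F M Y)" "h \<in> carrier (Val G X' M)"
      note lin = module_homD[OF G.Pull_linear[OF xh(2)]]
      show "(\<lambda>c. Pull B X X' Y c (cls X' Y M x h)) \<in> module_hom K (Hom \<C> X X') (Cd X Y)"
        by (rule module_homI)
          (simp_all add: coend_Pull_cls xh lin cb(3,5) cls_closed G.Pull_closed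
            F.Hom.M.a_closed F.Hom.smult_closed)
    qed simp
  next
    fix \<delta> X Y Y' assume "\<delta> \<in> carrier (Cd X Y)"
    then show "(\<lambda>a. Push B X Y Y' a \<delta>) \<in> module_hom K (Hom \<C> Y Y') (Cd X Y')"
    proof (rule coend_linear_family[OF F.module_Hom vectorspace_Cd Pushh, rotated 2])
      fix M x h assume xh: "x \<in> carrier (Val F M Y)" "h \<in> carrier (Val G X M)"
      note lin = module_homD[OF F.Push_linear[OF xh(1)]]
      show "(\<lambda>a. Push B X Y Y' a (cls X Y M x h)) \<in> module_hom K (Hom \<C> Y Y') (Cd X Y')"
        by (rule module_homI)
          (simp_all add: coend_Push_cls xh lin cb(2,4) cls_closed F.Push_closed
            F.Hom.M.a_closed F.Hom.smult_closed)
    qed simp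
  qed
qed

end

section \<open>Presentations of composites\<close>

text \<open>
  What the presentation arguments use of the coend \<open>H\<close> of \<open>F\<close> and \<open>G\<close>, stated so that it can be
  moved along a change of the type of elements. Here \<open>\<tau> X Y M x h\<close> is the class of \<open>x \<otimes> h\<close>. The
  zero test occurs twice because the type of its target is fixed inside a locale: the targets that
  occur are values of \<open>F\<close> and values of \<open>G\<close>.
\<close>

locale composite = F: bilinear_bifunctor K \<C> F + G: bilinear_bifunctor K \<C> G
    + H: bilinear_bifunctor K \<C> H
  for K :: "'k ring" and \<C> :: "('k, 'o, 'm, 'z) lincat_scheme" (structure)
    and F :: "('k, 'o, 'm, 'x) bifunctor" and G :: "('k, 'o, 'm, 'y) bifunctor"
    and H :: "('k, 'o, 'm, 'w) bifunctor" +
  fixes \<tau> :: "'o \<Rightarrow> 'o \<Rightarrow> 'o \<Rightarrow> 'x \<Rightarrow> 'y \<Rightarrow> 'w"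
  assumes \<tau>_balanced: "balanced K \<C> F G X Y (Val H X Y) (\<tau> X Y)"
    and generated: "\<lbrakk>t \<in> carrier (Val H X Y); Q \<zero>\<^bsub>Val H X Y\<^esub>;
        \<And>M x h. \<lbrakk>x \<in> carrier (Val F M Y); h \<in> carrier (Val G X M)\<rbrakk> \<Longrightarrow> Q (\<tau> X Y M x h);
        \<And>s t. \<lbrakk>s \<in> carrier (Val H X Y); t \<in> carrier (Val H X Y); Q s; Q t\<rbrakk>
          \<Longrightarrow> Q (s \<oplus>\<^bsub>Val H X Y\<^esub> t)\<rbrakk> \<Longrightarrow> Q t"
    and Pull_\<tau>: "\<lbrakk>c \<in> Arr \<C> X X'; x \<in> carrier (Val F M Y); h \<in> carrier (Val G X' M)\<rbrakk>
        \<Longrightarrow> Pull H X X' Y c (\<tau> X' Y M x h) = \<tau> X Y M x (Pull G X X' M c h)"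
    and Push_\<tau>: "\<lbrakk>a \<in> Arr \<C> Y Y'; x \<in> carrier (Val F M Y); h \<in> carrier (Val G X M)\<rbrakk>
        \<Longrightarrow> Push H X Y Y' a (\<tau> X Y M x h) = \<tau> X Y' M (Push F M Y Y' a x) h"
    and zero_test_left: "\<lbrakk>vectorspace K W; balanced K \<C> F G X Y W \<beta>;
        x \<in> carrier (Val F M Y); h \<in> carrier (Val G X M); \<tau> X Y M x h = \<zero>\<^bsub>Val H X Y\<^esub>\<rbrakk>
        \<Longrightarrow> \<beta> M x h = (\<zero>\<^bsub>W\<^esub> :: 'x)"
    and zero_test_right: "\<lbrakk>vectorspace K V; balanced K \<C> F G X Y V \<gamma>;
        x \<in> carrier (Val F M Y); h \<in> carrier (Val G X M); \<tau> X Y M x h = \<zero>\<^bsub>Val H X Y\<^esub>\<rbrakk>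
        \<Longrightarrow> \<gamma> M x h = (\<zero>\<^bsub>V\<^esub> :: 'y)"

lemma (in bifunctor_pair) composite_coend: "composite K \<C> F G B cls"
  apply (rule composite.intro)
     apply (rule F.bilinear_bifunctor_axioms G.bilinear_bifunctor_axioms bilinear_bifunctor_coend)+
  apply (rule composite_axioms.intro)
       apply (unfold Val_coend)
       apply (rule cls_balanced)
      subgoal for t X Y Q by (rule coend_induct[of t X Y Q])
     apply (rule coend_Pull_cls; assumption)
    apply (rule coend_Push_cls; assumption)
   subgoal for W X Y \<beta> x M h by (rule zero_test[of W X Y \<beta>])
  subgoal for W X Y \<beta> x M h by (rule zero_test[of W X Y \<beta>])
  done

context composite
begin

lemma \<tau>_zero_left: "h \<in> carrier (Val G X M) \<Longrightarrow> \<tau> X Y M \<zero>\<^bsub>Val F M Y\<^esub> h = \<zero>\<^bsub>Val H X Y\<^esub>"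
proof -
  assume h: "h \<in> carrier (Val G X M)"
  have "(\<lambda>x. \<tau> X Y M x h) \<in> module_hom K (Val F M Y) (Val H X Y)"
    by (rule module_homI) (simp_all add: balancedD(1,2,4)[OF \<tau>_balanced] h)
  then show ?thesis by (rule module_hom_zero[OF F.module_Val H.module_Val])
qed

lemma \<tau>_zero_right: "x \<in> carrier (Val F M Y) \<Longrightarrow> \<tau> X Y M x \<zero>\<^bsub>Val G X M\<^esub> = \<zero>\<^bsub>Val H X Y\<^esub>"
proof -
  assume x: "x \<in> carrier (Val F M Y)"
  have "(\<lambda>h. \<tau> X Y M x h) \<in> module_hom K (Val G X M) (Val H X Y)"
    by (rule module_homI) (simp_all add: balancedD(1,3,5)[OF \<tau>_balanced] x)
  then show ?thesis by (rule module_hom_zero[OF G.module_Val H.module_Val])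
qed

lemma trivial_composite:
  assumes "\<And>M. carrier (Val G X M) = {\<zero>\<^bsub>Val G X M\<^esub>}"
  shows "carrier (Val H X Y) = {\<zero>\<^bsub>Val H X Y\<^esub>}"
proof -
  have "t = \<zero>\<^bsub>Val H X Y\<^esub>" if "t \<in> carrier (Val H X Y)" for t
    using that by (rule generated) (use assms \<tau>_zero_right in auto)
  then show ?thesis using H.Val.M.zero_closed by blast
qed

text \<open>
  Let \<open>G(Y, -)\<close> be the cokernel of \<open>\<C>(i, -)\<close> with \<open>i : W \<rightarrow> P\<close>. The coend is right exact in its
  second factor and returns \<open>F(W, -)\<close> if this factor is \<open>\<C>(W, -)\<close>, so \<open>H(Y, -)\<close> is the cokernel of \<open>F(P, -) \<rightarrow> F(W, -)\<close>, which is
  \<open>F(W, -)\<close> if \<open>F(P, -) = 0\<close>. Concretely, \<open>x \<otimes> m\<^sub>* \<delta> = m\<^sup>* x \<otimes> \<delta>\<close> makes \<open>x \<mapsto> x \<otimes> \<delta>\<close> surjective, and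
  \<open>x \<otimes> h \<mapsto> m\<^sup>* x\<close> for any \<open>m\<close> with \<open>h = m\<^sub>* \<delta>\<close> is its inverse. Hence a presentation of \<open>F(W, -)\<close>
  is one of \<open>H(Y, -)\<close>.
\<close>

lemma presents_left:
  assumes Gp: "presents \<C> (\<lambda>A. Val G Y A) (\<lambda>A B f. Push G Y A B f) W P i \<delta>"
    and triv: "\<And>A. carrier (Val F P A) = {\<zero>\<^bsub>Val F P A\<^esub>}"
    and Fp: "presents \<C> (\<lambda>A. Val F W A) (\<lambda>A B f. Push F W A B f) W' P' i' e"
  shows "presents \<C> (\<lambda>A. Val H Y A) (\<lambda>A B f. Push H Y A B f) W' P' i' (\<tau> Y W' W e \<delta>)"
proof -
  have i: "i \<in> Arr \<C> W P" and \<delta>: "\<delta> \<in> carrier (Val G Y W)"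
    and gen: "\<And>A h. h \<in> carrier (Val G Y A) \<Longrightarrow> \<exists>m \<in> Arr \<C> W A. Push G Y W A m \<delta> = h"
    and ker: "\<And>A m. \<lbrakk>m \<in> Arr \<C> W A; Push G Y W A m \<delta> = \<zero>\<^bsub>Val G Y A\<^esub>\<rbrakk> \<Longrightarrow> \<exists>g \<in> Arr \<C> P A. m = g \<cdot> i"
    using Gp unfolding presents_def by blast+
  have i': "i' \<in> Arr \<C> W' P'" and e: "e \<in> carrier (Val F W W')"
    and genF: "\<And>A x. x \<in> carrier (Val F W A) \<Longrightarrow> \<exists>k \<in> Arr \<C> W' A. Push F W W' A k e = x"
    and kerF: "\<And>A k. k \<in> Arr \<C> W' A \<Longrightarrow>
      Push F W W' A k e = \<zero>\<^bsub>Val F W A\<^esub> \<longleftrightarrow> (\<exists>g \<in> Arr \<C> P' A. k = g \<cdot> i')"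
    using Fp unfolding presents_def by blast+
  \<comment> \<open>two choices of \<open>m\<close> differ by an arrow through \<open>P\<close>, on which \<open>F\<close> vanishes\<close>
  have wd: "Pull F W M A m x = Pull F W M A m' x"
    if m: "m \<in> Arr \<C> W M" "m' \<in> Arr \<C> W M" "Push G Y W M m \<delta> = Push G Y W M m' \<delta>"
      and x: "x \<in> carrier (Val F M A)" for M A m m' x
  proof -
    have "Push G Y W M (m \<ominus>\<^bsub>Hom \<C> W M\<^esub> m') \<delta> = \<zero>\<^bsub>Val G Y M\<^esub>"
      using G.Push_diff_arrow[OF \<delta> m(1,2)] m(3) G.Push_closed[OF m(2) \<delta>] by simp
    then obtain g where g: "g \<in> Arr \<C> P M" "m \<ominus>\<^bsub>Hom \<C> W M\<^esub> m' = g \<cdot> i"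
      using ker F.Hom.M.minus_closed[OF m(1,2)] by blast
    have "Pull F W M A m x \<ominus>\<^bsub>Val F W A\<^esub> Pull F W M A m' x = Pull F W P A i (Pull F P M A g x)"
      using F.Pull_diff_arrow[OF x m(1,2)] F.Pull_Comp[OF i g(1) x] g(2) by simp
    also have "\<dots> = \<zero>\<^bsub>Val F W A\<^esub>"
      using triv[of A] F.Pull_closed[OF g(1) x] F.Pull_zero[OF i] by simp
    finally show ?thesis using F.Pull_closed[OF m(1) x] F.Pull_closed[OF m(2) x] by simp
  qed
  define ch where "ch M h = (SOME m. m \<in> Arr \<C> W M \<and> Push G Y W M m \<delta> = h)" for M h
  have ch: "ch M h \<in> Arr \<C> W M" "Push G Y W M (ch M h) \<delta> = h" if "h \<in> carrier (Val G Y M)" for M h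
  proof -
    have "\<exists>m. m \<in> Arr \<C> W M \<and> Push G Y W M m \<delta> = h" using gen[OF that] by blast
    from someI_ex[OF this] show "ch M h \<in> Arr \<C> W M" "Push G Y W M (ch M h) \<delta> = h"
      by (auto simp: ch_def)
  qed
  have bal: "balanced K \<C> F G Y A (Val F W A) (\<lambda>M x h. Pull F W M A (ch M h) x)" for A
  proof (rule balancedI)
    fix M x h h' assume x: "x \<in> carrier (Val F M A)"
      and h: "h \<in> carrier (Val G Y M)" "h' \<in> carrier (Val G Y M)"
    note c = ch[OF h(1)] and c' = ch[OF h(2)] and c'' = ch[OF G.Val.M.a_closed[OF h]]
    have "Push G Y W M (ch M h \<oplus>\<^bsub>Hom \<C> W M\<^esub> ch M h') \<delta> = h \<oplus>\<^bsub>Val G Y M\<^esub> h'"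
      using module_homD(2)[OF G.Push_linear[OF \<delta>] c(1) c'(1)] c c' by simp
    then have "Pull F W M A (ch M (h \<oplus>\<^bsub>Val G Y M\<^esub> h')) x
        = Pull F W M A (ch M h \<oplus>\<^bsub>Hom \<C> W M\<^esub> ch M h') x"
      by (intro wd[OF c''(1) _ _ x]) (use c c' c'' in auto)
    then show "Pull F W M A (ch M (h \<oplus>\<^bsub>Val G Y M\<^esub> h')) x
        = Pull F W M A (ch M h) x \<oplus>\<^bsub>Val F W A\<^esub> Pull F W M A (ch M h') x"
      using module_homD(2)[OF F.Pull_linear[OF x] c(1) c'(1)] by simp
  next
    fix M k x h assume k: "k \<in> carrier K" and x: "x \<in> carrier (Val F M A)"
      and h: "h \<in> carrier (Val G Y M)"
    note c = ch[OF h] and c'' = ch[OF G.Val.smult_closed[OF k h]]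
    have "Push G Y W M (k \<odot>\<^bsub>Hom \<C> W M\<^esub> ch M h) \<delta> = k \<odot>\<^bsub>Val G Y M\<^esub> h"
      using module_homD(3)[OF G.Push_linear[OF \<delta>] k c(1)] c by simp
    then have "Pull F W M A (ch M (k \<odot>\<^bsub>Val G Y M\<^esub> h)) x = Pull F W M A (k \<odot>\<^bsub>Hom \<C> W M\<^esub> ch M h) x"
      by (intro wd[OF c''(1) _ _ x]) (use c c'' k in auto)
    then show "Pull F W M A (ch M (k \<odot>\<^bsub>Val G Y M\<^esub> h)) x = k \<odot>\<^bsub>Val F W A\<^esub> Pull F W M A (ch M h) x"
      using module_homD(3)[OF F.Pull_linear[OF x] k c(1)] by simp
  next
    fix M M' f x h assume f: "f \<in> Arr \<C> M M'" and x: "x \<in> carrier (Val F M' A)"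
      and h: "h \<in> carrier (Val G Y M)"
    note c = ch[OF h] and c' = ch[OF G.Push_closed[OF f h]]
    have fc: "f \<cdot> ch M h \<in> Arr \<C> W M'" by (rule F.Comp_Arr[OF c(1) f])
    have "Push G Y W M' (f \<cdot> ch M h) \<delta> = Push G Y M M' f h"
      using G.Push_Comp[OF c(1) f \<delta>] c(2) by simp
    then have "Pull F W M' A (ch M' (Push G Y M M' f h)) x = Pull F W M' A (f \<cdot> ch M h) x"
      by (intro wd[OF c'(1) fc _ x]) (use c' in simp)
    then show "Pull F W M A (ch M h) (Pull F M M' A f x) = Pull F W M' A (ch M' (Push G Y M M' f h)) x"
      using F.Pull_Comp[OF c(1) f x] by simp
  qed (simp_all add: ch F.Pull_closed module_homD[OF F.Pull_hom])
  have simple: "\<exists>x \<in> carrier (Val F W A). t = \<tau> Y A W x \<delta>" if t: "t \<in> carrier (Val H Y A)" for A t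
    using t
  proof (rule generated)
    show "\<exists>x \<in> carrier (Val F W A). \<zero>\<^bsub>Val H Y A\<^esub> = \<tau> Y A W x \<delta>"
      using \<tau>_zero_left[OF \<delta>] F.Val.M.zero_closed by metis
  next
    fix M x h assume x: "x \<in> carrier (Val F M A)" and h: "h \<in> carrier (Val G Y M)"
    have "\<tau> Y A M x h = \<tau> Y A W (Pull F W M A (ch M h) x) \<delta>"
      using balancedD(6)[OF \<tau>_balanced ch(1)[OF h] x \<delta>] ch(2)[OF h] by simp
    then show "\<exists>x' \<in> carrier (Val F W A). \<tau> Y A M x h = \<tau> Y A W x' \<delta>"
      using F.Pull_closed[OF ch(1)[OF h] x] by blast
  next
    fix s t assume "\<exists>x \<in> carrier (Val F W A). s = \<tau> Y A W x \<delta>" "\<exists>x \<in> carrier (Val F W A). t = \<tau> Y A W x \<delta>"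
    then obtain x x' where x: "x \<in> carrier (Val F W A)" "x' \<in> carrier (Val F W A)"
      "s = \<tau> Y A W x \<delta>" "t = \<tau> Y A W x' \<delta>" by blast
    then show "\<exists>x \<in> carrier (Val F W A). s \<oplus>\<^bsub>Val H Y A\<^esub> t = \<tau> Y A W x \<delta>"
      using balancedD(2)[OF \<tau>_balanced x(1,2) \<delta>] F.Val.M.a_closed[OF x(1,2)] by metis
  qed
  have "Push H Y W' A k (\<tau> Y W' W e \<delta>) = \<zero>\<^bsub>Val H Y A\<^esub> \<longleftrightarrow> Push F W W' A k e = \<zero>\<^bsub>Val F W A\<^esub>"
    if k: "k \<in> Arr \<C> W' A" for A k
  proof -
    have ke: "Push F W W' A k e \<in> carrier (Val F W A)" by (rule F.Push_closed[OF k e])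
    have "Pull F W W A (ch W \<delta>) (Push F W W' A k e) = Pull F W W A (Ident \<C> W) (Push F W W' A k e)"
      using ch[OF \<delta>] G.Push_Ident[OF \<delta>] by (intro wd[OF _ F.Ident_Arr _ ke]) auto
    then have \<beta>: "Pull F W W A (ch W \<delta>) (Push F W W' A k e) = Push F W W' A k e"
      using F.Pull_Ident[OF ke] by simp
    show ?thesis
      unfolding Push_\<tau>[OF k e \<delta>]
      using zero_test_left[OF F.vectorspace_Val bal ke \<delta>] \<beta> \<tau>_zero_left[OF \<delta>] by auto
  qed
  moreover have "\<exists>k \<in> Arr \<C> W' A. Push H Y W' A k (\<tau> Y W' W e \<delta>) = t"
    if t: "t \<in> carrier (Val H Y A)" for A t
  proof -
    obtain x where x: "x \<in> carrier (Val F W A)" "t = \<tau> Y A W x \<delta>" using simple[OF t] by blast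
    obtain k where "k \<in> Arr \<C> W' A" "Push F W W' A k e = x" using genF[OF x(1)] by blast
    then show ?thesis using Push_\<tau>[OF _ e \<delta>] x(2) by auto
  qed
  ultimately show ?thesis
    unfolding presents_def using i' kerF balancedD(1)[OF \<tau>_balanced e \<delta>] by simp
qed

end

text \<open>
  The mirror image of the previous argument: \<open>F(-, X)\<close> is now a cokernel of representable functors,
  \<open>h \<mapsto> e \<otimes> h\<close> identifies \<open>G(-, W)\<close> with \<open>H(-, X)\<close>, and \<open>x \<otimes> h \<mapsto> m\<^sub>* h\<close> for any \<open>m\<close> with \<open>x = m\<^sup>* e\<close>
  is the inverse; it is well defined because \<open>G(-, J) = 0\<close>.
\<close>

lemma composite_presents_right:
  fixes \<C> :: "('k, 'o, 'm, 'e, 'z) extricat_scheme" (structure)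
  assumes comp: "composite K \<C> F G H \<tau>"
    and Fp: "presents (opp \<C>) (\<lambda>A. Val F A X) (\<lambda>A B f. Pull F B A X f) W J q e"
    and triv: "\<And>A. carrier (Val G A J) = {\<zero>\<^bsub>Val G A J\<^esub>}"
    and Gp: "presents (opp \<C>) (\<lambda>A. Val G A W) (\<lambda>A B f. Pull G B A W f) W' J' q' \<epsilon>"
  shows "presents (opp \<C>) (\<lambda>A. Val H A X) (\<lambda>A B f. Pull H B A X f) W' J' q' (\<tau> W' X W e \<epsilon>)"
proof -
  interpret composite K \<C> F G H \<tau> by fact
  have q: "q \<in> Arr \<C> J W" and e: "e \<in> carrier (Val F W X)"
    and gen: "\<And>A x. x \<in> carrier (Val F A X) \<Longrightarrow> \<exists>m \<in> Arr \<C> A W. Pull F A W X m e = x"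
    and ker: "\<And>A m. \<lbrakk>m \<in> Arr \<C> A W; Pull F A W X m e = \<zero>\<^bsub>Val F A X\<^esub>\<rbrakk> \<Longrightarrow> \<exists>g \<in> Arr \<C> A J. m = q \<cdot> g"
    using Fp unfolding presents_def opp_simps by blast+
  have q': "q' \<in> Arr \<C> J' W'" and \<epsilon>: "\<epsilon> \<in> carrier (Val G W' W)"
    and genG: "\<And>A h. h \<in> carrier (Val G A W) \<Longrightarrow> \<exists>k \<in> Arr \<C> A W'. Pull G A W' W k \<epsilon> = h"
    and kerG: "\<And>A k. k \<in> Arr \<C> A W' \<Longrightarrow>
      Pull G A W' W k \<epsilon> = \<zero>\<^bsub>Val G A W\<^esub> \<longleftrightarrow> (\<exists>g \<in> Arr \<C> A J'. k = q' \<cdot> g)"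
    using Gp unfolding presents_def opp_simps by blast+
  \<comment> \<open>two choices of \<open>m\<close> differ by an arrow through \<open>J\<close>, where \<open>G\<close> vanishes\<close>
  have wd: "Push G A M W m h = Push G A M W m' h"
    if m: "m \<in> Arr \<C> M W" "m' \<in> Arr \<C> M W" "Pull F M W X m e = Pull F M W X m' e"
      and h: "h \<in> carrier (Val G A M)" for M A m m' h
  proof -
    have "Pull F M W X (m \<ominus>\<^bsub>Hom \<C> M W\<^esub> m') e = \<zero>\<^bsub>Val F M X\<^esub>"
      using F.Pull_diff_arrow[OF e m(1,2)] m(3) F.Pull_closed[OF m(2) e] by simp
    then obtain g where g: "g \<in> Arr \<C> M J" "m \<ominus>\<^bsub>Hom \<C> M W\<^esub> m' = q \<cdot> g"
      using ker F.Hom.M.minus_closed[OF m(1,2)] by blast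
    have "Push G A M W m h \<ominus>\<^bsub>Val G A W\<^esub> Push G A M W m' h = Push G A J W q (Push G A M J g h)"
      using G.Push_diff_arrow[OF h m(1,2)] G.Push_Comp[OF g(1) q h] g(2) by simp
    also have "\<dots> = \<zero>\<^bsub>Val G A W\<^esub>"
      using triv[of A] G.Push_closed[OF g(1) h] G.Push_zero[OF q] by simp
    finally show ?thesis using G.Push_closed[OF m(1) h] G.Push_closed[OF m(2) h] by simp
  qed
  define ch where "ch M x = (SOME m. m \<in> Arr \<C> M W \<and> Pull F M W X m e = x)" for M x
  have ch: "ch M x \<in> Arr \<C> M W" "Pull F M W X (ch M x) e = x" if "x \<in> carrier (Val F M X)" for M x
  proof -
    have "\<exists>m. m \<in> Arr \<C> M W \<and> Pull F M W X m e = x" using gen[OF that] by blast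
    from someI_ex[OF this] show "ch M x \<in> Arr \<C> M W" "Pull F M W X (ch M x) e = x"
      by (auto simp: ch_def)
  qed
  have bal: "balanced K \<C> F G A X (Val G A W) (\<lambda>M x h. Push G A M W (ch M x) h)" for A
  proof (rule balancedI)
    fix M x x' h assume x: "x \<in> carrier (Val F M X)" "x' \<in> carrier (Val F M X)"
      and h: "h \<in> carrier (Val G A M)"
    note c = ch[OF x(1)] and c' = ch[OF x(2)] and c'' = ch[OF F.Val.M.a_closed[OF x]]
    have "Pull F M W X (ch M x \<oplus>\<^bsub>Hom \<C> M W\<^esub> ch M x') e = x \<oplus>\<^bsub>Val F M X\<^esub> x'"
      using module_homD(2)[OF F.Pull_linear[OF e] c(1) c'(1)] c c' by simp
    then have "Push G A M W (ch M (x \<oplus>\<^bsub>Val F M X\<^esub> x')) h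
        = Push G A M W (ch M x \<oplus>\<^bsub>Hom \<C> M W\<^esub> ch M x') h"
      by (intro wd[OF c''(1) _ _ h]) (use c c' c'' in auto)
    then show "Push G A M W (ch M (x \<oplus>\<^bsub>Val F M X\<^esub> x')) h
        = Push G A M W (ch M x) h \<oplus>\<^bsub>Val G A W\<^esub> Push G A M W (ch M x') h"
      using module_homD(2)[OF G.Push_linear[OF h] c(1) c'(1)] by simp
  next
    fix M k x h assume k: "k \<in> carrier K" and x: "x \<in> carrier (Val F M X)"
      and h: "h \<in> carrier (Val G A M)"
    note c = ch[OF x] and c'' = ch[OF F.Val.smult_closed[OF k x]]
    have "Pull F M W X (k \<odot>\<^bsub>Hom \<C> M W\<^esub> ch M x) e = k \<odot>\<^bsub>Val F M X\<^esub> x"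
      using module_homD(3)[OF F.Pull_linear[OF e] k c(1)] c by simp
    then have "Push G A M W (ch M (k \<odot>\<^bsub>Val F M X\<^esub> x)) h = Push G A M W (k \<odot>\<^bsub>Hom \<C> M W\<^esub> ch M x) h"
      by (intro wd[OF c''(1) _ _ h]) (use c c'' k in auto)
    then show "Push G A M W (ch M (k \<odot>\<^bsub>Val F M X\<^esub> x)) h = k \<odot>\<^bsub>Val G A W\<^esub> Push G A M W (ch M x) h"
      using module_homD(3)[OF G.Push_linear[OF h] k c(1)] by simp
  next
    fix M M' f x h assume f: "f \<in> Arr \<C> M M'" and x: "x \<in> carrier (Val F M' X)"
      and h: "h \<in> carrier (Val G A M)"
    note c = ch[OF x] and c' = ch[OF F.Pull_closed[OF f x]]
    have cf: "ch M' x \<cdot> f \<in> Arr \<C> M W" by (rule F.Comp_Arr[OF f c(1)])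
    have "Pull F M W X (ch M' x \<cdot> f) e = Pull F M M' X f x"
      using F.Pull_Comp[OF f c(1) e] c(2) by simp
    then have "Push G A M W (ch M (Pull F M M' X f x)) h = Push G A M W (ch M' x \<cdot> f) h"
      by (intro wd[OF c'(1) cf _ h]) (use c' in simp)
    then show "Push G A M W (ch M (Pull F M M' X f x)) h = Push G A M' W (ch M' x) (Push G A M M' f h)"
      using G.Push_Comp[OF f c(1) h] by simp
  qed (simp_all add: ch G.Push_closed module_homD[OF G.Push_hom])
  have simple: "\<exists>h \<in> carrier (Val G A W). t = \<tau> A X W e h" if t: "t \<in> carrier (Val H A X)" for A t
    using t
  proof (rule generated)
    show "\<exists>h \<in> carrier (Val G A W). \<zero>\<^bsub>Val H A X\<^esub> = \<tau> A X W e h"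
      using \<tau>_zero_right[OF e] G.Val.M.zero_closed by metis
  next
    fix M x h assume x: "x \<in> carrier (Val F M X)" and h: "h \<in> carrier (Val G A M)"
    have "\<tau> A X M x h = \<tau> A X W e (Push G A M W (ch M x) h)"
      using balancedD(6)[OF \<tau>_balanced ch(1)[OF x] e h] ch(2)[OF x] by simp
    then show "\<exists>h' \<in> carrier (Val G A W). \<tau> A X M x h = \<tau> A X W e h'"
      using G.Push_closed[OF ch(1)[OF x] h] by blast
  next
    fix s t assume "\<exists>h \<in> carrier (Val G A W). s = \<tau> A X W e h" "\<exists>h \<in> carrier (Val G A W). t = \<tau> A X W e h"
    then obtain h h' where h: "h \<in> carrier (Val G A W)" "h' \<in> carrier (Val G A W)"
      "s = \<tau> A X W e h" "t = \<tau> A X W e h'" by blast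
    then show "\<exists>h \<in> carrier (Val G A W). s \<oplus>\<^bsub>Val H A X\<^esub> t = \<tau> A X W e h"
      using balancedD(3)[OF \<tau>_balanced e h(1,2)] G.Val.M.a_closed[OF h(1,2)] by metis
  qed
  have "Pull H A W' X k (\<tau> W' X W e \<epsilon>) = \<zero>\<^bsub>Val H A X\<^esub> \<longleftrightarrow> Pull G A W' W k \<epsilon> = \<zero>\<^bsub>Val G A W\<^esub>"
    if k: "k \<in> Arr \<C> A W'" for A k
  proof -
    have k\<epsilon>: "Pull G A W' W k \<epsilon> \<in> carrier (Val G A W)" by (rule G.Pull_closed[OF k \<epsilon>])
    have "Push G A W W (ch W e) (Pull G A W' W k \<epsilon>) = Push G A W W (Ident \<C> W) (Pull G A W' W k \<epsilon>)"
      using ch[OF e] F.Pull_Ident[OF e] by (intro wd[OF _ F.Ident_Arr _ k\<epsilon>]) auto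
    then have \<beta>: "Push G A W W (ch W e) (Pull G A W' W k \<epsilon>) = Pull G A W' W k \<epsilon>"
      using G.Push_Ident[OF k\<epsilon>] by simp
    show ?thesis
      unfolding Pull_\<tau>[OF k e \<epsilon>]
      using zero_test_right[OF G.vectorspace_Val bal e k\<epsilon>] \<beta> \<tau>_zero_right[OF e] by auto
  qed
  moreover have "\<exists>k \<in> Arr \<C> A W'. Pull H A W' X k (\<tau> W' X W e \<epsilon>) = t"
    if t: "t \<in> carrier (Val H A X)" for A t
  proof -
    obtain h where h: "h \<in> carrier (Val G A W)" "t = \<tau> A X W e h" using simple[OF t] by blast
    obtain k where "k \<in> Arr \<C> A W'" "Pull G A W' W k \<epsilon> = h" using genG[OF h(1)] by blast
    then show ?thesis using Pull_\<tau>[OF _ e \<epsilon>] h(2) by auto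
  qed
  ultimately show ?thesis
    unfolding presents_def opp_simps using q' kerG balancedD(1)[OF \<tau>_balanced e \<epsilon>] by simp
qed

section \<open>Transport of structure\<close>

context bilinear_bifunctor
begin

context
  fixes \<iota> :: "'x \<Rightarrow> 'w"
  assumes inj: "\<And>X Y. inj_on \<iota> (carrier (Val F X Y))"
begin

abbreviation "T \<equiv> transport_bifunctor \<iota> F"

lemma transport_simps:
  "carrier (Val T X Y) = \<iota> ` carrier (Val F X Y)"
  "\<zero>\<^bsub>Val T X Y\<^esub> = \<iota> \<zero>\<^bsub>Val F X Y\<^esub>"
  "\<lbrakk>s \<in> carrier (Val F X Y); t \<in> carrier (Val F X Y)\<rbrakk>
    \<Longrightarrow> \<iota> s \<oplus>\<^bsub>Val T X Y\<^esub> \<iota> t = \<iota> (s \<oplus>\<^bsub>Val F X Y\<^esub> t)"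
  "t \<in> carrier (Val F X Y) \<Longrightarrow> k \<odot>\<^bsub>Val T X Y\<^esub> \<iota> t = \<iota> (k \<odot>\<^bsub>Val F X Y\<^esub> t)"
  "t \<in> carrier (Val F X' Y) \<Longrightarrow> Pull T X X' Y c (\<iota> t) = \<iota> (Pull F X X' Y c t)"
  "t \<in> carrier (Val F X Y) \<Longrightarrow> Push T X Y Y' a (\<iota> t) = \<iota> (Push F X Y Y' a t)"
  by (simp_all add: transport_bifunctor_def transport_module_def Let_def inv_into_f_f[OF inj])

lemma bilinear_bifunctor_transport: "bilinear_bifunctor K \<C> T"
proof (intro bilinear_bifunctor.intro bilinear_bifunctor_axioms.intro)
  show "linear_category K \<C>" ..
  show "vectorspace K (Val T X Y)" for X Y
    by (rule vectorspace_surjective_image(1)[OF vectorspace_Val, of \<iota> X Y])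
      (simp_all add: transport_simps)
  show "Pull T X X' Y c \<in> module_hom K (Val T X' Y) (Val T X Y)" if "c \<in> Arr \<C> X X'" for c X X' Y
    using that module_homD[OF Pull_hom[OF that]]
    by (intro module_homI) (auto simp: transport_simps Pull_closed)
  show "Push T X Y Y' a \<in> module_hom K (Val T X Y) (Val T X Y')" if "a \<in> Arr \<C> Y Y'" for a X Y Y'
    using that module_homD[OF Push_hom[OF that]]
    by (intro module_homI) (auto simp: transport_simps Push_closed)
  show "(\<lambda>c. Pull T X X' Y c \<delta>) \<in> module_hom K (Hom \<C> X X') (Val T X Y)"
    if d: "\<delta> \<in> carrier (Val T X' Y)" for \<delta> X' Y X
  proof -
    obtain t where t: "t \<in> carrier (Val F X' Y)" "\<delta> = \<iota> t" using d by (auto simp: transport_simps)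
    show ?thesis
      unfolding t(2) transport_simps(5)[OF t(1)]
      using module_homD[OF Pull_linear[OF t(1)]] Pull_closed[OF _ t(1)]
      by (intro module_homI) (simp_all add: transport_simps)
  qed
  show "(\<lambda>a. Push T X Y Y' a \<delta>) \<in> module_hom K (Hom \<C> Y Y') (Val T X Y')"
    if d: "\<delta> \<in> carrier (Val T X Y)" for \<delta> X Y Y'
  proof -
    obtain t where t: "t \<in> carrier (Val F X Y)" "\<delta> = \<iota> t" using d by (auto simp: transport_simps)
    show ?thesis
      unfolding t(2) transport_simps(6)[OF t(1)]
      using module_homD[OF Push_linear[OF t(1)]] Push_closed[OF _ t(1)]
      by (intro module_homI) (simp_all add: transport_simps)
  qed
qed (auto simp: transport_simps Pull_Ident Push_Ident Pull_Comp Push_Comp Pull_closed Push_closed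
    Push_Pull)

end

end

lemma balanced_hom:
  assumes "balanced K \<C> F G X Y W \<beta>" "f \<in> module_hom K W W'"
  shows "balanced K \<C> F G X Y W' (\<lambda>M x h. f (\<beta> M x h))"
  by (rule balancedI)
    (simp_all add: balancedD[OF assms(1)] module_homD[OF assms(2)])

lemma composite_transport:
  fixes \<iota> :: "'w \<Rightarrow> 'v"
  assumes comp: "composite K \<C> F G H \<tau>" and inj: "\<And>X Y. inj_on \<iota> (carrier (Val H X Y))"
  shows "composite K \<C> F G (transport_bifunctor \<iota> H) (\<lambda>X Y M x h. \<iota> (\<tau> X Y M x h))"
proof -
  interpret composite K \<C> F G H \<tau> by fact
  note ts = H.transport_simps[OF inj]
  note cl = balancedD(1)[OF \<tau>_balanced]
  have hom: "\<iota> \<in> module_hom K (Val H X Y) (Val (transport_bifunctor \<iota> H) X Y)" for X Y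
    by (rule module_homI) (simp_all add: ts)
  have zero: "\<tau> X Y M x h = \<zero>\<^bsub>Val H X Y\<^esub>"
    if "x \<in> carrier (Val F M Y)" "h \<in> carrier (Val G X M)"
      "\<iota> (\<tau> X Y M x h) = \<zero>\<^bsub>Val (transport_bifunctor \<iota> H) X Y\<^esub>" for X Y M x h
    using inj_onD[OF inj _ cl[OF that(1,2)] H.Val.M.zero_closed] that(3) by (simp add: ts)
  show ?thesis
    apply (rule composite.intro)
       apply (rule F.bilinear_bifunctor_axioms G.bilinear_bifunctor_axioms
        H.bilinear_bifunctor_transport[OF inj])+
    apply (rule composite_axioms.intro)
         apply (rule balanced_hom[OF \<tau>_balanced hom])
    subgoal premises prems for t X Y Q
    proof -
      obtain s where s: "s \<in> carrier (Val H X Y)" "t = \<iota> s" using prems(1) by (auto simp: ts)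
      have "Q (\<iota> s)"
      proof (rule generated[OF s(1), of "\<lambda>s. Q (\<iota> s)"])
        show "Q (\<iota> (u \<oplus>\<^bsub>Val H X Y\<^esub> v))"
          if "u \<in> carrier (Val H X Y)" "v \<in> carrier (Val H X Y)" "Q (\<iota> u)" "Q (\<iota> v)" for u v
          using prems(4)[of "\<iota> u" "\<iota> v"] that by (simp add: ts)
      qed (use prems(2,3) in \<open>simp_all add: ts\<close>)
      then show ?thesis using s(2) by simp
    qed
       apply (simp add: ts cl Pull_\<tau>)
      apply (simp add: ts cl Push_\<tau>)
    subgoal premises prems for W X Y \<beta> x M h
      by (rule zero_test_left[OF prems(1-4) zero[OF prems(3-5)]])
    subgoal premises prems for W X Y \<beta> x M h
      by (rule zero_test_right[OF prems(1-4) zero[OF prems(3-5)]])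
    done
qed

lemma presents_image:
  assumes pres: "presents \<C> F act W P i e"
    and inj: "\<And>A. inj_on \<iota> (carrier (F A))" and zero: "\<And>A. \<zero>\<^bsub>F A\<^esub> \<in> carrier (F A)"
    and F': "\<And>A. carrier (F' A) = \<iota> ` carrier (F A)" "\<And>A. \<zero>\<^bsub>F' A\<^esub> = \<iota> \<zero>\<^bsub>F A\<^esub>"
    and act: "\<And>A B f \<xi>. \<lbrakk>f \<in> Arr \<C> A B; \<xi> \<in> carrier (F A)\<rbrakk>
      \<Longrightarrow> act A B f \<xi> \<in> carrier (F B) \<and> act' A B f (\<iota> \<xi>) = \<iota> (act A B f \<xi>)"
  shows "presents \<C> F' act' W P i (\<iota> e)"
proof -
  have i: "i \<in> Arr \<C> W P" and e: "e \<in> carrier (F W)"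
    and gen: "\<And>A \<xi>. \<xi> \<in> carrier (F A) \<Longrightarrow> \<exists>h \<in> Arr \<C> W A. act W A h e = \<xi>"
    and ker: "\<And>A h. h \<in> Arr \<C> W A \<Longrightarrow>
      act W A h e = \<zero>\<^bsub>F A\<^esub> \<longleftrightarrow> (\<exists>g \<in> Arr \<C> P A. h = g \<cdot>\<^bsub>\<C>\<^esub> i)"
    using pres unfolding presents_def by blast+
  have "act' W A h (\<iota> e) = \<zero>\<^bsub>F' A\<^esub> \<longleftrightarrow> act W A h e = \<zero>\<^bsub>F A\<^esub>" if "h \<in> Arr \<C> W A" for A h
    using act[OF that e] inj_on_eq_iff[OF inj _ zero] by (auto simp: F')
  moreover have "\<exists>h \<in> Arr \<C> W A. act' W A h (\<iota> e) = \<xi>" if \<xi>: "\<xi> \<in> carrier (F' A)" for A \<xi>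
  proof -
    obtain x where "x \<in> carrier (F A)" "\<xi> = \<iota> x" using \<xi> F' by auto
    then show ?thesis using gen act[OF _ e] by metis
  qed
  ultimately show ?thesis unfolding presents_def using i e F' ker by simp
qed

text \<open>
  A code determines a member of the coset, and distinct cosets are disjoint. Every coset has a code
  of the required shape since its members are finitely supported.
\<close>

lemma inj_on_encode_coset:
  fixes K :: "'k ring" and S :: "('o \<times> ('k, 'o, 'm, 'e) hext \<times> 'e) set"
  assumes K: "field K" and N: "subspace K N (free_module K S)"
  shows "inj_on (encode_coset K) (carrier (quot_module (free_module K S) N))"
proof (rule inj_onI)
  let ?Q = "quot_module (free_module K S) N"
  interpret N: abelian_subgroup N "free_module K S" by (rule abelian_subgroup_of_subspace[OF N])
  define f where "f l = (\<lambda>s. case map_of l s of None \<Rightarrow> \<zero>\<^bsub>K\<^esub> | Some k \<Rightarrow> k)"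
    for l :: "(('o \<times> ('k, 'o, 'm, 'e) hext \<times> 'e) \<times> 'k) list"
  have code: "\<exists>l. encode_coset K t = Hext_Sum l \<and> f l \<in> t" if t: "t \<in> carrier ?Q" for t
  proof -
    obtain v where v: "v \<in> carrier (free_module K S)" "t = N +>\<^bsub>free_module K S\<^esub> v"
      using t by (auto simp: quot_simps[OF N])
    then have vt: "v \<in> t" using N.a_rcos_self by simp
    have "finite {s. v s \<noteq> \<zero>\<^bsub>K\<^esub>}" using v(1) by (simp add: free_simps[OF K])
    then obtain xs where xs: "set xs = {s. v s \<noteq> \<zero>\<^bsub>K\<^esub>}" using finite_list by blast
    have "f (map (\<lambda>s. (s, v s)) xs) = v"
      by (auto simp: f_def map_of_map_restrict restrict_map_def xs fun_eq_iff)
    then have "\<exists>l. f l \<in> t" using vt by metis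
    from someI_ex[OF this] show ?thesis by (auto simp: encode_coset_def f_def)
  qed
  fix t t' assume t: "t \<in> carrier ?Q" "t' \<in> carrier ?Q" and eq: "encode_coset K t = encode_coset K t'"
  obtain l where l: "f l \<in> t" "f l \<in> t'" using code[OF t(1)] code[OF t(2)] eq by auto
  then have "\<not> disjnt t t'" by (auto simp: disjnt_iff)
  moreover have "t \<in> a_rcosets\<^bsub>free_module K S\<^esub> N" "t' \<in> a_rcosets\<^bsub>free_module K S\<^esub> N"
    using t by (simp_all add: quot_module_def)
  ultimately show "t = t'" using N.a_rcos_disjoint by (auto simp: pairwise_def)
qed

section \<open>Positive extensions\<close>

context extriangulated_category
begin

abbreviation "En n \<equiv> pos_ext K \<C> (Suc n)"

lemma Ext_bilinear: "bilinear_bifunctor K \<C> (Ext \<C>)" by unfold_locales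

lemma inj_encode_coend:
  assumes "bilinear_bifunctor K \<C> (F :: ('k, 'o, 'm, ('k, 'o, 'm, 'e) hext) bifunctor)"
  shows "inj_on (encode_coset K) (carrier (Val (coend_bifunctor K \<C> F (Ext \<C>)) X Y))"
proof -
  interpret bifunctor_pair K \<C> F "Ext \<C>"
    by (rule bifunctor_pair.intro[OF assms Ext_bilinear])
  show ?thesis unfolding Val_coend by (rule inj_on_encode_coset[OF field_K subspace_Nl])
qed

lemma En_bilinear: "bilinear_bifunctor K \<C> (En n)"
proof (induction n)
  case 0
  show ?case using bilinear_bifunctor_transport[of Hext_Ext] by (simp add: inj_on_def)
next
  case (Suc n)
  interpret bifunctor_pair K \<C> "En n" "Ext \<C>"
    by (rule bifunctor_pair.intro[OF Suc Ext_bilinear])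
  show ?case
    using bilinear_bifunctor.bilinear_bifunctor_transport[OF bilinear_bifunctor_coend
        inj_encode_coend[OF Suc]] by simp
qed

lemma En_composite: "\<exists>\<tau>. composite K \<C> (En n) (Ext \<C>) (En (Suc n)) \<tau>"
proof -
  interpret bifunctor_pair K \<C> "En n" "Ext \<C>"
    by (rule bifunctor_pair.intro[OF En_bilinear Ext_bilinear])
  show ?thesis
    using composite_transport[OF composite_coend inj_encode_coend[OF En_bilinear]] by auto
qed

text \<open>
  In degree one this is the definition; in higher degrees, in the coend at \<open>(P, A)\<close> every second
  tensor factor lies in some \<open>\<E>(P, M) = 0\<close>.
\<close>

lemma En_projective:
  assumes "projective \<C> P"
  shows "carrier (Val (En n) P A) = {\<zero>\<^bsub>Val (En n) P A\<^esub>}"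
proof -
  have P: "Extn \<C> P A = {\<zero>\<^bsub>Val (Ext \<C>) P A\<^esub>}" for A using assms by (simp add: projective_def)
  show ?thesis
  proof (cases n)
    case 0
    then show ?thesis using P by (simp add: transport_simps inj_on_def)
  next
    case (Suc m)
    obtain \<tau> where "composite K \<C> (En m) (Ext \<C>) (En (Suc m)) \<tau>" using En_composite by blast
    then show ?thesis unfolding Suc by (rule composite.trivial_composite) (rule P)
  qed
qed

lemma presents_Ext_Push:
  assumes "s_triangle \<C> W i P p Y \<delta>" "projective \<C> P"
  shows "presents \<C> (\<lambda>A. Val (Ext \<C>) Y A) (\<lambda>A B f. ps Y A B f) W P i \<delta>"
proof -
  note T = s_triangleD[OF assms(1)]
  have "\<exists>h \<in> Arr \<C> W A. ps Y W A h \<delta> = \<xi>" if "\<xi> \<in> Extn \<C> Y A" for A \<xi>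
  proof (rule Push_surjective_on_kernel[OF assms(1) that])
    show "pl P Y A p \<xi> = \<zero>\<^bsub>Val (Ext \<C>) P A\<^esub>"
      using assms(2) Pull_closed[OF T(2) that] by (auto simp: projective_def)
  qed
  then show ?thesis using T Push_eq_zero_iff[OF assms(1)] by (simp add: presents_def)
qed

lemma presents_Ext_Pull:
  assumes "s_triangle \<C> X j J q S \<epsilon>" "injective \<C> J"
  shows "presents (opp \<C>) (\<lambda>A. Val (Ext \<C>) A X) (\<lambda>A B f. pl B A X f) S J q \<epsilon>"
proof -
  note T = s_triangleD[OF assms(1)]
  have "\<exists>h \<in> Arr \<C> A S. pl A S X h \<epsilon> = \<xi>" if "\<xi> \<in> Extn \<C> A X" for A \<xi>
  proof (rule Pull_surjective_on_kernel[OF assms(1) that])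
    show "ps A X J j \<xi> = \<zero>\<^bsub>Val (Ext \<C>) A J\<^esub>"
      using assms(2) Push_closed[OF T(1) that] by (auto simp: injective_def)
  qed
  then show ?thesis using T Pull_eq_zero_iff[OF assms(1)] by (simp add: presents_def)
qed

lemma presents_En_0_Push:
  assumes "s_triangle \<C> W i P p Y \<delta>" "projective \<C> P"
  shows "presents \<C> (\<lambda>A. Val (En 0) Y A) (\<lambda>A B f. Push (En 0) Y A B f) W P i (Hext_Ext \<delta>)"
  by (rule presents_image[OF presents_Ext_Push[OF assms]])
    (simp_all add: transport_simps[of Hext_Ext] inj_on_def Push_closed)

lemma presents_En_0_Pull:
  assumes "s_triangle \<C> X j J q S \<epsilon>" "injective \<C> J"
  shows "presents (opp \<C>) (\<lambda>A. Val (En 0) A X) (\<lambda>A B f. Pull (En 0) B A X f) S J q (Hext_Ext \<epsilon>)"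
  by (rule presents_image[OF presents_Ext_Pull[OF assms]])
    (simp_all add: transport_simps[of Hext_Ext] inj_on_def Pull_closed)

end

section \<open>Negative extensions through syzygies and cosyzygies\<close>

text \<open>
  Chosen triangles \<open>\<Omega>Y \<rightarrow> P \<rightarrow> Y\<close> with \<open>P\<close> projective and \<open>X \<rightarrow> J \<rightarrow> \<Sigma>X\<close> with \<open>J\<close> injective, of
  classes \<open>dl Y\<close> and \<open>ep X\<close>. The order of the parameters is such that the opposite category is
  obtained by exchanging the two blocks.
\<close>

locale resolved = extriangulated_category K \<C>
  for K :: "'k ring" and \<C> :: "('k, 'o, 'm, 'e, 'z) extricat_scheme" (structure) +
  fixes Om Pr :: "'o \<Rightarrow> 'o" and io pr :: "'o \<Rightarrow> 'm" and dl :: "'o \<Rightarrow> 'e"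
    and Sg In :: "'o \<Rightarrow> 'o" and qo jo :: "'o \<Rightarrow> 'm" and ep :: "'o \<Rightarrow> 'e"
  assumes syzygy: "s_triangle \<C> (Om Y) (io Y) (Pr Y) (pr Y) Y (dl Y)"
    and proj: "projective \<C> (Pr Y)"
    and cosyzygy: "s_triangle \<C> X (jo X) (In X) (qo X) (Sg X) (ep X)"
    and inj: "injective \<C> (In X)"
    and hom_fin: "hom_finite K \<C>"

lemma resolved_opp:
  assumes "resolved K \<C> Om Pr io pr dl Sg In qo jo ep"
  shows "resolved K (opp \<C>) Sg In qo jo ep Om Pr io pr dl"
proof -
  interpret resolved K \<C> Om Pr io pr dl Sg In qo jo ep by fact
  show ?thesis
    by (intro resolved.intro resolved_axioms.intro extriangulated_category_opp
        extriangulated_category_axioms)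
      (use syzygy proj cosyzygy inj hom_fin in
        \<open>simp_all add: s_triangle_opp projective_opp injective_opp hom_finite_def\<close>)
qed

context resolved
begin

text \<open>
  The dimensions of \<open>\<E>\<^sub>I\<^sup>-\<^sup>1(X, Y)\<close> and \<open>\<E>\<^sub>I\<^sub>I\<^sup>-\<^sup>1(X, Y)\<close>, computed with the chosen triangles. In the
  opposite category the two exchange roles, with \<open>X\<close> and \<open>Y\<close> swapped.
\<close>

definition syzygy_dim :: "'o \<Rightarrow> 'o \<Rightarrow> nat" where
  "syzygy_dim X Y = subdim K (Hom \<C> X (Om Y)) {u \<in> Arr \<C> X (Om Y). io Y \<cdot> u = \<zero>\<^bsub>Hom \<C> X (Pr Y)\<^esub>}"

definition cosyzygy_dim :: "'o \<Rightarrow> 'o \<Rightarrow> nat" where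
  "cosyzygy_dim X Y = subdim K (Hom \<C> (Sg X) Y) {v \<in> Arr \<C> (Sg X) Y. v \<cdot> qo X = \<zero>\<^bsub>Hom \<C> (In X) Y\<^esub>}"

lemma fin_dim_Hom: "vectorspace.fin_dim K (Hom \<C> X Y)"
  using hom_fin by (simp add: hom_finite_def)

text \<open>
  Here \<open>En n\<close> is \<open>\<E>\<^sup>n\<^sup>+\<^sup>1\<close>. The step is dimension shifting: \<open>\<E>\<^sup>n\<^sup>+\<^sup>2(Y, -)\<close> has the same presentation as
  \<open>\<E>\<^sup>n\<^sup>+\<^sup>1(\<Omega>Y, -)\<close>.
\<close>

lemma presents_En_Push:
  "\<exists>e. presents \<C> (\<lambda>A. Val (En n) Y A) (\<lambda>A B f. Push (En n) Y A B f)
    (Om ((Om ^^ n) Y)) (Pr ((Om ^^ n) Y)) (io ((Om ^^ n) Y)) e"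
proof (induction n arbitrary: Y)
  case 0
  show ?case using presents_En_0_Push[OF syzygy proj] by auto
next
  case (Suc n)
  obtain \<tau> where \<tau>: "composite K \<C> (En n) (Ext \<C>) (En (Suc n)) \<tau>" using En_composite by blast
  obtain e where e: "presents \<C> (\<lambda>A. Val (En n) (Om Y) A) (\<lambda>A B f. Push (En n) (Om Y) A B f)
    (Om ((Om ^^ Suc n) Y)) (Pr ((Om ^^ Suc n) Y)) (io ((Om ^^ Suc n) Y)) e"
    using Suc[of "Om Y"] by (auto simp: funpow_swap1)
  show ?case
    using composite.presents_left[OF \<tau> presents_Ext_Push[OF syzygy proj] En_projective[OF proj] e]
    by blast
qed

text \<open>
  Here the step shifts \<open>X\<close>: as \<open>\<E>\<^sup>n\<^sup>+\<^sup>1(-, X)\<close> is presented by the generator \<open>e\<close> over \<open>W = \<Sigma>\<^sup>n\<^sup>+\<^sup>1X\<close>,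
  the functor \<open>\<E>\<^sup>n\<^sup>+\<^sup>2(-, X)\<close> is isomorphic to \<open>\<E>(-, W)\<close>.
\<close>

lemma presents_En_Pull:
  "\<exists>e. presents (opp \<C>) (\<lambda>A. Val (En n) A X) (\<lambda>A B f. Pull (En n) B A X f)
    (Sg ((Sg ^^ n) X)) (In ((Sg ^^ n) X)) (qo ((Sg ^^ n) X)) e"
proof (induction n)
  case 0
  show ?case using presents_En_0_Pull[OF cosyzygy inj] by auto
next
  case (Suc n)
  obtain \<tau> where \<tau>: "composite K \<C> (En n) (Ext \<C>) (En (Suc n)) \<tau>" using En_composite by blast
  obtain e where e: "presents (opp \<C>) (\<lambda>A. Val (En n) A X) (\<lambda>A B f. Pull (En n) B A X f)
    (Sg ((Sg ^^ n) X)) (In ((Sg ^^ n) X)) (qo ((Sg ^^ n) X)) e" using Suc by blast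
  have J: "Extn \<C> A (In ((Sg ^^ n) X)) = {\<zero>\<^bsub>Val (Ext \<C>) A (In ((Sg ^^ n) X))\<^esub>}" for A
    using inj by (simp add: injective_def)
  show ?case
    using composite_presents_right[OF \<tau> e J presents_Ext_Pull[OF cosyzygy inj]] by auto
qed

lemma dim_neg_ext_I:
  "vectorspace.dim K (neg_ext_I K \<C> (Suc n) X Y) = syzygy_dim X ((Om ^^ n) Y)"
proof -
  interpret E: bilinear_bifunctor K \<C> "En n" by (rule En_bilinear)
  obtain e where "presents \<C> (\<lambda>A. Val (En n) Y A) (\<lambda>A B f. Push (En n) Y A B f)
    (Om ((Om ^^ n) Y)) (Pr ((Om ^^ n) Y)) (io ((Om ^^ n) Y)) e"
    using presents_En_Push by blast
  from linear_functor.presented_nat_space(2)[OF E.linear_functor_Push this fin_dim_Hom]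
  show ?thesis unfolding neg_ext_I_def syzygy_dim_def .
qed

lemma dim_neg_ext_II:
  "vectorspace.dim K (neg_ext_II K \<C> (Suc n) X Y) = cosyzygy_dim ((Sg ^^ n) X) Y"
proof -
  obtain e where e: "presents (opp \<C>) (\<lambda>A. Val (En n) A X) (\<lambda>A B f. Pull (En n) B A X f)
    (Sg ((Sg ^^ n) X)) (In ((Sg ^^ n) X)) (qo ((Sg ^^ n) X)) e"
    using presents_En_Pull by blast
  have "vectorspace.fin_dim K (Hom (opp \<C>) Y (Sg ((Sg ^^ n) X)))" using fin_dim_Hom by simp
  from linear_functor.presented_nat_space(2)[OF linear_functor_Pull[OF En_bilinear] e this]
  show ?thesis unfolding neg_ext_II_def cosyzygy_dim_def by simp
qed

text \<open>
  Inflations behave as monomorphisms with respect to arrows out of injective objects. In the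
  opposite category this is the condition on deflations and projective objects.
\<close>

definition monic_on_injectives :: bool where
  "monic_on_injectives \<longleftrightarrow>
    (\<forall>I A B x. injective \<C> I \<and> inflation \<C> A B x \<longrightarrow> inj_on (\<lambda>f. x \<cdot> f) (Arr \<C> I A))"

lemma monic_on_injectives_cancel:
  assumes "monic_on_injectives" "s \<in> Arr \<C> (In X) (Om Y)" "io Y \<cdot> s = \<zero>\<^bsub>Hom \<C> (In X) (Pr Y)\<^esub>"
  shows "s = \<zero>\<^bsub>Hom \<C> (In X) (Om Y)\<^esub>"
proof -
  have "inflation \<C> (Om Y) (Pr Y) (io Y)" using syzygy by (auto simp: inflation_def)
  then have "inj_on (\<lambda>f. io Y \<cdot> f) (Arr \<C> (In X) (Om Y))"
    using assms(1) inj unfolding monic_on_injectives_def by blast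
  moreover have "io Y \<cdot> s = io Y \<cdot> \<zero>\<^bsub>Hom \<C> (In X) (Om Y)\<^esub>"
    using assms(3) Comp_zero_right[OF s_triangleD(1)[OF syzygy]] by simp
  ultimately show ?thesis using assms(2) by (simp add: inj_on_def)
qed

text \<open>
  If \<open>I\<close> is injective, then \<open>I \<rightarrow> J \<rightarrow> \<Sigma>I\<close> splits, so an arrow out of \<open>\<Sigma>I\<close> killed by \<open>J \<rightarrow> \<Sigma>I\<close> is zero.
\<close>

lemma cosyzygy_dim_injective:
  assumes "injective \<C> I" shows "cosyzygy_dim I Y = 0"
proof -
  note T = s_triangleD[OF cosyzygy]
  have "ep I = \<zero>\<^bsub>Val (Ext \<C>) (Sg I) I\<^esub>" using assms T(3)[of I] by (auto simp: injective_def)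
  then have "pl (Sg I) (Sg I) I (Ident \<C> (Sg I)) (ep I) = \<zero>\<^bsub>Val (Ext \<C>) (Sg I) I\<^esub>"
    using Pull_zero[OF Ident_Arr] by simp
  then obtain g where g: "g \<in> Arr \<C> (Sg I) (In I)" "Ident \<C> (Sg I) = qo I \<cdot> g"
    using Pull_eq_zero_iff[OF cosyzygy Ident_Arr] by blast
  have "v = \<zero>\<^bsub>Hom \<C> (Sg I) Y\<^esub>"
    if v: "v \<in> Arr \<C> (Sg I) Y" "v \<cdot> qo I = \<zero>\<^bsub>Hom \<C> (In I) Y\<^esub>" for v
  proof -
    have "v = v \<cdot> (qo I \<cdot> g)" using Comp_Ident_right[OF v(1)] g(2) by simp
    also have "\<dots> = (v \<cdot> qo I) \<cdot> g" using Comp_assoc[OF g(1) T(2) v(1)] by simp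
    also have "\<dots> = \<zero>\<^bsub>Hom \<C> (Sg I) Y\<^esub>" using v(2) Comp_zero_left[OF g(1)] by simp
    finally show ?thesis .
  qed
  then have "{v \<in> Arr \<C> (Sg I) Y. v \<cdot> qo I = \<zero>\<^bsub>Hom \<C> (In I) Y\<^esub>} = {\<zero>\<^bsub>Hom \<C> (Sg I) Y\<^esub>}"
    using Comp_zero_left T(2) by auto
  then show ?thesis using subdim_zero[OF vectorspace_Hom] by (simp add: cosyzygy_dim_def)
qed

text \<open>
  For \<open>I\<close> injective both negative extensions of \<open>I\<close> vanish, that is, an arrow from \<open>I\<close> to a syzygy
  which is killed by the inflation into the projective is zero. The inflations of the chosen
  triangles suffice, because an arrow killed by an arbitrary inflation lifts to a syzygy.
\<close>

lemma monic_on_injectivesI: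
  assumes "\<And>X Y. syzygy_dim X Y = cosyzygy_dim X Y" shows "monic_on_injectives"
  unfolding monic_on_injectives_def
proof (intro allI impI inj_onI, elim conjE)
  fix I A B x f f'
  assume I: "injective \<C> I" and x: "inflation \<C> A B x"
    and f: "f \<in> Arr \<C> I A" "f' \<in> Arr \<C> I A" and eq: "x \<cdot> f = x \<cdot> f'"
  obtain y Z \<delta> where t: "s_triangle \<C> A x B y Z \<delta>" using x by (auto simp: inflation_def)
  note T = s_triangleD[OF t]
  let ?d = "f \<ominus>\<^bsub>Hom \<C> I A\<^esub> f'"
  have d: "?d \<in> Arr \<C> I A" using f by simp
  have "x \<cdot> ?d = \<zero>\<^bsub>Hom \<C> I B\<^esub>"
    using Comp_diff_right[OF T(1) f] eq Comp_Arr[OF f(2) T(1)] by simp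
  from lift_along_inflation[OF t syzygy proj d this]
  obtain a k where a: "a \<in> Arr \<C> (Om Z) A" and k: "k \<in> Arr \<C> I (Om Z)" "?d = a \<cdot> k"
    "io Z \<cdot> k = \<zero>\<^bsub>Hom \<C> I (Pr Z)\<^esub>" by blast
  have "syzygy_dim I Z = 0" using assms cosyzygy_dim_injective[OF I] by simp
  then have "{u \<in> Arr \<C> I (Om Z). io Z \<cdot> u = \<zero>\<^bsub>Hom \<C> I (Pr Z)\<^esub>} = {\<zero>\<^bsub>Hom \<C> I (Om Z)\<^esub>}"
    unfolding syzygy_dim_def
    using subdim_eq_0_imp_trivial[OF annihilated_subspace[OF s_triangleD(1)[OF syzygy]] fin_dim_Hom] by blast
  then have "k = \<zero>\<^bsub>Hom \<C> I (Om Z)\<^esub>" using k by blast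
  then have "?d = \<zero>\<^bsub>Hom \<C> I A\<^esub>" using k(2) Comp_zero_right[OF a] by simp
  then show "f = f'" using f by simp
qed

text \<open>
  Together with its dual, this says that the connecting maps \<open>u \<mapsto> u\<^sub>* \<epsilon>\<close> and \<open>v \<mapsto> v\<^sup>* \<delta>\<close> from the two
  negative extensions of \<open>(X, Y)\<close> to \<open>\<E>(\<Sigma>X, \<Omega>Y)\<close> have the same image. Given \<open>u\<close>, the pair \<open>(u, v)\<close>
  with \<open>u\<^sub>* \<epsilon> = v\<^sup>* \<delta>\<close> extends to a morphism of triangles, whose middle component \<open>b\<close> factors
  through \<open>J \<rightarrow> \<Sigma>X\<close> by some \<open>c\<close>; subtracting the image of \<open>c\<close> corrects \<open>v\<close> to an arrow that
  vanishes on \<open>J\<close>.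
\<close>

lemma connecting_subset:
  "(\<lambda>u. ps (Sg X) X (Om Y) u (ep X)) ` {u \<in> Arr \<C> X (Om Y). io Y \<cdot> u = \<zero>\<^bsub>Hom \<C> X (Pr Y)\<^esub>}
    \<subseteq> (\<lambda>v. pl (Sg X) Y (Om Y) v (dl Y)) ` {v \<in> Arr \<C> (Sg X) Y. v \<cdot> qo X = \<zero>\<^bsub>Hom \<C> (In X) Y\<^esub>}"
proof clarify
  fix u assume u: "u \<in> Arr \<C> X (Om Y)" "io Y \<cdot> u = \<zero>\<^bsub>Hom \<C> X (Pr Y)\<^esub>"
  note T = s_triangleD[OF syzygy[of Y]] and Q = s_triangleD[OF cosyzygy[of X]]
  let ?\<epsilon> = "ps (Sg X) X (Om Y) u (ep X)"
  have "ps (Sg X) (Om Y) (Pr Y) (io Y) ?\<epsilon> = \<zero>\<^bsub>Val (Ext \<C>) (Sg X) (Pr Y)\<^esub>"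
    using Push_Comp[OF u(1) T(1) Q(3)] u(2) Push_zero_arrow[OF Q(3)] by simp
  then obtain v where v: "v \<in> Arr \<C> (Sg X) Y" "pl (Sg X) Y (Om Y) v (dl Y) = ?\<epsilon>"
    using Pull_surjective_on_kernel[OF syzygy Push_closed[OF u(1) Q(3)]] by blast
  obtain b where b: "b \<in> Arr \<C> (In X) (Pr Y)" "b \<cdot> jo X = io Y \<cdot> u" "pr Y \<cdot> b = v \<cdot> qo X"
    using realization[OF cosyzygy syzygy u(1) v(1) v(2)[symmetric]] by blast
  obtain c where c: "c \<in> Arr \<C> (Sg X) (Pr Y)" "b = c \<cdot> qo X"
    using factor_through_deflation[OF cosyzygy b(1)] b(2) u(2) by auto
  have pc: "pr Y \<cdot> c \<in> Arr \<C> (Sg X) Y" by (rule Comp_Arr[OF c(1) T(2)])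
  let ?v = "v \<ominus>\<^bsub>Hom \<C> (Sg X) Y\<^esub> pr Y \<cdot> c"
  have "?v \<cdot> qo X = \<zero>\<^bsub>Hom \<C> (In X) Y\<^esub>"
    using Comp_diff_left[OF Q(2) v(1) pc] Comp_assoc[OF Q(2) c(1) T(2)] b(3) c(2)
      Comp_Arr[OF Q(2) v(1)] by simp
  moreover have "pl (Sg X) Y (Om Y) (pr Y \<cdot> c) (dl Y) = \<zero>\<^bsub>Val (Ext \<C>) (Sg X) (Om Y)\<^esub>"
    using Pull_eq_zero_iff[OF syzygy pc] c(1) by blast
  then have "pl (Sg X) Y (Om Y) ?v (dl Y) = ?\<epsilon>"
    using Pull_diff_arrow[OF T(3) v(1) pc] v(2) Pull_closed[OF v(1) T(3)]
      Val.M.r_neg[OF Val.M.zero_closed] by (simp add: a_minus_def)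
  moreover have "?v \<in> Arr \<C> (Sg X) Y" using v(1) pc by simp
  ultimately show "?\<epsilon> \<in> (\<lambda>v. pl (Sg X) Y (Om Y) v (dl Y)) `
      {v \<in> Arr \<C> (Sg X) Y. v \<cdot> qo X = \<zero>\<^bsub>Hom \<C> (In X) Y\<^esub>}"
    by (intro image_eqI[of _ _ ?v]) simp_all
qed

text \<open>
  By rank and nullity \<open>\<E>\<^sub>I\<^sup>-\<^sup>1(X, Y)\<close> splits into the image \<open>I\<close> of its connecting map and the kernel of
  that map, which consists of the restrictions to \<open>X\<close> of the arrows \<open>s : J \<rightarrow> \<Omega>Y\<close> whose image in
  \<open>\<C>(X, P)\<close> is zero. By hypothesis \<open>s\<close> is determined by \<open>i \<cdot> s\<close>; this identifies those \<open>s\<close> with \<open>B\<close>, and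
  the ones that vanish on \<open>X\<close> with \<open>B0\<close>. The terms \<open>B\<close> and \<open>B0\<close> are self-dual, and so is \<open>I\<close> as a
  common image, so the dual formula for \<open>\<E>\<^sub>I\<^sub>I\<^sup>-\<^sup>1(X, Y)\<close> has the same terms.
\<close>

lemma syzygy_dim_formula:
  fixes X Y
  assumes lf: monic_on_injectives
  defines "I \<equiv> (\<lambda>u. ps (Sg X) X (Om Y) u (ep X)) `
      {u \<in> Arr \<C> X (Om Y). io Y \<cdot> u = \<zero>\<^bsub>Hom \<C> X (Pr Y)\<^esub>}"
    and "B \<equiv> {b \<in> Arr \<C> (In X) (Pr Y). b \<cdot> jo X = \<zero>\<^bsub>Hom \<C> X (Pr Y)\<^esub> \<and> pr Y \<cdot> b = \<zero>\<^bsub>Hom \<C> (In X) Y\<^esub>}"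
    and "B0 \<equiv> (\<lambda>t. io Y \<cdot> (t \<cdot> qo X)) ` Arr \<C> (Sg X) (Om Y)"
  shows "syzygy_dim X Y + subdim K (Hom \<C> (In X) (Pr Y)) B0
    = subdim K (Val (Ext \<C>) (Sg X) (Om Y)) I + subdim K (Hom \<C> (In X) (Pr Y)) B"
proof -
  note T = s_triangleD[OF syzygy[of Y]] and Q = s_triangleD[OF cosyzygy[of X]]
  let ?O = "Om Y" and ?P = "Pr Y" and ?J = "In X" and ?i = "io Y" and ?j = "jo X" and ?q = "qo X"
  let ?Ker = "{u \<in> Arr \<C> X ?O. ?i \<cdot> u = \<zero>\<^bsub>Hom \<C> X ?P\<^esub>}"
  have U1: "subspace K ?Ker (Hom \<C> X ?O)" by (rule annihilated_subspace[OF T(1)])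
  have full: "subspace K (Arr \<C> A D) (Hom \<C> A D)" for A D
    by (rule subspaceI[OF vectorspace_Hom]) auto
  note ih = Comp_linear_right[OF T(1)] and jh = Comp_linear_left[OF Q(1)]
  let ?U = "{u \<in> ?Ker. ps (Sg X) X ?O u (ep X) = \<zero>\<^bsub>Val (Ext \<C>) (Sg X) ?O\<^esub>}"
  have 1: "syzygy_dim X Y = subdim K (Val (Ext \<C>) (Sg X) ?O) I + subdim K (Hom \<C> X ?O) ?U"
    unfolding syzygy_dim_def I_def
    by (rule rank_nullity_subspace[OF vectorspace_Hom fin_dim_Hom vectorspace_Val Push_linear[OF Q(3)] U1])
  let ?S = "{s \<in> Arr \<C> ?J ?O. ?i \<cdot> (s \<cdot> ?j) = \<zero>\<^bsub>Hom \<C> X ?P\<^esub>}"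
  have S: "subspace K ?S (Hom \<C> ?J ?O)"
    using linear_kernel_subspace[OF vectorspace_Hom vectorspace_Hom module_hom_comp[OF jh ih] full] .
  have SU: "(\<lambda>s. s \<cdot> ?j) ` ?S = ?U"
  proof (intro equalityI subsetI)
    fix u assume "u \<in> (\<lambda>s. s \<cdot> ?j) ` ?S"
    then obtain s where s: "s \<in> Arr \<C> ?J ?O" "?i \<cdot> (s \<cdot> ?j) = \<zero>\<^bsub>Hom \<C> X ?P\<^esub>" "u = s \<cdot> ?j" by blast
    moreover have "s \<cdot> ?j \<in> Arr \<C> X ?O" by (rule Comp_Arr[OF Q(1) s(1)])
    ultimately show "u \<in> ?U" using Push_eq_zero_iff[OF cosyzygy] by blast
  next
    fix u assume "u \<in> ?U"
    then show "u \<in> (\<lambda>s. s \<cdot> ?j) ` ?S" using Push_eq_zero_iff[OF cosyzygy] by blast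
  qed
  let ?Sz = "{s \<in> ?S. s \<cdot> ?j = \<zero>\<^bsub>Hom \<C> X ?O\<^esub>}"
  have 2: "subdim K (Hom \<C> ?J ?O) ?S = subdim K (Hom \<C> X ?O) ?U + subdim K (Hom \<C> ?J ?O) ?Sz"
    using rank_nullity_subspace[OF vectorspace_Hom fin_dim_Hom vectorspace_Hom jh S] unfolding SU .
  have SB: "(\<lambda>s. ?i \<cdot> s) ` ?S = B"
  proof (intro equalityI subsetI)
    fix b assume "b \<in> (\<lambda>s. ?i \<cdot> s) ` ?S"
    then obtain s where s: "s \<in> Arr \<C> ?J ?O" "?i \<cdot> (s \<cdot> ?j) = \<zero>\<^bsub>Hom \<C> X ?P\<^esub>" "b = ?i \<cdot> s" by blast
    then show "b \<in> B"
      using Comp_Arr[OF s(1) T(1)] Comp_assoc[OF Q(1) s(1) T(1)] Comp_assoc[OF s(1) T(1,2), symmetric]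
        deflation_inflation_zero[OF syzygy] Comp_zero_left[OF s(1)] by (simp add: B_def)
  next
    fix b assume "b \<in> B"
    then have b: "b \<in> Arr \<C> ?J ?P" "b \<cdot> ?j = \<zero>\<^bsub>Hom \<C> X ?P\<^esub>" "pr Y \<cdot> b = \<zero>\<^bsub>Hom \<C> ?J Y\<^esub>"
      by (auto simp: B_def)
    obtain s where s: "s \<in> Arr \<C> ?J ?O" "b = ?i \<cdot> s"
      using factor_through_inflation[OF syzygy b(1,3)] by blast
    then have "s \<in> ?S" using b(2) Comp_assoc[OF Q(1) s(1) T(1)] by simp
    then show "b \<in> (\<lambda>s. ?i \<cdot> s) ` ?S" using s(2) by blast
  qed
  have 3: "subdim K (Hom \<C> ?J ?P) B = subdim K (Hom \<C> ?J ?O) ?S"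
    using subdim_injective_image[OF vectorspace_Hom fin_dim_Hom vectorspace_Hom ih S]
      monic_on_injectives_cancel[OF lf] unfolding SB by blast
  have S0: "subspace K ?Sz (Hom \<C> ?J ?O)"
    by (rule linear_kernel_subspace[OF vectorspace_Hom vectorspace_Hom jh S])
  have SB0: "(\<lambda>s. ?i \<cdot> s) ` ?Sz = B0"
  proof (intro equalityI subsetI)
    fix b assume "b \<in> (\<lambda>s. ?i \<cdot> s) ` ?Sz"
    then obtain s where s: "s \<in> Arr \<C> ?J ?O" "s \<cdot> ?j = \<zero>\<^bsub>Hom \<C> X ?O\<^esub>" "b = ?i \<cdot> s" by blast
    then show "b \<in> B0"
      using factor_through_deflation[OF cosyzygy s(1,2)] by (auto simp: B0_def)
  next
    fix b assume "b \<in> B0"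
    then obtain t where t: "t \<in> Arr \<C> (Sg X) ?O" "b = ?i \<cdot> (t \<cdot> ?q)" by (auto simp: B0_def)
    have "(t \<cdot> ?q) \<cdot> ?j = \<zero>\<^bsub>Hom \<C> X ?O\<^esub>"
      using Comp_assoc[OF Q(1,2) t(1)] deflation_inflation_zero[OF cosyzygy] Comp_zero_right[OF t(1)]
      by simp
    then have "t \<cdot> ?q \<in> ?Sz" using Comp_Arr[OF Q(2) t(1)] Comp_zero_right[OF T(1)] by simp
    then show "b \<in> (\<lambda>s. ?i \<cdot> s) ` ?Sz" using t(2) by blast
  qed
  have 4: "subdim K (Hom \<C> ?J ?P) B0 = subdim K (Hom \<C> ?J ?O) ?Sz"
    using subdim_injective_image[OF vectorspace_Hom fin_dim_Hom vectorspace_Hom ih S0]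
      monic_on_injectives_cancel[OF lf] unfolding SB0 by blast
  show ?thesis using 1 2 3 4 by simp
qed

abbreviation "opp_monic_on_injectives \<equiv> resolved.monic_on_injectives (opp \<C>)"

lemma syzygy_dim_eq_cosyzygy_dim:
  assumes lf: monic_on_injectives and rf: opp_monic_on_injectives
  shows "syzygy_dim X Y = cosyzygy_dim X Y"
proof -
  interpret opp: resolved K "opp \<C>" Sg In qo jo ep Om Pr io pr dl
    by (rule resolved_opp) unfold_locales
  note T = s_triangleD[OF syzygy[of Y]] and Q = s_triangleD[OF cosyzygy[of X]]
  let ?I = "(\<lambda>u. ps (Sg X) X (Om Y) u (ep X)) ` {u \<in> Arr \<C> X (Om Y). io Y \<cdot> u = \<zero>\<^bsub>Hom \<C> X (Pr Y)\<^esub>}"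
  let ?I' = "(\<lambda>v. pl (Sg X) Y (Om Y) v (dl Y)) ` {v \<in> Arr \<C> (Sg X) Y. v \<cdot> qo X = \<zero>\<^bsub>Hom \<C> (In X) Y\<^esub>}"
  have I: "?I' = ?I"
    using connecting_subset[of X Y] opp.connecting_subset[of Y X] by simp
  have B0: "(\<lambda>t. (io Y \<cdot> t) \<cdot> qo X) ` Arr \<C> (Sg X) (Om Y)
      = (\<lambda>t. io Y \<cdot> (t \<cdot> qo X)) ` Arr \<C> (Sg X) (Om Y)"
    using Comp_assoc[OF Q(2) _ T(1)] by (intro image_cong) auto
  have B: "{b \<in> Arr \<C> (In X) (Pr Y). pr Y \<cdot> b = \<zero>\<^bsub>Hom \<C> (In X) Y\<^esub> \<and> b \<cdot> jo X = \<zero>\<^bsub>Hom \<C> X (Pr Y)\<^esub>}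
      = {b \<in> Arr \<C> (In X) (Pr Y). b \<cdot> jo X = \<zero>\<^bsub>Hom \<C> X (Pr Y)\<^esub> \<and> pr Y \<cdot> b = \<zero>\<^bsub>Hom \<C> (In X) Y\<^esub>}"
    by auto
  have k: "opp.syzygy_dim Y X = cosyzygy_dim X Y" by (simp add: opp.syzygy_dim_def cosyzygy_dim_def)
  show ?thesis
    using syzygy_dim_formula[OF lf, of X Y] opp.syzygy_dim_formula[OF rf, of Y X]
    unfolding opp_simps k B0 B I by simp
qed

lemma opp_monic_on_injectivesI:
  assumes "\<And>X Y. syzygy_dim X Y = cosyzygy_dim X Y" shows opp_monic_on_injectives
proof -
  interpret opp: resolved K "opp \<C>" Sg In qo jo ep Om Pr io pr dl
    by (rule resolved_opp) unfold_locales
  have "opp.syzygy_dim Y X = cosyzygy_dim X Y" "opp.cosyzygy_dim Y X = syzygy_dim X Y" for X Y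
    by (simp_all add: opp.syzygy_dim_def cosyzygy_dim_def opp.cosyzygy_dim_def syzygy_dim_def)
  then show ?thesis using assms by (intro opp.monic_on_injectivesI) simp
qed

lemma opp_monic_on_injectives_iff:
  "opp_monic_on_injectives \<longleftrightarrow>
    (\<forall>P B Z y. projective \<C> P \<and> deflation \<C> B Z y \<longrightarrow> inj_on (\<lambda>g. g \<cdot> y) (Arr \<C> Z P))"
proof -
  interpret opp: resolved K "opp \<C>" Sg In qo jo ep Om Pr io pr dl
    by (rule resolved_opp) unfold_locales
  show ?thesis
    unfolding opp.monic_on_injectives_def opp_simps injective_opp inflation_opp by blast
qed

text \<open>
  Both \<open>\<E>\<^sub>I\<^sub>I\<^sup>-\<^sup>1(X, \<Omega>Y)\<close> and \<open>\<E>\<^sub>I\<^sup>-\<^sup>1(\<Sigma>X, Y)\<close> are subspaces of \<open>\<C>(\<Sigma>X, \<Omega>Y)\<close>, defined by \<open>t \<cdot> q = 0\<close> and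
  by \<open>i \<cdot> t = 0\<close>. Under the two conditions each equation is equivalent to \<open>i \<cdot> t \<cdot> q = 0\<close>.
\<close>

lemma cosyzygy_dim_Om_eq_syzygy_dim_Sg:
  assumes lf: monic_on_injectives and rf: opp_monic_on_injectives
  shows "cosyzygy_dim X (Om Y) = syzygy_dim (Sg X) Y"
proof -
  interpret opp: resolved K "opp \<C>" Sg In qo jo ep Om Pr io pr dl
    by (rule resolved_opp) unfold_locales
  note T = s_triangleD[OF syzygy[of Y]] and Q = s_triangleD[OF cosyzygy[of X]]
  have "t \<cdot> qo X = \<zero>\<^bsub>Hom \<C> (In X) (Om Y)\<^esub> \<longleftrightarrow> io Y \<cdot> t = \<zero>\<^bsub>Hom \<C> (Sg X) (Pr Y)\<^esub>"
    if t: "t \<in> Arr \<C> (Sg X) (Om Y)" for t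
  proof -
    have tq: "t \<cdot> qo X \<in> Arr \<C> (In X) (Om Y)" and it: "io Y \<cdot> t \<in> Arr \<C> (Sg X) (Pr Y)"
      using Comp_Arr[OF Q(2) t] Comp_Arr[OF t T(1)] .
    have "t \<cdot> qo X = \<zero>\<^bsub>Hom \<C> (In X) (Om Y)\<^esub> \<longleftrightarrow> io Y \<cdot> (t \<cdot> qo X) = \<zero>\<^bsub>Hom \<C> (In X) (Pr Y)\<^esub>"
      using monic_on_injectives_cancel[OF lf tq] Comp_zero_right[OF T(1)] by auto
    also have "\<dots> \<longleftrightarrow> (io Y \<cdot> t) \<cdot> qo X = \<zero>\<^bsub>Hom \<C> (In X) (Pr Y)\<^esub>"
      using Comp_assoc[OF Q(2) t T(1)] by simp
    also have "\<dots> \<longleftrightarrow> io Y \<cdot> t = \<zero>\<^bsub>Hom \<C> (Sg X) (Pr Y)\<^esub>"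
      using opp.monic_on_injectives_cancel[OF rf, of "io Y \<cdot> t" Y X] it Comp_zero_left[OF Q(2)] by auto
    finally show ?thesis .
  qed
  then show ?thesis
    unfolding cosyzygy_dim_def syzygy_dim_def by (intro arg_cong[where f = "subdim K _"]) auto
qed

lemma syzygy_dim_Om_eq_cosyzygy_dim_Sg:
  assumes lf: monic_on_injectives and rf: opp_monic_on_injectives
  shows "syzygy_dim X ((Om ^^ n) Y) = cosyzygy_dim ((Sg ^^ n) X) Y"
proof (induction n arbitrary: X)
  case 0
  show ?case using syzygy_dim_eq_cosyzygy_dim[OF lf rf] by simp
next
  case (Suc n)
  have "syzygy_dim X ((Om ^^ Suc n) Y) = cosyzygy_dim X (Om ((Om ^^ n) Y))"
    using syzygy_dim_eq_cosyzygy_dim[OF lf rf] by simp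
  also have "\<dots> = syzygy_dim (Sg X) ((Om ^^ n) Y)"
    by (rule cosyzygy_dim_Om_eq_syzygy_dim_Sg[OF lf rf])
  also have "\<dots> = cosyzygy_dim ((Sg ^^ n) (Sg X)) Y" by (rule Suc)
  finally show ?case by (simp add: funpow_swap1)
qed

lemma monic_on_injectives_iff_dim_eq:
  "monic_on_injectives \<and> opp_monic_on_injectives \<longleftrightarrow>
    (\<forall>X Y. vectorspace.dim K (neg_ext_I K \<C> 1 X Y) = vectorspace.dim K (neg_ext_II K \<C> 1 X Y))"
  using dim_neg_ext_I[of 0] dim_neg_ext_II[of 0] syzygy_dim_eq_cosyzygy_dim
    monic_on_injectivesI opp_monic_on_injectivesI
  by auto

lemma dim_eq_one_iff_dim_eq_all:
  "(\<forall>X Y. vectorspace.dim K (neg_ext_I K \<C> 1 X Y) = vectorspace.dim K (neg_ext_II K \<C> 1 X Y)) \<longleftrightarrow>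
    (\<forall>X Y. \<forall>n > 0. vectorspace.dim K (neg_ext_I K \<C> n X Y) = vectorspace.dim K (neg_ext_II K \<C> n X Y))"
proof
  assume "\<forall>X Y. vectorspace.dim K (neg_ext_I K \<C> 1 X Y) = vectorspace.dim K (neg_ext_II K \<C> 1 X Y)"
  then have f: monic_on_injectives opp_monic_on_injectives using monic_on_injectives_iff_dim_eq by auto
  show "\<forall>X Y. \<forall>n > 0. vectorspace.dim K (neg_ext_I K \<C> n X Y) = vectorspace.dim K (neg_ext_II K \<C> n X Y)"
  proof (intro allI impI)
    fix X Y and n :: nat assume "n > 0"
    then obtain m where "n = Suc m" by (cases n) auto
    then show "vectorspace.dim K (neg_ext_I K \<C> n X Y) = vectorspace.dim K (neg_ext_II K \<C> n X Y)"
      using dim_neg_ext_I[of m] dim_neg_ext_II[of m]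
        syzygy_dim_Om_eq_cosyzygy_dim_Sg[OF f, of X m Y] by simp
  qed
qed auto

end

section \<open>The equivalence\<close>

lemma resolved_exists:
  fixes \<C> :: "('k, 'o, 'm, 'e) extricat"
  assumes "extriangulated_category K \<C>" "hom_finite K \<C>" "enough_projectives \<C>" "enough_injectives \<C>"
  shows "\<exists>Om Pr io pr dl Sg In qo jo ep. resolved K \<C> Om Pr io pr dl Sg In qo jo ep"
proof -
  have "\<forall>Y. \<exists>W P i p \<delta>. projective \<C> P \<and> s_triangle \<C> W i P p Y \<delta>"
    using assms(3) unfolding enough_projectives_def deflation_def by blast
  then obtain Om Pr io pr dl where
    P: "\<And>Y. projective \<C> (Pr Y) \<and> s_triangle \<C> (Om Y) (io Y) (Pr Y) (pr Y) Y (dl Y)" by metis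
  have "\<forall>X. \<exists>S J j q \<epsilon>. injective \<C> J \<and> s_triangle \<C> X j J q S \<epsilon>"
    using assms(4) unfolding enough_injectives_def inflation_def by blast
  then obtain Sg In jo qo ep where
    I: "\<And>X. injective \<C> (In X) \<and> s_triangle \<C> X (jo X) (In X) (qo X) (Sg X) (ep X)" by metis
  have "resolved K \<C> Om Pr io pr dl Sg In qo jo ep"
    using assms(1,2) P I by (auto simp: resolved_def resolved_axioms_def)
  then show ?thesis by blast
qed

theorem proposition5p29:
  fixes K :: "'k ring" and \<C> :: "('k, 'o, 'm, 'e) extricat"
  assumes "extriangulated_category K \<C>"
    and "hom_finite K \<C>"
    and "enough_projectives \<C>"
    and "enough_injectives \<C>"
  shows
    "(((\<forall>I A B x. injective \<C> I \<and> inflation \<C> A B x \<longrightarrow> inj_on (\<lambda>f. x \<cdot>\<^bsub>\<C>\<^esub> f) (Arr \<C> I A)) \<and>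
       (\<forall>P B Z y. projective \<C> P \<and> deflation \<C> B Z y \<longrightarrow> inj_on (\<lambda>g. g \<cdot>\<^bsub>\<C>\<^esub> y) (Arr \<C> Z P)))
      \<longleftrightarrow>
      (\<forall>X Y. vectorspace.dim K (neg_ext_I K \<C> 1 X Y) = vectorspace.dim K (neg_ext_II K \<C> 1 X Y)))
     \<and>
     ((\<forall>X Y. vectorspace.dim K (neg_ext_I K \<C> 1 X Y) = vectorspace.dim K (neg_ext_II K \<C> 1 X Y))
      \<longleftrightarrow>
      (\<forall>X Y. \<forall>n > 0.
         vectorspace.dim K (neg_ext_I K \<C> n X Y) = vectorspace.dim K (neg_ext_II K \<C> n X Y)))"
proof -
  obtain Om Pr io pr dl Sg In qo jo ep where "resolved K \<C> Om Pr io pr dl Sg In qo jo ep"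
    using resolved_exists[OF assms] by blast
  then interpret resolved K \<C> Om Pr io pr dl Sg In qo jo ep .
  show ?thesis
    using monic_on_injectives_iff_dim_eq dim_eq_one_iff_dim_eq_all
    unfolding monic_on_injectives_def opp_monic_on_injectives_iff by blast
qed

end
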